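(* Let $\Bbbk$, $A$, $f$, $A_f$ be as in the context and let $S$ be the direct sum of all the simple $A$-modules $S_1,\dots,S_n$ (one from each isomorphism class). Assume that $S$ satisfies condition $(\ast A)$, and let $T_{\delta_i}\colon Q_i\to Q_{i-1}$ ($i\ge 1$) be the associated linear maps described in the context. Identify $\operatorname{Ext}^*_{A_f}(S,S)$ with $\operatorname{Ext}^*_A(S,S)\otimes_\Bbbk \Bbbk[x]$ as in the context. Denote by $\circ$ and $\star$ the Yoneda products in $\operatorname{Ext}^*_{A_f}(S,S)$ and $\operatorname{Ext}^*_A(S,S)$ respectively. Then for all integers $p,m\ge 0$ the product of $\hat g=\sum_{s=0}^{p} g_s\,x^{p-s}\in\operatorname{Ext}^p_{A_f}(S,S)$ and $\hat h=\sum_{i=0}^m h_i\,x^{m-i}\in \operatorname{Ext}^m_{A_f}(S,S)$ (with $g_s\in\operatorname{Ext}^s_A(S,S)$, $h_i\in\operatorname{Ext}^i_A(S,S)$) is given by linearity and by $$ h_i x^{m-i}\circ g_s x^{p-s} = (-1)^{s(m-i)}\,(h_i\star g_s)\, x^{m+p-i-s} + \sum_{l=s+1}^{m+p-i} c_{i,s,l}\;\bigl(h_i\star (g_s T_{\delta_{s+1}}T_{\delta_{s+2}}\cdots T_{\delta_l})\bigr)\, x^{m+p-i-l}$$ for certain integers $c_{i,s,l}$. Here $g_sT_{\delta_{s+1}}\cdots T_{\delta_l}\colon Q_l\to S$ is the composition, regarded as an element of $\operatorname{Hom}_A(Q_l,S)=\operatorname{Ext}^l_A(S,S)$.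
   Context: Setting. $\Bbbk$ is an algebraically closed field, $A$ a finite dimensional associative unital $\Bbbk$-algebra, all modules are finite dimensional left modules. $1=\sum_{i=1}^n e_i$ is a decomposition into primitive orthogonal idempotents such that $P_i=Ae_i$ ($1\le i\le n$) form a complete set of representatives of isomorphism classes of indecomposable projective $A$-modules; $S_i=P_i/\operatorname{rad}P_i$. $f\colon A\otimes_\Bbbk A\to A$ is a Hochschild $2$-cocycle: $af(b\otimes c)-f(ab\otimes c)+f(a\otimes bc)-f(a\otimes b)c=0$. $A_f=A[t]/(t^2)\simeq A\oplus A$ is the algebra with product $(a_0+a_1t)(b_0+b_1t)=a_0b_0+(a_0b_1+a_1b_0+f(a_0\otimes b_0))t$. $A_f$-modules. $\operatorname{mod}A_f$ is identified with the category of tuples $(M_0,M_1,T_M,f_M)$, $M_0,M_1\in\operatorname{mod}A$, $T_M\in\operatorname{Hom}_A(M_0,M_1)$ a monomorphism, $f_M\in\operatorname{Hom}_\Bbbk(A\otimes_\Bbbk M_0,M_1)$ with $af_M(b\otimes m)-f_M(ab\otimes m)+f_M(a\otimes bm)-f(a\otimes b)T_M(m)=0$; the tuple corresponds to $M_0\oplus M_1$ with $(a+bt)(m_0,m_1)=(am_0,\,am_1+bT_M(m_0)+f_M(a\otimes m_0))$. Morphisms $(M_0,M_1,T_M,f_M)\to(N_0,N_1,T_N,f_N)$ are triples $(u_0,u_1,u_2)$, $u_0\in\operatorname{Hom}_A(M_0,N_0)$, $u_2\in\operatorname{Hom}_A(M_1,N_1)$, $u_1\in\operatorname{Hom}_\Bbbk(M_0,N_1)$,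 with $T_Nu_0=u_2T_M$ and $u_1(am)=au_1(m)-u_2(f_M(a\otimes m))+f_N(a\otimes u_0(m))$; composition is $(v_0,v_1,v_2)(u_0,u_1,u_2)=(v_0u_0,\,v_2u_1+v_1u_0,\,v_2u_2)$. An $A$-module $M$ is viewed as the $A_f$-module $(0,M,0,0)$. Projectives. Every projective $A$-module $Q$ is taken with a decomposition $Q=\bigoplus_{r=1}^m Ae_{i_r}$; for $x=\sum x_r\in Q$, $x_r\in Ae_{i_r}$, write $[x]=[x_1\cdots x_m]$; $E\in M_m(A)$ is the diagonal matrix with entries $e_{i_1},\dots,e_{i_m}$. $f_Q\colon A\otimes Q\to Q$ is $f_Q(a\otimes x)=\sum_r f(a\otimes x_r)e_{i_r}$, and $\hat Q=(Q,Q,\mathrm{Id},f_Q)$, a projective $A_f$-module. A morphism $\delta\colon Q\to Q'$ of projective $A$-modules is given by a matrix $B$ with $EBE'=B$ via $[\delta(x)]=[x]B$. For matrices over $A$ of compatible sizes, $\tilde f(B\otimes B')_{ij}=\sum_l f(b_{il}\otimes b'_{lj})$. Condition $(\ast A)$. An $A$-module $M$ satisfies $(\ast A)$ if it has a minimal projective resolution $\cdots\to Q_1\xrightarrow{\delta_1}Q_0\xrightarrow{\delta_0}M\to0$ such that, with $B_i$ the matrix of $\delta_i$ ($i\ge1$) and $E_i$ the diagonal matrix of $Q_i$, the linear map $T_{\delta_1}\colon Q_1\to Q_0$, $[T_{\delta_1}(x)]=\tilde f([x]\otimes B_1)E_0$, satisfies $\delta_0T_{\delta_1}=0$. In this case there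 are matrices $C_i$ over $A$ with $E_iC_iE_{i-1}=C_i$ ($i\ge1$), $C_1=0$, and $E_i\tilde f(B_i\otimes B_{i-1})E_{i-2}=C_iB_{i-1}+B_iC_{i-1}$ ($i\ge2$); fix such a choice and put $[T_{\delta_i}(x)]=(-1)^{i+1}\bigl(\tilde f([x]\otimes B_i)E_{i-1}-[x]C_i\bigr)$. Resolution and identification (for $M=S$). A minimal projective resolution of the $A_f$-module $S$ is $\cdots\to\bigoplus_{i=0}^m\hat Q_i\xrightarrow{\hat\delta_m}\bigoplus_{i=0}^{m-1}\hat Q_i\to\cdots\to\hat Q_0\xrightarrow{\hat\delta_0}S\to0$ with $\hat\delta_0=(0,\delta_0,0)$, $\hat\delta_m=(u_m,v_m,u_m)$, $u_m(x_0,\dots,x_m)=(\delta_1x_1,\dots,\delta_mx_m)$, and $v_m(x_0,\dots,x_m)$ having component $(-1)^{i-1}(x_{i-1}+T_{\delta_i}x_i)$ in $Q_{i-1}$ ($1\le i\le m$). By minimality, $\operatorname{Ext}^k_A(S,S)=\operatorname{Hom}_A(Q_k,S)$ and $\operatorname{Ext}^p_{A_f}(S,S)=\operatorname{Hom}_{A_f}(\bigoplus_{k=0}^p\hat Q_k,S)$; each element of the latter is $\hat g=(0,[g_0\ \cdots\ g_p],0)$ with $g_k\in\operatorname{Hom}_A(Q_k,S)$, and it is identified with $\sum_{k=0}^p g_k\,x^{p-k}\in\operatorname{Ext}^*_A(S,S)\otimes\Bbbk[x]$. Yoneda product: for classes $h$ of degree $m$ and $g$ of degree $p$, the product of $h$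 and $g$ (in this order) is the class of $h\gamma_m$, where $\{\gamma_j\}_{j\ge0}$ is a lifting of $g$ to a chain map between the chosen projective resolutions ($\gamma_j$ from degree $p+j$ to degree $j$), strictly commuting with the differentials. *)

theory Defs
  imports
    "HOL-Computational_Algebra.Polynomial"
    "HOL-Library.Function_Algebras"
    "HOL-Library.Product_Plus"
begin

section \<open>The algebra and its Hochschild cocycle\<close>

text \<open>
  The algebra \<open>A\<close> is the whole type \<open>'a\<close>; \<open>sc\<close> is the scalar multiplication by the
  ground field \<open>'k\<close>.  A linear map on \<open>A \<otimes> A\<close> is given by the corresponding bilinear map.
\<close>

definition fd_algebra :: "('k::field \<Rightarrow> 'a::ring_1 \<Rightarrow> 'a) \<Rightarrow> bool" where
  "fd_algebra sc \<longleftrightarrow>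
     (\<exists>Basis. finite_dimensional_vector_space sc Basis) \<and>
     (\<forall>c x y. sc c (x * y) = sc c x * y \<and> sc c (x * y) = x * sc c y)"

definition hochschild_2_cocycle ::
  "('k::field \<Rightarrow> 'a::ring_1 \<Rightarrow> 'a) \<Rightarrow> ('a \<Rightarrow> 'a \<Rightarrow> 'a) \<Rightarrow> bool" where
  "hochschild_2_cocycle sc f \<longleftrightarrow>
     (\<forall>a. Vector_Spaces.linear sc sc (f a)) \<and>
     (\<forall>b. Vector_Spaces.linear sc sc (\<lambda>a. f a b)) \<and>
     (\<forall>a b c. a * f b c - f (a * b) c + f a (b * c) - f a b * c = 0)"

section \<open>Left modules\<close>

text \<open>
  The addition and zero of a module are those of the type in which its carrier lies.
  The ground field acts on a module through \<open>sc c 1\<close>.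
\<close>

record ('a, 'm) lmod =
  car :: "'m set"
  act :: "'a \<Rightarrow> 'm \<Rightarrow> 'm"

definition left_module :: "('a::ring_1, 'm::ab_group_add) lmod \<Rightarrow> bool" where
  "left_module M \<longleftrightarrow>
     0 \<in> car M \<and>
     (\<forall>x\<in>car M. \<forall>y\<in>car M. x + y \<in> car M) \<and>
     (\<forall>a. \<forall>x\<in>car M. act M a x \<in> car M) \<and>
     (\<forall>a. \<forall>x\<in>car M. \<forall>y\<in>car M. act M a (x + y) = act M a x + act M a y) \<and>
     (\<forall>a b. \<forall>x\<in>car M. act M (a + b) x = act M a x + act M b x) \<and>
     (\<forall>a b. \<forall>x\<in>car M. act M (a * b) x = act M a (act M b x)) \<and>
     (\<forall>x\<in>car M. act M 1 x = x)"

definition submodule :: "'m set \<Rightarrow> ('a::ring_1, 'm::ab_group_add) lmod \<Rightarrow> bool" where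
  "submodule N M \<longleftrightarrow>
     N \<subseteq> car M \<and> 0 \<in> N \<and> (\<forall>x\<in>N. \<forall>y\<in>N. x + y \<in> N) \<and> (\<forall>a. \<forall>x\<in>N. act M a x \<in> N)"

definition radical :: "('a::ring_1, 'm::ab_group_add) lmod \<Rightarrow> 'm set" where
  "radical M = {x \<in> car M. \<forall>N. submodule N M \<and> N \<noteq> car M \<and>
      (\<forall>L. submodule L M \<and> N \<subseteq> L \<longrightarrow> L = N \<or> L = car M) \<longrightarrow> x \<in> N}"

text \<open>
  Maps between modules are total functions that vanish outside the carrier of the source,
  so that equality of maps is equality of functions.
\<close>

definition restr0 :: "'m set \<Rightarrow> ('m \<Rightarrow> 'n::zero) \<Rightarrow> 'm \<Rightarrow> 'n" where
  "restr0 X u = (\<lambda>x. if x \<in> X then u x else 0)"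

definition hom ::
  "('a::ring_1, 'm::ab_group_add) lmod \<Rightarrow> ('a, 'n::ab_group_add) lmod \<Rightarrow> ('m \<Rightarrow> 'n) set" where
  "hom M N = {u. (\<forall>x\<in>car M. u x \<in> car N) \<and>
     (\<forall>x\<in>car M. \<forall>y\<in>car M. u (x + y) = u x + u y) \<and>
     (\<forall>a. \<forall>x\<in>car M. u (act M a x) = act N a (u x)) \<and>
     (\<forall>x. x \<notin> car M \<longrightarrow> u x = 0)}"

definition klin :: "('k::field \<Rightarrow> 'a::ring_1 \<Rightarrow> 'a) \<Rightarrow>
    ('a, 'm::ab_group_add) lmod \<Rightarrow> ('a, 'n::ab_group_add) lmod \<Rightarrow> ('m \<Rightarrow> 'n) set" where
  "klin sc M N = {u. (\<forall>x\<in>car M. u x \<in> car N) \<and>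
     (\<forall>x\<in>car M. \<forall>y\<in>car M. u (x + y) = u x + u y) \<and>
     (\<forall>c. \<forall>x\<in>car M. u (act M (sc c 1) x) = act N (sc c 1) (u x)) \<and>
     (\<forall>x. x \<notin> car M \<longrightarrow> u x = 0)}"

definition iso_mod ::
  "('a::ring_1, 'm::ab_group_add) lmod \<Rightarrow> ('a, 'n::ab_group_add) lmod \<Rightarrow> bool" where
  "iso_mod M N \<longleftrightarrow> (\<exists>u\<in>hom M N. bij_betw u (car M) (car N))"

definition indecomposable :: "('a::ring_1, 'm::ab_group_add) lmod \<Rightarrow> bool" where
  "indecomposable M \<longleftrightarrow> car M \<noteq> {0} \<and>
     (\<forall>N L. submodule N M \<and> submodule L M \<and> N \<inter> L = {0} \<and>
        {x + y |x y. x \<in> N \<and> y \<in> L} = car M \<longrightarrow> N = {0} \<or> L = {0})"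

definition free_mod :: "nat \<Rightarrow> ('a::ring_1, nat \<Rightarrow> 'a) lmod" where
  "free_mod d = \<lparr>car = {x. \<forall>r\<ge>d. x r = 0}, act = (\<lambda>a x r. a * x r)\<rparr>"

text \<open>Finitely generated projective modules, as direct summands of \<open>A\<^sup>d\<close>.\<close>

definition projective :: "('a::ring_1, 'm::ab_group_add) lmod \<Rightarrow> bool" where
  "projective M \<longleftrightarrow> (\<exists>d. \<exists>\<iota>\<in>hom M (free_mod d). \<exists>\<pi>\<in>hom (free_mod d) M. \<forall>x\<in>car M. \<pi> (\<iota> x) = x)"

definition superfluous :: "'m set \<Rightarrow> ('a::ring_1, 'm::ab_group_add) lmod \<Rightarrow> bool" where
  "superfluous K M \<longleftrightarrow>
     (\<forall>N. submodule N M \<and> {x + y |x y. x \<in> K \<and> y \<in> N} = car M \<longrightarrow> N = car M)"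

definition ker :: "('a, 'm) lmod \<Rightarrow> ('m \<Rightarrow> 'n::zero) \<Rightarrow> 'm set" where
  "ker M u = {x \<in> car M. u x = 0}"

section \<open>Idempotents, indecomposable projectives and simple modules\<close>

text \<open>The idempotents, hence also the modules \<open>P\<^sub>i\<close> and \<open>S\<^sub>i\<close>, are indexed by \<open>i < n\<close>.\<close>

definition primitive_idem :: "'a::ring_1 \<Rightarrow> bool" where
  "primitive_idem e \<longleftrightarrow> e \<noteq> 0 \<and> e * e = e \<and>
     \<not> (\<exists>u v. u \<noteq> 0 \<and> v \<noteq> 0 \<and> u * u = u \<and> v * v = v \<and> u * v = 0 \<and> v * u = 0 \<and> e = u + v)"

definition Pmod :: "'a::ring_1 \<Rightarrow> ('a, 'a) lmod" where
  "Pmod e = \<lparr>car = {a * e |a. True}, act = (*)\<rparr>"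

text \<open>
  Every finitely generated projective module is isomorphic to one whose carrier lies in the
  type \<open>nat \<Rightarrow> 'a\<close>, so nothing is lost by letting \<open>M\<close> range over modules in that type.
\<close>

definition idempotent_decomposition :: "nat \<Rightarrow> (nat \<Rightarrow> 'a::ring_1) \<Rightarrow> bool" where
  "idempotent_decomposition n e \<longleftrightarrow>
     (\<forall>i<n. primitive_idem (e i)) \<and>
     (\<forall>i<n. \<forall>j<n. i \<noteq> j \<longrightarrow> e i * e j = 0) \<and>
     (\<Sum>i<n. e i) = 1 \<and>
     (\<forall>i<n. \<forall>j<n. iso_mod (Pmod (e i)) (Pmod (e j)) \<longrightarrow> i = j) \<and>
     (\<forall>M :: ('a, nat \<Rightarrow> 'a) lmod. left_module M \<and> projective M \<and> indecomposable M \<longrightarrow>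
        (\<exists>i<n. iso_mod M (Pmod (e i))))"

text \<open>
  \<open>S\<close> is the (internal) direct sum of submodules \<open>V i\<close> (\<open>i < n\<close>), where \<open>V i\<close> is the quotient
  of \<open>P\<^sub>i\<close> by its radical, with quotient map \<open>q i\<close>.
\<close>

definition sum_of_simples ::
  "nat \<Rightarrow> (nat \<Rightarrow> 'a::ring_1) \<Rightarrow> ('a, 's::ab_group_add) lmod \<Rightarrow> bool" where
  "sum_of_simples n e S \<longleftrightarrow> left_module S \<and>
     (\<exists>V q. (\<forall>i<n. submodule (V i) S \<and> q i \<in> hom (Pmod (e i)) S \<and>
               q i ` car (Pmod (e i)) = V i \<and> ker (Pmod (e i)) (q i) = radical (Pmod (e i))) \<and>
            (\<forall>x\<in>car S. \<exists>y. (\<forall>i<n. y i \<in> V i) \<and> x = (\<Sum>i<n. y i)) \<and>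
            (\<forall>y. (\<forall>i<n. y i \<in> V i) \<and> (\<Sum>i<n. y i) = 0 \<longrightarrow> (\<forall>i<n. y i = 0)))"

section \<open>The algebra \<open>A\<^sub>f\<close> and its modules\<close>

text \<open>The pair \<open>(a, b)\<close> stands for \<open>a + b t\<close>.\<close>

definition Af_mult :: "('a::ring_1 \<Rightarrow> 'a \<Rightarrow> 'a) \<Rightarrow> 'a \<times> 'a \<Rightarrow> 'a \<times> 'a \<Rightarrow> 'a \<times> 'a" where
  "Af_mult f x y =
     (fst x * fst y, fst x * snd y + snd x * fst y + f (fst x) (fst y))"

record ('a, 'm, 'n) afmod =
  M0 :: "('a, 'm) lmod"
  M1 :: "('a, 'n) lmod"
  TM :: "'m \<Rightarrow> 'n"
  fM :: "'a \<Rightarrow> 'm \<Rightarrow> 'n"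

definition Af_module :: "('k::field \<Rightarrow> 'a::ring_1 \<Rightarrow> 'a) \<Rightarrow> ('a \<Rightarrow> 'a \<Rightarrow> 'a) \<Rightarrow>
    ('a, 'm::ab_group_add, 'n::ab_group_add) afmod \<Rightarrow> bool" where
  "Af_module sc f M \<longleftrightarrow>
     left_module (M0 M) \<and> left_module (M1 M) \<and>
     TM M \<in> hom (M0 M) (M1 M) \<and> inj_on (TM M) (car (M0 M)) \<and>
     (\<forall>a. fM M a \<in> klin sc (M0 M) (M1 M)) \<and>
     (\<forall>a b. \<forall>x\<in>car (M0 M). fM M (a + b) x = fM M a x + fM M b x) \<and>
     (\<forall>c a. \<forall>x\<in>car (M0 M). fM M (sc c a) x = act (M1 M) (sc c 1) (fM M a x)) \<and>
     (\<forall>a b. \<forall>x\<in>car (M0 M).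
        act (M1 M) a (fM M b x) - fM M (a * b) x + fM M a (act (M0 M) b x)
          - act (M1 M) (f a b) (TM M x) = 0)"

definition Af_act :: "('a, 'm, 'n::ab_group_add) afmod \<Rightarrow> 'a \<times> 'a \<Rightarrow> 'm \<times> 'n \<Rightarrow> 'm \<times> 'n" where
  "Af_act M x m =
     (act (M0 M) (fst x) (fst m),
      act (M1 M) (fst x) (snd m) + act (M1 M) (snd x) (TM M (fst m)) + fM M (fst x) (fst m))"

type_synonym ('m, 'n, 'm2, 'n2) aftriple = "('m \<Rightarrow> 'm2) \<times> ('m \<Rightarrow> 'n2) \<times> ('n \<Rightarrow> 'n2)"

definition Af_hom :: "('k::field \<Rightarrow> 'a::ring_1 \<Rightarrow> 'a) \<Rightarrow>
    ('a, 'm::ab_group_add, 'n::ab_group_add) afmod \<Rightarrow>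
    ('a, 'm2::ab_group_add, 'n2::ab_group_add) afmod \<Rightarrow> ('m, 'n, 'm2, 'n2) aftriple set" where
  "Af_hom sc M N = {(u0, u1, u2).
     u0 \<in> hom (M0 M) (M0 N) \<and> u1 \<in> klin sc (M0 M) (M1 N) \<and> u2 \<in> hom (M1 M) (M1 N) \<and>
     (\<forall>x\<in>car (M0 M). TM N (u0 x) = u2 (TM M x)) \<and>
     (\<forall>a. \<forall>x\<in>car (M0 M).
        u1 (act (M0 M) a x) = act (M1 N) a (u1 x) - u2 (fM M a x) + fM N a (u0 x))}"

definition Af_comp :: "('m2, 'n2, 'm3, 'n3::plus) aftriple \<Rightarrow> ('m, 'n, 'm2, 'n2) aftriple \<Rightarrow>
    ('m, 'n, 'm3, 'n3) aftriple" where
  "Af_comp v u = (case v of (v0, v1, v2) \<Rightarrow> case u of (u0, u1, u2) \<Rightarrow>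
     (\<lambda>x. v0 (u0 x), \<lambda>x. v2 (u1 x) + v1 (u0 x), \<lambda>x. v2 (u2 x)))"

text \<open>Tuples and triples do describe modules over \<open>A\<^sub>f\<close> and their homomorphisms:\<close>

lemma Af_mult_assoc:
  assumes "hochschild_2_cocycle sc f"
  shows "Af_mult f (Af_mult f x y) z = Af_mult f x (Af_mult f y z)"
proof -
  have "f (a * b) c + f a b * c = a * f b c + f a (b * c)" for a b c
    using assms unfolding hochschild_2_cocycle_def
    by (metis (no_types, lifting) add.commute diff_add_eq diff_eq_eq eq_iff_diff_eq_0)
  then show ?thesis
    by (simp add: Af_mult_def algebra_simps)
qed

lemma Af_act_mult:
  assumes M: "Af_module sc f M" and m: "m0 \<in> car (M0 M)" "m1 \<in> car (M1 M)"
  shows "Af_act M (Af_mult f x y) (m0, m1) = Af_act M x (Af_act M y (m0, m1))"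
proof -
  note d = M[unfolded Af_module_def left_module_def hom_def klin_def]
  have c: "fM M (a * b) m0 + act (M1 M) (f a b) (TM M m0)
      = act (M1 M) a (fM M b m0) + fM M a (act (M0 M) b m0)" for a b
  proof -
    have "act (M1 M) a (fM M b m0) - fM M (a * b) m0 + fM M a (act (M0 M) b m0)
        - act (M1 M) (f a b) (TM M m0) = 0"
      using d m by blast
    then show ?thesis by (simp add: algebra_simps)
  qed
  have T: "TM M m0 \<in> car (M1 M)" "\<And>a. fM M a m0 \<in> car (M1 M)"
    "\<And>a. TM M (act (M0 M) a m0) = act (M1 M) a (TM M m0)"
    using d m by auto
  have a: "\<And>a b. act (M0 M) (a * b) m0 = act (M0 M) a (act (M0 M) b m0)"
    "\<And>a b z. z \<in> car (M1 M) \<Longrightarrow> act (M1 M) (a * b) z = act (M1 M) a (act (M1 M) b z)"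
    "\<And>a b z. z \<in> car (M1 M) \<Longrightarrow> act (M1 M) (a + b) z = act (M1 M) a z + act (M1 M) b z"
    "\<And>a y z. y \<in> car (M1 M) \<Longrightarrow> z \<in> car (M1 M) \<Longrightarrow>
       act (M1 M) a (y + z) = act (M1 M) a y + act (M1 M) a z"
    "\<And>a z. z \<in> car (M1 M) \<Longrightarrow> act (M1 M) a z \<in> car (M1 M)"
    "\<And>y z. y \<in> car (M1 M) \<Longrightarrow> z \<in> car (M1 M) \<Longrightarrow> y + z \<in> car (M1 M)"
    using d m by auto
  show ?thesis
    using c[of "fst x" "fst y"] by (simp add: Af_act_def Af_mult_def T a m algebra_simps)
qed

lemma Af_hom_act:
  assumes M: "Af_module sc f M" and N: "Af_module sc f N" and u: "(u0, u1, u2) \<in> Af_hom sc M N"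
    and m: "m0 \<in> car (M0 M)" "m1 \<in> car (M1 M)"
  defines "\<phi> \<equiv> \<lambda>(z0, z1). (u0 z0, u1 z0 + u2 z1)"
  shows "\<phi> (Af_act M x (m0, m1)) = Af_act N x (\<phi> (m0, m1))"
proof -
  note d = M[unfolded Af_module_def left_module_def hom_def klin_def]
  note d' = N[unfolded Af_module_def left_module_def]
  note h = u[unfolded Af_hom_def hom_def klin_def]
  have T: "TM M m0 \<in> car (M1 M)" "\<And>a. fM M a m0 \<in> car (M1 M)"
    "\<And>a z. z \<in> car (M1 M) \<Longrightarrow> act (M1 M) a z \<in> car (M1 M)"
    "\<And>y z. y \<in> car (M1 M) \<Longrightarrow> z \<in> car (M1 M) \<Longrightarrow> y + z \<in> car (M1 M)"
    using d m by auto
  have a: "\<And>y z. y \<in> car (M1 N) \<Longrightarrow> z \<in> car (M1 N) \<Longrightarrow>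
       act (M1 N) a (y + z) = act (M1 N) a y + act (M1 N) a z" for a
    using d' by auto
  have v: "\<And>a. u0 (act (M0 M) a m0) = act (M0 N) a (u0 m0)"
    "\<And>a. u1 (act (M0 M) a m0) = act (M1 N) a (u1 m0) - u2 (fM M a m0) + fM N a (u0 m0)"
    "\<And>y z. y \<in> car (M1 M) \<Longrightarrow> z \<in> car (M1 M) \<Longrightarrow> u2 (y + z) = u2 y + u2 z"
    "\<And>a z. z \<in> car (M1 M) \<Longrightarrow> u2 (act (M1 M) a z) = act (M1 N) a (u2 z)"
    "u2 (TM M m0) = TM N (u0 m0)" "u1 m0 \<in> car (M1 N)" "u2 m1 \<in> car (M1 N)"
    using h m by auto
  show ?thesis
    by (simp add: \<phi>_def Af_act_def T a v m)
qed

section \<open>Projective modules and matrices\<close>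

text \<open>
  A list \<open>is = [i\<^sub>1, \<dots>, i\<^sub>m]\<close> stands for \<open>Q = A e\<^bsub>i\<^sub>1\<^esub> \<oplus> \<cdots> \<oplus> A e\<^bsub>i\<^sub>m\<^esub>\<close>, whose elements are row
  vectors, i.e. sequences vanishing from position \<open>m\<close> on.  Matrices are functions of a row
  and a column index (both starting at 0) that vanish outside their range; the condition
  \<open>E B E' = B\<close> includes this.  In products, \<open>l\<close> is the common inner dimension.
\<close>

definition Qmod :: "(nat \<Rightarrow> 'a::ring_1) \<Rightarrow> nat list \<Rightarrow> ('a, nat \<Rightarrow> 'a) lmod" where
  "Qmod e is = \<lparr>car = {x. (\<forall>r<length is. x r \<in> car (Pmod (e (is ! r)))) \<and> (\<forall>r\<ge>length is. x r = 0)},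
                act = (\<lambda>a x r. a * x r)\<rparr>"

definition row_mult :: "nat \<Rightarrow> (nat \<Rightarrow> 'a::ring_1) \<Rightarrow> (nat \<Rightarrow> nat \<Rightarrow> 'a) \<Rightarrow> nat \<Rightarrow> 'a" where
  "row_mult l x B = (\<lambda>j. \<Sum>r<l. x r * B r j)"

definition mat_mult ::
  "nat \<Rightarrow> (nat \<Rightarrow> nat \<Rightarrow> 'a::ring_1) \<Rightarrow> (nat \<Rightarrow> nat \<Rightarrow> 'a) \<Rightarrow> nat \<Rightarrow> nat \<Rightarrow> 'a" where
  "mat_mult l B B' = (\<lambda>i. row_mult l (B i) B')"

text \<open>\<open>f_row\<close> and \<open>f_mat\<close> are \<open>f\<close>-tilde on \<open>[x] \<otimes> B\<close> and on \<open>B \<otimes> B'\<close>.\<close>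

definition f_row :: "('a::ring_1 \<Rightarrow> 'a \<Rightarrow> 'a) \<Rightarrow> nat \<Rightarrow> (nat \<Rightarrow> 'a) \<Rightarrow> (nat \<Rightarrow> nat \<Rightarrow> 'a) \<Rightarrow> nat \<Rightarrow> 'a" where
  "f_row f l x B = (\<lambda>j. \<Sum>r<l. f (x r) (B r j))"

definition f_mat :: "('a::ring_1 \<Rightarrow> 'a \<Rightarrow> 'a) \<Rightarrow> nat \<Rightarrow>
    (nat \<Rightarrow> nat \<Rightarrow> 'a) \<Rightarrow> (nat \<Rightarrow> nat \<Rightarrow> 'a) \<Rightarrow> nat \<Rightarrow> nat \<Rightarrow> 'a" where
  "f_mat f l B B' = (\<lambda>i. f_row f l (B i) B')"

definition diag :: "(nat \<Rightarrow> 'a::ring_1) \<Rightarrow> nat list \<Rightarrow> nat \<Rightarrow> nat \<Rightarrow> 'a" where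
  "diag e is = (\<lambda>r j. if r = j \<and> r < length is then e (is ! r) else 0)"

definition mat_between ::
  "(nat \<Rightarrow> 'a::ring_1) \<Rightarrow> nat list \<Rightarrow> nat list \<Rightarrow> (nat \<Rightarrow> nat \<Rightarrow> 'a) \<Rightarrow> bool" where
  "mat_between e is js B \<longleftrightarrow>
     mat_mult (length js) (mat_mult (length is) (diag e is) B) (diag e js) = B"

definition f_Q :: "(nat \<Rightarrow> 'a::ring_1) \<Rightarrow> ('a \<Rightarrow> 'a \<Rightarrow> 'a) \<Rightarrow> nat list \<Rightarrow> 'a \<Rightarrow> (nat \<Rightarrow> 'a) \<Rightarrow> nat \<Rightarrow> 'a" where
  "f_Q e f is a x = (\<lambda>r. if r < length is then f a (x r) * e (is ! r) else 0)"

section \<open>Minimal projective resolutions over \<open>A\<close> and condition \<open>(\<ast>A)\<close>\<close>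

text \<open>
  \<open>verts R i\<close> is the list of vertices of \<open>Q\<^sub>i\<close>, \<open>bmat R i\<close> (for \<open>i \<ge> 1\<close>) is the matrix \<open>B\<^sub>i\<close> of
  \<open>\<delta>\<^sub>i : Q\<^sub>i \<rightarrow> Q\<^bsub>i-1\<^esub>\<close>, and \<open>aug R\<close> is \<open>\<delta>\<^sub>0 : Q\<^sub>0 \<rightarrow> M\<close>.
\<close>

record ('a, 's) resolution =
  verts :: "nat \<Rightarrow> nat list"
  bmat :: "nat \<Rightarrow> nat \<Rightarrow> nat \<Rightarrow> 'a"
  aug :: "(nat \<Rightarrow> 'a) \<Rightarrow> 's"

definition Qres :: "(nat \<Rightarrow> 'a::ring_1) \<Rightarrow> ('a, 's) resolution \<Rightarrow> nat \<Rightarrow> ('a, nat \<Rightarrow> 'a) lmod" where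
  "Qres e R i = Qmod e (verts R i)"

definition rk :: "('a, 's) resolution \<Rightarrow> nat \<Rightarrow> nat" where
  "rk R i = length (verts R i)"

definition delta :: "(nat \<Rightarrow> 'a::ring_1) \<Rightarrow> ('a, 's) resolution \<Rightarrow> nat \<Rightarrow> (nat \<Rightarrow> 'a) \<Rightarrow> nat \<Rightarrow> 'a" where
  "delta e R i = restr0 (car (Qres e R i)) (\<lambda>x. row_mult (rk R i) x (bmat R i))"

text \<open>Minimality: each \<open>Q\<^sub>i\<close> is a projective cover of the image of \<open>\<delta>\<^sub>i\<close>.\<close>

definition minimal_resolution ::
  "nat \<Rightarrow> (nat \<Rightarrow> 'a::ring_1) \<Rightarrow> ('a, 's::ab_group_add) lmod \<Rightarrow> ('a, 's) resolution \<Rightarrow> bool" where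
  "minimal_resolution n e M R \<longleftrightarrow>
     (\<forall>i. set (verts R i) \<subseteq> {..<n}) \<and>
     (\<forall>i\<ge>1. mat_between e (verts R i) (verts R (i - 1)) (bmat R i)) \<and>
     aug R \<in> hom (Qres e R 0) M \<and> aug R ` car (Qres e R 0) = car M \<and>
     delta e R 1 ` car (Qres e R 1) = ker (Qres e R 0) (aug R) \<and>
     (\<forall>i\<ge>1. delta e R (i + 1) ` car (Qres e R (i + 1)) = ker (Qres e R i) (delta e R i)) \<and>
     superfluous (ker (Qres e R 0) (aug R)) (Qres e R 0) \<and>
     (\<forall>i\<ge>1. superfluous (ker (Qres e R i) (delta e R i)) (Qres e R i))"

text \<open>
  \<open>M\<close> satisfies condition \<open>(\<ast>A)\<close> iff \<open>star_resolution n e f M R\<close> holds for some \<open>R\<close>.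
\<close>

definition star_resolution :: "nat \<Rightarrow> (nat \<Rightarrow> 'a::ring_1) \<Rightarrow> ('a \<Rightarrow> 'a \<Rightarrow> 'a) \<Rightarrow>
    ('a, 's::ab_group_add) lmod \<Rightarrow> ('a, 's) resolution \<Rightarrow> bool" where
  "star_resolution n e f M R \<longleftrightarrow> minimal_resolution n e M R \<and>
     (\<forall>x\<in>car (Qres e R 1).
        aug R (row_mult (rk R 0) (f_row f (rk R 1) x (bmat R 1)) (diag e (verts R 0))) = 0)"

definition admissible_C :: "(nat \<Rightarrow> 'a::ring_1) \<Rightarrow> ('a \<Rightarrow> 'a \<Rightarrow> 'a) \<Rightarrow>
    ('a, 's) resolution \<Rightarrow> (nat \<Rightarrow> nat \<Rightarrow> nat \<Rightarrow> 'a) \<Rightarrow> bool" where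
  "admissible_C e f R C \<longleftrightarrow>
     (\<forall>i\<ge>1. mat_between e (verts R i) (verts R (i - 1)) (C i)) \<and>
     C 1 = 0 \<and>
     (\<forall>i\<ge>2.
        mat_mult (rk R (i - 2))
          (mat_mult (rk R i) (diag e (verts R i)) (f_mat f (rk R (i - 1)) (bmat R i) (bmat R (i - 1))))
          (diag e (verts R (i - 2)))
        = mat_mult (rk R (i - 1)) (C i) (bmat R (i - 1))
          + mat_mult (rk R (i - 1)) (bmat R i) (C (i - 1)))"

definition Tdelta :: "(nat \<Rightarrow> 'a::ring_1) \<Rightarrow> ('a \<Rightarrow> 'a \<Rightarrow> 'a) \<Rightarrow> ('a, 's) resolution \<Rightarrow>
    (nat \<Rightarrow> nat \<Rightarrow> nat \<Rightarrow> 'a) \<Rightarrow> nat \<Rightarrow> (nat \<Rightarrow> 'a) \<Rightarrow> nat \<Rightarrow> 'a" where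
  "Tdelta e f R C i = restr0 (car (Qres e R i)) (\<lambda>x j. (-1) ^ (i + 1) *
     (row_mult (rk R (i - 1)) (f_row f (rk R i) x (bmat R i)) (diag e (verts R (i - 1))) j
      - row_mult (rk R i) x (C i) j))"

text \<open>\<open>T_comp e f R C g s d\<close> is the composition \<open>g T\<^bsub>s+1\<^esub> \<cdots> T\<^bsub>s+d\<^esub>\<close>, where \<open>T\<^sub>i\<close> is the map \<open>Tdelta\<close> at \<open>i\<close>.\<close>

primrec T_comp :: "(nat \<Rightarrow> 'a::ring_1) \<Rightarrow> ('a \<Rightarrow> 'a \<Rightarrow> 'a) \<Rightarrow> ('a, 's) resolution \<Rightarrow>
    (nat \<Rightarrow> nat \<Rightarrow> nat \<Rightarrow> 'a) \<Rightarrow> ((nat \<Rightarrow> 'a) \<Rightarrow> 's) \<Rightarrow> nat \<Rightarrow> nat \<Rightarrow> (nat \<Rightarrow> 'a) \<Rightarrow> 's" where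
  "T_comp e f R C g s 0 = g"
| "T_comp e f R C g s (Suc d) = T_comp e f R C g s d \<circ> Tdelta e f R C (s + Suc d)"

section \<open>\<open>Ext\<close> over \<open>A\<close> and its Yoneda product\<close>

text \<open>As the resolution is minimal, classes in \<open>Ext\<close> are the homomorphisms themselves.\<close>

definition Ext_A :: "(nat \<Rightarrow> 'a::ring_1) \<Rightarrow> ('a, 's::ab_group_add) lmod \<Rightarrow> ('a, 's) resolution \<Rightarrow>
    nat \<Rightarrow> ((nat \<Rightarrow> 'a) \<Rightarrow> 's) set" where
  "Ext_A e S R k = hom (Qres e R k) S"

definition lifting_A :: "(nat \<Rightarrow> 'a::ring_1) \<Rightarrow> ('a, 's::ab_group_add) resolution \<Rightarrow> nat \<Rightarrow>
    ((nat \<Rightarrow> 'a) \<Rightarrow> 's) \<Rightarrow> (nat \<Rightarrow> (nat \<Rightarrow> 'a) \<Rightarrow> nat \<Rightarrow> 'a) \<Rightarrow> bool" where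
  "lifting_A e R p g \<gamma> \<longleftrightarrow>
     (\<forall>j. \<gamma> j \<in> hom (Qres e R (p + j)) (Qres e R j)) \<and>
     aug R \<circ> \<gamma> 0 = g \<and>
     (\<forall>j\<ge>1. delta e R j \<circ> \<gamma> j = \<gamma> (j - 1) \<circ> delta e R (p + j))"

text \<open>The product \<open>h \<star> g\<close> of \<open>h\<close> of degree \<open>m\<close> and \<open>g\<close> of degree \<open>p\<close>.\<close>

definition yoneda_A :: "(nat \<Rightarrow> 'a::ring_1) \<Rightarrow> ('a, 's::ab_group_add) resolution \<Rightarrow>
    nat \<Rightarrow> ((nat \<Rightarrow> 'a) \<Rightarrow> 's) \<Rightarrow> nat \<Rightarrow> ((nat \<Rightarrow> 'a) \<Rightarrow> 's) \<Rightarrow> (nat \<Rightarrow> 'a) \<Rightarrow> 's" where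
  "yoneda_A e R m h p g = (THE w. \<exists>\<gamma>. lifting_A e R p g \<gamma> \<and> w = h \<circ> \<gamma> m)"

section \<open>\<open>Ext\<close> over \<open>A\<^sub>f\<close> and its Yoneda product\<close>

text \<open>\<open>Psum\<close> is the direct sum of \<open>Q\<^sub>0, \<dots>, Q\<^sub>m\<close>, and \<open>Phat\<close> that of the \<open>A\<^sub>f\<close>-modules \<open>(Q\<^sub>k, Q\<^sub>k, id, f\<^bsub>Q\<^sub>k\<^esub>)\<close>.\<close>

definition Psum :: "(nat \<Rightarrow> 'a::ring_1) \<Rightarrow> ('a, 's) resolution \<Rightarrow> nat \<Rightarrow> ('a, nat \<Rightarrow> nat \<Rightarrow> 'a) lmod" where
  "Psum e R m = \<lparr>car = {x. (\<forall>k\<le>m. x k \<in> car (Qres e R k)) \<and> (\<forall>k>m. x k = 0)},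
                 act = (\<lambda>a x k. act (Qres e R k) a (x k))\<rparr>"

definition Phat :: "(nat \<Rightarrow> 'a::ring_1) \<Rightarrow> ('a \<Rightarrow> 'a \<Rightarrow> 'a) \<Rightarrow> ('a, 's) resolution \<Rightarrow> nat \<Rightarrow>
    ('a, nat \<Rightarrow> nat \<Rightarrow> 'a, nat \<Rightarrow> nat \<Rightarrow> 'a) afmod" where
  "Phat e f R m = \<lparr>M0 = Psum e R m, M1 = Psum e R m,
     TM = restr0 (car (Psum e R m)) (\<lambda>x. x),
     fM = (\<lambda>a. restr0 (car (Psum e R m)) (\<lambda>x k. if k \<le> m then f_Q e f (verts R k) a (x k) else 0))\<rparr>"

text \<open>An \<open>A\<close>-module as an \<open>A\<^sub>f\<close>-module \<open>(0, M, 0, 0)\<close>.\<close>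

definition Af_of :: "('a, 's::ab_group_add) lmod \<Rightarrow> ('a, 's, 's) afmod" where
  "Af_of M = \<lparr>M0 = \<lparr>car = {0}, act = (\<lambda>a x. 0)\<rparr>, M1 = M, TM = (\<lambda>x. 0), fM = (\<lambda>a x. 0)\<rparr>"

text \<open>\<open>hat_delta\<close> is only used for \<open>m \<ge> 1\<close> (in degree 0 the differential is \<open>(0, \<delta>\<^sub>0, 0)\<close>); the component of \<open>v\<^sub>m\<close> in \<open>Q\<^bsub>i-1\<^esub>\<close> appears at index \<open>k = i - 1\<close>.\<close>

definition hat_delta :: "(nat \<Rightarrow> 'a::ring_1) \<Rightarrow> ('a \<Rightarrow> 'a \<Rightarrow> 'a) \<Rightarrow> ('a, 's) resolution \<Rightarrow>
    (nat \<Rightarrow> nat \<Rightarrow> nat \<Rightarrow> 'a) \<Rightarrow> nat \<Rightarrow>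
    (nat \<Rightarrow> nat \<Rightarrow> 'a, nat \<Rightarrow> nat \<Rightarrow> 'a, nat \<Rightarrow> nat \<Rightarrow> 'a, nat \<Rightarrow> nat \<Rightarrow> 'a) aftriple" where
  "hat_delta e f R C m =
     (let u = restr0 (car (Psum e R m)) (\<lambda>x k. if k < m then delta e R (k + 1) (x (k + 1)) else 0);
          v = restr0 (car (Psum e R m)) (\<lambda>x k. if k < m
                then act (Qres e R k) ((-1) ^ k) (x k + Tdelta e f R C (k + 1) (x (k + 1))) else 0)
      in (u, v, u))"

text \<open>
  A family \<open>g\<close> with \<open>g k \<in> Ext_A e S R k\<close> for \<open>k \<le> p\<close> yields the element \<open>(0, [g\<^sub>0 \<cdots> g\<^sub>p], 0)\<close> of
  \<open>Ext\<^sup>p(S, S)\<close> over \<open>A\<^sub>f\<close>, which is identified with \<open>\<Sum>\<^sub>k g\<^sub>k x\<^bsup>p-k\<^esup>\<close>.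
\<close>

definition hat_elem :: "(nat \<Rightarrow> 'a::ring_1) \<Rightarrow> ('a, 's) resolution \<Rightarrow> nat \<Rightarrow>
    (nat \<Rightarrow> (nat \<Rightarrow> 'a) \<Rightarrow> 's::ab_group_add) \<Rightarrow> (nat \<Rightarrow> nat \<Rightarrow> 'a, nat \<Rightarrow> nat \<Rightarrow> 'a, 's, 's) aftriple" where
  "hat_elem e R p g = (0, restr0 (car (Psum e R p)) (\<lambda>x. \<Sum>k\<le>p. g k (x k)), 0)"

definition Ext_Af :: "('k::field \<Rightarrow> 'a::ring_1 \<Rightarrow> 'a) \<Rightarrow> (nat \<Rightarrow> 'a) \<Rightarrow> ('a \<Rightarrow> 'a \<Rightarrow> 'a) \<Rightarrow>
    ('a, 's::ab_group_add) lmod \<Rightarrow> ('a, 's) resolution \<Rightarrow> nat \<Rightarrow>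
    (nat \<Rightarrow> nat \<Rightarrow> 'a, nat \<Rightarrow> nat \<Rightarrow> 'a, 's, 's) aftriple set" where
  "Ext_Af sc e f S R p = Af_hom sc (Phat e f R p) (Af_of S)"

lemma Psum_simps:
  "x \<in> car (Psum e R p) \<longleftrightarrow> (\<forall>k\<le>p. x k \<in> car (Qres e R k)) \<and> (\<forall>k>p. x k = 0)"
  "act (Psum e R p) a x = (\<lambda>k. act (Qres e R k) a (x k))"
  by (simp_all add: Psum_def)

lemma Qres_props:
  fixes R :: "('a::ring_1, 's) resolution"
  shows "0 \<in> car (Qres e R k)" "act (Qres e R k) a 0 = 0"
    "x \<in> car (Qres e R k) \<Longrightarrow> act (Qres e R k) a x \<in> car (Qres e R k)"
    "x \<in> car (Qres e R k) \<Longrightarrow> y \<in> car (Qres e R k) \<Longrightarrow> x + y \<in> car (Qres e R k)"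
proof -
  show "0 \<in> car (Qres e R k)" "act (Qres e R k) a 0 = 0"
    by (auto simp: Qres_def Qmod_def Pmod_def intro: exI[of _ 0])
  show "x \<in> car (Qres e R k) \<Longrightarrow> act (Qres e R k) a x \<in> car (Qres e R k)"
    by (auto simp: Qres_def Qmod_def Pmod_def) (metis mult.assoc)
  show "x \<in> car (Qres e R k) \<Longrightarrow> y \<in> car (Qres e R k) \<Longrightarrow> x + y \<in> car (Qres e R k)"
    by (auto simp: Qres_def Qmod_def Pmod_def) (metis distrib_right)
qed

lemma Ext_Af_eq:
  fixes S :: "('a::ring_1, 's::ab_group_add) lmod"
  assumes S: "left_module S"
  shows "Ext_Af sc e f S R p = {hat_elem e R p g |g. \<forall>k\<le>p. g k \<in> Ext_A e S R k}"
proof (intro equalityI subsetI)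
  fix G assume "G \<in> Ext_Af sc e f S R p"
  then obtain u0 u1 u2 where G: "G = (u0, u1, u2)" and h: "(u0, u1, u2) \<in> Af_hom sc (Phat e f R p) (Af_of S)"
    by (cases G) (auto simp: Ext_Af_def)
  let ?X = "car (Psum e R p)"
  note h' = h[unfolded Af_hom_def hom_def klin_def Phat_def Af_of_def restr0_def, simplified]
  have u0: "u0 = 0" using h' by (auto simp: fun_eq_iff)
  have u2: "u2 = 0" using h' by (auto simp: fun_eq_iff)
  have u1: "u1 (x + y) = u1 x + u1 y" if "x \<in> ?X" "y \<in> ?X" for x y using h' that by auto
  have u1a: "u1 (act (Psum e R p) a x) = act S a (u1 x)" if "x \<in> ?X" for a x
    using h' that by (auto simp: u2)
  have u1z: "u1 x = 0" if "x \<notin> ?X" for x using h' that by auto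
  have u1S: "u1 x \<in> car S" if "x \<in> ?X" for x using h' that by auto
  define i where "i = (\<lambda>(k::nat) (y::nat \<Rightarrow> 'a) (j::nat). if j = k then y else 0)"
  define g where "g = (\<lambda>k. restr0 (car (Qres e R k)) (\<lambda>y. u1 (i k y)))"
  have iX: "i k y \<in> ?X" if "k \<le> p" "y \<in> car (Qres e R k)" for k y
    using that by (auto simp: Psum_simps i_def Qres_props)
  have ia: "i k (act (Qres e R k) a y) = act (Psum e R p) a (i k y)" for k a y
    by (auto simp: Psum_simps i_def Qres_props fun_eq_iff[of "i k _"])
  have ip: "i k (x + y) = i k x + i k y" for k x y
    by (auto simp: i_def fun_eq_iff)
  have g: "g k \<in> Ext_A e S R k" if "k \<le> p" for k
    using that by (auto simp: Ext_A_def hom_def g_def restr0_def Qres_props u1S iX ia ip u1 u1a)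
  have 0: "0 \<in> ?X" by (auto simp: Psum_simps Qres_props)
  have u10: "u1 0 = 0" using u1[OF 0 0] by simp
  have "u1 x = (\<Sum>k\<le>p. g k (x k))" if x: "x \<in> ?X" for x
  proof -
    have tr: "(\<lambda>k. if k < N then x k else 0) \<in> ?X" for N
      using x by (auto simp: Psum_simps Qres_props)
    have "u1 (\<lambda>k. if k < N then x k else 0) = (\<Sum>k<N. g k (x k))" if "N \<le> Suc p" for N
      using that
    proof (induction N)
      case 0
      then show ?case using u10 by (simp add: zero_fun_def)
    next
      case (Suc N)
      have "(\<lambda>k. if k < Suc N then x k else 0) = (\<lambda>k. if k < N then x k else 0) + i N (x N)"
        by (auto simp: fun_eq_iff i_def less_Suc_eq)
      moreover have "x N \<in> car (Qres e R N)" using x Suc.prems by (auto simp: Psum_simps)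
      ultimately show ?case
        using Suc by (simp add: u1 tr iX g_def restr0_def)
    qed
    from this[of "Suc p"] have "u1 (\<lambda>k. if k < Suc p then x k else 0) = (\<Sum>k\<le>p. g k (x k))"
      by (simp add: lessThan_Suc_atMost)
    moreover have "(\<lambda>k. if k < Suc p then x k else 0) = x"
      using x by (auto simp: Psum_simps fun_eq_iff[of _ x])
    ultimately show ?thesis by simp
  qed
  then have "G = hat_elem e R p g"
    using u1z by (auto simp: G u0 u2 hat_elem_def restr0_def fun_eq_iff[of u1])
  with g show "G \<in> {hat_elem e R p g |g. \<forall>k\<le>p. g k \<in> Ext_A e S R k}" by blast
next
  fix G assume "G \<in> {hat_elem e R p g |g. \<forall>k\<le>p. g k \<in> Ext_A e S R k}"
  then obtain g where G: "G = hat_elem e R p g" and g: "\<And>k. k \<le> p \<Longrightarrow> g k \<in> hom (Qres e R k) S"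
    by (auto simp: Ext_A_def)
  note s = S[unfolded left_module_def]
  have S0: "act S a 0 = 0" for a
    using s by (metis add_cancel_right_left)
  have sum_in: "(\<Sum>k\<in>K. z k) \<in> car S" if "finite K" "\<forall>k\<in>K. z k \<in> car S" for K :: "nat set" and z
    using that by (induction K) (use s in auto)
  have act_sum: "act S a (\<Sum>k\<in>K. z k) = (\<Sum>k\<in>K. act S a (z k))"
    if "finite K" "\<forall>k\<in>K. z k \<in> car S" for a and K :: "nat set" and z
    using that by (induction K) (use s S0 sum_in in auto)
  have P: "act (Psum e R p) a x \<in> car (Psum e R p)" if "x \<in> car (Psum e R p)" for a x
    using that by (auto simp: Psum_simps Qres_props)
  have P': "x + y \<in> car (Psum e R p)" if "x \<in> car (Psum e R p)" "y \<in> car (Psum e R p)" for x y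
    using that by (auto simp: Psum_simps Qres_props)
  have gS: "\<forall>k\<in>{..p}. g k (x k) \<in> car S" if "x \<in> car (Psum e R p)" for x
    using that g by (auto simp: hom_def Psum_simps)
  have ga: "(\<Sum>k\<le>p. g k (act (Psum e R p) a x k)) = act S a (\<Sum>k\<le>p. g k (x k))"
    if "x \<in> car (Psum e R p)" for a x
    using that g by (simp add: act_sum gS) (auto simp: hom_def Psum_simps intro!: sum.cong)
  have gp: "(\<Sum>k\<le>p. g k (x k + y k)) = (\<Sum>k\<le>p. g k (x k)) + (\<Sum>k\<le>p. g k (y k))"
    if "x \<in> car (Psum e R p)" "y \<in> car (Psum e R p)" for x y
    unfolding sum.distrib[symmetric]
    using that g by (auto simp: hom_def Psum_simps intro!: sum.cong)
  show "G \<in> Ext_Af sc e f S R p"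
    using s
    by (auto simp: Ext_Af_def G hat_elem_def Af_hom_def Phat_def Af_of_def hom_def klin_def restr0_def
        P P' ga gp sum_in gS S0)
qed

text \<open>The monomial \<open>g x\<^sup>j\<close> for \<open>g\<close> of degree \<open>k\<close>; it lies in degree \<open>k + j\<close>.\<close>

definition hat_monom :: "(nat \<Rightarrow> 'a::ring_1) \<Rightarrow> ('a, 's) resolution \<Rightarrow> nat \<Rightarrow>
    ((nat \<Rightarrow> 'a) \<Rightarrow> 's::ab_group_add) \<Rightarrow> nat \<Rightarrow> (nat \<Rightarrow> nat \<Rightarrow> 'a, nat \<Rightarrow> nat \<Rightarrow> 'a, 's, 's) aftriple" where
  "hat_monom e R k g j = hat_elem e R (k + j) (\<lambda>i. if i = k then g else 0)"

definition lifting_Af :: "('k::field \<Rightarrow> 'a::ring_1 \<Rightarrow> 'a) \<Rightarrow> (nat \<Rightarrow> 'a) \<Rightarrow> ('a \<Rightarrow> 'a \<Rightarrow> 'a) \<Rightarrow>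
    ('a, 's::ab_group_add) resolution \<Rightarrow> (nat \<Rightarrow> nat \<Rightarrow> nat \<Rightarrow> 'a) \<Rightarrow> nat \<Rightarrow>
    (nat \<Rightarrow> nat \<Rightarrow> 'a, nat \<Rightarrow> nat \<Rightarrow> 'a, 's, 's) aftriple \<Rightarrow>
    (nat \<Rightarrow> (nat \<Rightarrow> nat \<Rightarrow> 'a, nat \<Rightarrow> nat \<Rightarrow> 'a, nat \<Rightarrow> nat \<Rightarrow> 'a, nat \<Rightarrow> nat \<Rightarrow> 'a) aftriple) \<Rightarrow> bool" where
  "lifting_Af sc e f R C p g \<gamma> \<longleftrightarrow>
     (\<forall>j. \<gamma> j \<in> Af_hom sc (Phat e f R (p + j)) (Phat e f R j)) \<and>
     Af_comp (hat_elem e R 0 (\<lambda>_. aug R)) (\<gamma> 0) = g \<and>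
     (\<forall>j\<ge>1. Af_comp (hat_delta e f R C j) (\<gamma> j) = Af_comp (\<gamma> (j - 1)) (hat_delta e f R C (p + j)))"

text \<open>The product \<open>h \<circ> g\<close> of \<open>h\<close> of degree \<open>m\<close> and \<open>g\<close> of degree \<open>p\<close>.\<close>

definition yoneda_Af :: "('k::field \<Rightarrow> 'a::ring_1 \<Rightarrow> 'a) \<Rightarrow> (nat \<Rightarrow> 'a) \<Rightarrow> ('a \<Rightarrow> 'a \<Rightarrow> 'a) \<Rightarrow>
    ('a, 's::ab_group_add) resolution \<Rightarrow> (nat \<Rightarrow> nat \<Rightarrow> nat \<Rightarrow> 'a) \<Rightarrow>
    nat \<Rightarrow> (nat \<Rightarrow> nat \<Rightarrow> 'a, nat \<Rightarrow> nat \<Rightarrow> 'a, 's, 's) aftriple \<Rightarrow>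
    nat \<Rightarrow> (nat \<Rightarrow> nat \<Rightarrow> 'a, nat \<Rightarrow> nat \<Rightarrow> 'a, 's, 's) aftriple \<Rightarrow>
    (nat \<Rightarrow> nat \<Rightarrow> 'a, nat \<Rightarrow> nat \<Rightarrow> 'a, 's, 's) aftriple" where
  "yoneda_Af sc e f R C m h p g = (THE w. \<exists>\<gamma>. lifting_Af sc e f R C p g \<gamma> \<and> w = Af_comp h (\<gamma> m))"

text \<open>The multiple of a homomorphism into \<open>S\<close> by an integer.\<close>

definition int_mult :: "('a::ring_1, 's) lmod \<Rightarrow> int \<Rightarrow> ('x \<Rightarrow> 's) \<Rightarrow> 'x \<Rightarrow> 's" where
  "int_mult S c \<phi> = (\<lambda>x. act S (of_int c) (\<phi> x))"

end

theory Submission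
  imports Defs
begin

text \<open>
  Write \<open>T'\<close> for the map \<open>T\<close> at \<open>\<delta>\<close> without its sign.  A morphism between sums of the modules \<open>(Q, Q, id, f\<^sub>Q)\<close>
  is a pair \<open>(u, d)\<close>: a homomorphism \<open>u\<close> over \<open>A\<close> and an additive map \<open>d\<close> whose failure to be
  \<open>A\<close>-linear is the commutator of \<open>u\<close> with \<open>f\<^sub>Q\<close>.  Such a \<open>d\<close> is called twisted over \<open>u\<close>.  Every
  homomorphism \<open>u\<close> has a twisted map over it, and any two differ by a homomorphism.  The map \<open>T'\<close> is
  twisted over \<open>\<delta>\<close> and \<open>\<delta> T' + T' \<delta> = 0\<close>, so the pairs \<open>(\<delta>, T')\<close> deform the resolution of \<open>S\<close> to a
  complex over \<open>A\<^sub>f\<close>.  The resolution over \<open>A\<^sub>f\<close> is this complex tensored with \<open>k[x]\<close>, and its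
  differential has one more summand, \<open>(-1)\<^sup>k t\<close> times division by \<open>x\<close> on \<open>Q\<^sub>k\<close>.

  Let \<open>g\<close> have degree \<open>l\<close> and let \<open>\<gamma>\<close> be a chain map over \<open>A\<close> that lifts it.  Extending \<open>\<gamma>\<close> to a chain
  map of the deformed complexes is obstructed, and the obstruction is itself, up to sign, a chain map
  that lifts \<open>g T\<^bsub>l+1\<^esub>\<close>.  In general it cannot be removed, but it can be moved to any prescribed lifting
  of \<open>g T\<^bsub>l+1\<^esub>\<close> (lemma \<open>deformed_lift\<close>).  Do this for all \<open>g T\<^bsub>s+1\<^esub> \<cdots> T\<^sub>l\<close> at once.  A combination of the
  resulting maps, in which the \<open>l\<close>-th one occurs on \<open>x\<^sup>a\<close> with an integer coefficient \<open>\<kappa>\<^sub>l(a)\<close>, commutes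
  with the differentials over \<open>A\<^sub>f\<close> as soon as the obstruction of the \<open>l\<close>-th one and the defect of the
  next one with respect to division by \<open>x\<close> cancel.  This is a recursion for \<open>\<kappa>\<close>, and its initial values
  express that \<open>g x\<^bsup>p-s\<^esup>\<close> is lifted (lemma \<open>monomial_lift\<close>).  The product with \<open>h\<^sub>i x\<^bsup>m-i\<^esup>\<close> is then read off;
  for \<open>l = s\<close> each step of the recursion only multiplies by \<open>(-1)\<^sup>s\<close>, which is where \<open>(-1)\<^bsup>s(m-i)\<^esup>\<close> comes
  from.

  All the vanishing in this argument happens in the same way.  Let \<open>J\<close> be the annihilator of \<open>S\<close> and
  let \<open>rad Q\<close> consist of the elements of \<open>Q\<close> with all entries in \<open>J\<close>.  Homomorphisms to \<open>S\<close> kill \<open>rad Q\<close>,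
  and by minimality the differentials have values in \<open>rad Q\<close>.  The central point is that twisted maps
  preserve \<open>rad Q\<close> (lemma \<open>twisted_rad\<close>).  It rests on two properties of the cocycle: \<open>f(a, y) e\<^sub>i \<in> J\<close> for
  \<open>y \<in> J e\<^sub>i\<close>, which is where condition \<open>(\<ast>A)\<close> enters, together with the fact that every simple module
  occurs in \<open>S\<close>; and \<open>f(y, z) e\<^sub>j \<in> J\<close> for \<open>y \<in> J e\<^sub>i\<close> and \<open>z \<in> e\<^sub>i A e\<^sub>j\<close>, for which one needs that
  \<open>e\<^sub>i A e\<^sub>i\<close> is spanned by \<open>e\<^sub>i\<close> modulo \<open>J\<close>; this holds as the field is algebraically closed.  As a
  consequence, \<open>g T\<close> is a homomorphism, the class of the obstruction is as stated, and a lifting of zero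
  over \<open>A\<^sub>f\<close> takes values in the radical (lemma \<open>null_lift_in_rad\<close>), so that the Yoneda product does not
  depend on the lifting and is bilinear.
\<close>

section \<open>Polynomials in an element of a finite dimensional algebra\<close>

text \<open>
  The polynomial \<open>p\<close> evaluated at \<open>x\<close> and multiplied by \<open>z\<close> from the right.  Taking \<open>z\<close> to be an idempotent
  \<open>e\<close> evaluates \<open>p\<close> in the corner ring \<open>e A e\<close>, whose unit is \<open>e\<close>.
\<close>

definition peval :: "('k::field \<Rightarrow> 'a::ring_1 \<Rightarrow> 'a) \<Rightarrow> 'a \<Rightarrow> 'a \<Rightarrow> 'k poly \<Rightarrow> 'a" where
  "peval sc x z p = fold_coeffs (\<lambda>a s. sc a z + x * s) p 0"

context
  fixes sc :: "'k::field \<Rightarrow> 'a::ring_1 \<Rightarrow> 'a"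
  assumes fd: "fd_algebra sc"
begin

lemma sc_alg:
  "sc c (x + y) = sc c x + sc c y" "sc (a + b) x = sc a x + sc b x"
  "sc a (sc b x) = sc (a * b) x" "sc 1 x = x" "sc 0 x = 0" "sc c 0 = 0"
  "sc c x * y = sc c (x * y)" "x * sc c y = sc c (x * y)" "sc (- c) x = - sc c x" "sc c (- x) = - sc c x"
  "sc c (x - y) = sc c x - sc c y"
proof -
  obtain B where "finite_dimensional_vector_space sc B" using fd by (auto simp: fd_algebra_def)
  then interpret finite_dimensional_vector_space sc B .
  show "sc c (x + y) = sc c x + sc c y" "sc (a + b) x = sc a x + sc b x"
    "sc a (sc b x) = sc (a * b) x" "sc 1 x = x" "sc 0 x = 0" "sc c 0 = 0"
    "sc (- c) x = - sc c x" "sc c (- x) = - sc c x" "sc c (x - y) = sc c x - sc c y"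
    by (simp_all add: scale_right_distrib scale_left_distrib scale_right_diff_distrib)
  show "sc c x * y = sc c (x * y)" "x * sc c y = sc c (x * y)"
    using fd unfolding fd_algebra_def by metis+
qed

lemma peval_0: "peval sc x z 0 = 0"
  by (simp add: peval_def)

lemma peval_pCons: "peval sc x z (pCons a p) = sc a z + x * peval sc x z p"
  by (cases "p = 0 \<and> a = 0") (auto simp: peval_def sc_alg)

lemma peval_add: "peval sc x z (p + q) = peval sc x z p + peval sc x z q"
  by (induction p q rule: poly_induct2) (simp_all add: peval_0 peval_pCons sc_alg algebra_simps)

lemma peval_smult: "peval sc x z (smult c p) = sc c (peval sc x z p)"
  by (induction p) (simp_all add: peval_0 peval_pCons sc_alg)

lemma peval_monom: "peval sc x z (monom c i) = sc c (x ^ i * z)"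
  by (induction i) (simp_all add: monom_0 monom_Suc peval_pCons peval_0 sc_alg mult.assoc)

lemma peval_sum: "peval sc x z (\<Sum>i\<in>I. p i) = (\<Sum>i\<in>I. peval sc x z (p i))"
  by (induction I rule: infinite_finite_induct) (simp_all add: peval_0 peval_add)

lemma peval_linear_factor:
  "peval sc x z ([:- c, 1:] * q) = x * peval sc x z q - sc c (peval sc x z q)"
proof -
  have "[:- c, 1:] * q = pCons 0 q + smult (- c) q" by simp
  then have "peval sc x z ([:- c, 1:] * q) = peval sc x z (pCons 0 q + smult (- c) q)" by simp
  also have "\<dots> = x * peval sc x z q - sc c (peval sc x z q)"
    unfolding peval_add peval_smult peval_pCons by (simp add: sc_alg)
  finally show ?thesis .
qed

lemma peval_commute: "x * peval sc x 1 p = peval sc x 1 p * x"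
proof (induction p)
  case (pCons a p)
  show ?case using pCons.IH by (simp add: peval_pCons sc_alg distrib_left distrib_right flip: mult.assoc)
qed (simp add: peval_0)

text \<open>
  More powers of \<open>x\<close> than the dimension of the algebra are linearly dependent, or two of them coincide.
\<close>

lemma annihilating_poly: "\<exists>p. p \<noteq> 0 \<and> peval sc x z p = 0"
proof -
  obtain B where "finite_dimensional_vector_space sc B" using fd by (auto simp: fd_algebra_def)
  then interpret V: finite_dimensional_vector_space sc B .
  let ?d = "card B"
  let ?P = "\<lambda>i. x ^ i * z"
  show ?thesis
  proof (cases "inj_on ?P {..?d}")
    case False
    then obtain i j where ij: "i \<noteq> j" "?P i = ?P j" by (auto simp: inj_on_def)
    have "coeff (monom 1 i + monom (-1) j) i \<noteq> (0::'k)" using ij by simp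
    then have "monom 1 i + monom (-1) j \<noteq> (0::'k poly)" by (metis coeff_0)
    moreover have "peval sc x z (monom 1 i + monom (-1) j) = 0"
      using ij by (simp add: peval_add peval_monom sc_alg)
    ultimately show ?thesis by blast
  next
    case True
    have "V.dependent (?P ` {..?d})"
    proof (rule ccontr)
      assume "\<not> V.dependent (?P ` {..?d})"
      then have "card (?P ` {..?d}) \<le> ?d"
        using V.independent_span_bound[OF V.finite_Basis] by (simp add: V.span_Basis)
      then show False using True by (simp add: card_image)
    qed
    then obtain u where u: "\<exists>v\<in>?P ` {..?d}. u v \<noteq> 0" "(\<Sum>v\<in>?P ` {..?d}. sc (u v) v) = 0"
      by (auto simp: V.dependent_finite)
    let ?p = "\<Sum>i\<le>?d. monom (u (?P i)) i"
    have "peval sc x z ?p = 0"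
      using u(2) True by (simp add: peval_sum peval_monom sum.reindex)
    moreover obtain i where i: "i \<le> ?d" "u (?P i) \<noteq> 0" using u(1) by auto
    have "coeff ?p i = u (?P i)"
      using i by (simp add: coeff_sum)
    then have "?p \<noteq> 0" using i(2) by (metis coeff_0)
    ultimately show ?thesis by blast
  qed
qed

text \<open>
  Fitting's lemma in ring form.  Divide an annihilating polynomial by the largest power \<open>X\<^sup>m\<close> that
  divides it; the quotient has an invertible constant term, and solving for it expresses \<open>x\<^sup>m\<close> as a
  multiple of \<open>x\<^bsup>m+1\<^esup>\<close> by a polynomial in \<open>x\<close>.
\<close>

lemma strongly_pi_regular:
  fixes x :: 'a
  shows "\<exists>m r. r * x = x * r \<and> x ^ m = x ^ Suc m * r"
proof -
  have *: "\<exists>m q. coeff q 0 \<noteq> 0 \<and> peval sc x 1 p = x ^ m * peval sc x 1 q" if "p \<noteq> 0" for p :: "'k poly"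
    using that
  proof (induction p)
    case 0
    then show ?case by simp
  next
    case (pCons a p)
    show ?case
    proof (cases "a = 0")
      case True
      then have "p \<noteq> 0" using pCons by auto
      then obtain m q where "coeff q 0 \<noteq> 0" "peval sc x 1 p = x ^ m * peval sc x 1 q"
        using pCons by auto
      then show ?thesis using True
        by (intro exI[of _ "Suc m"] exI[of _ q]) (simp add: peval_pCons sc_alg mult.assoc)
    next
      case False
      then show ?thesis by (intro exI[of _ 0] exI[of _ "pCons a p"]) simp
    qed
  qed
  obtain p where "p \<noteq> 0" "peval sc x 1 p = 0" using annihilating_poly by blast
  with * obtain m q where q: "coeff q 0 \<noteq> 0" "x ^ m * peval sc x 1 q = 0" by metis
  obtain a q' where aq: "q = pCons a q'" by (cases q)
  then have a: "a \<noteq> 0" using q by simp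
  have "sc a (x ^ m) + x ^ Suc m * peval sc x 1 q' = 0"
    using q(2) by (simp add: aq peval_pCons distrib_left sc_alg power_commutes mult.assoc[symmetric])
  then have "sc (inverse a) (sc a (x ^ m)) = sc (inverse a) (- (x ^ Suc m * peval sc x 1 q'))"
    by (simp add: add_eq_0_iff2)
  then have "x ^ m = x ^ Suc m * (- sc (inverse a) (peval sc x 1 q'))"
    using a by (simp add: sc_alg)
  moreover have "(- sc (inverse a) (peval sc x 1 q')) * x = x * (- sc (inverse a) (peval sc x 1 q'))"
    by (simp add: sc_alg peval_commute)
  ultimately show ?thesis by blast
qed

end

section \<open>Primitive idempotents and their indecomposable projectives\<close>

lemma primitive_idem_corner:
  assumes e: "primitive_idem e" and u: "u * u = u" "e * u = u" "u * e = u"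
  shows "u = 0 \<or> u = e"
proof (rule ccontr)
  assume c: "\<not> ?thesis"
  have "(e - u) * (e - u) = e - u" "u * (e - u) = 0" "(e - u) * u = 0" "e = u + (e - u)" "e - u \<noteq> 0"
    using e u c by (auto simp add: primitive_idem_def algebra_simps)
  then show False using e u(1) c unfolding primitive_idem_def by metis
qed

text \<open>
  The ring \<open>e A e\<close> is local.  From \<open>x\<^sup>m = x\<^bsup>m+1\<^esup> r\<close> one gets the idempotent \<open>u = x\<^sup>M r\<^sup>M\<close> with \<open>x\<^sup>M = x\<^sup>M u\<close>.
  As \<open>e\<close> is primitive, either \<open>u = e\<close> and \<open>x\<close> is invertible, or \<open>u = 0\<close>, and then \<open>x\<close> is nilpotent and
  \<open>e - x\<close> is invertible by the geometric series.
\<close>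

lemma corner_local:
  fixes sc :: "'k::field \<Rightarrow> 'a::ring_1 \<Rightarrow> 'a" and e :: 'a
  assumes fd: "fd_algebra sc" and e: "primitive_idem e"
    and x: "e * x = x" "x * e = x" and xy: "e = x + (y::'a::ring_1)"
  shows "(\<exists>c. c * x = e) \<or> (\<exists>c. c * y = e)"
proof -
  obtain m r where r: "r * x = x * r" and m: "x ^ m = x ^ Suc m * r"
    using strongly_pi_regular[OF fd, of x] by metis
  have it: "x ^ m = x ^ (m + k) * r ^ k" for k
  proof (induction k)
    case (Suc k)
    have "x ^ (m + k) * r ^ k = x ^ k * x ^ m * r ^ k" by (simp add: power_add[symmetric] add.commute)
    also have "\<dots> = x ^ k * (x ^ Suc m * r) * r ^ k" using m by simp
    also have "\<dots> = (x ^ k * x ^ Suc m) * (r * r ^ k)" by (simp only: mult.assoc)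
    also have "\<dots> = x ^ (m + Suc k) * r ^ Suc k" by (simp add: power_add[symmetric] add.commute del: power_Suc flip: power_Suc)
    finally show ?case using Suc by simp
  qed simp
  \<comment> \<open>A positive exponent, so that the idempotent below lies in \<open>e A e\<close>.\<close>
  define M where "M = Suc m"
  have rp: "r ^ k * x ^ l = x ^ l * r ^ k" for k l
    by (metis r power_commuting_commutes)
  have M: "x ^ M = x ^ M * (x ^ M * r ^ M)"
  proof -
    have "x ^ M = x * x ^ m" by (simp add: M_def)
    also have "\<dots> = x * (x ^ (m + M) * r ^ M)" using it by metis
    also have "\<dots> = x ^ (M + M) * r ^ M" by (simp add: M_def mult.assoc)
    also have "\<dots> = x ^ M * (x ^ M * r ^ M)" by (simp only: power_add mult.assoc)
    finally show ?thesis .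
  qed
  define u where "u = x ^ M * r ^ M"
  have "u * u = x ^ M * (x ^ M * r ^ M) * r ^ M" by (simp add: u_def mult.assoc rp flip: mult.assoc[of "r ^ M" "x ^ M"])
  then have "u * u = u" using M by (simp add: u_def)
  moreover have "e * u = u" using x by (simp add: u_def M_def mult.assoc[symmetric])
  moreover have "u * e = u"
  proof -
    have "x ^ M * e = x ^ M" using x by (simp add: M_def power_Suc2 mult.assoc del: power_Suc)
    then show ?thesis by (metis mult.assoc rp u_def)
  qed
  ultimately consider "u = 0" | "u = e" using primitive_idem_corner[OF e] by blast
  then show ?thesis
  proof cases
    case 1
    then have "x ^ M = 0" using M by (simp add: u_def)
    moreover have "(\<Sum>i<N. x ^ i) * (1 - x) = 1 - x ^ N" for N
    proof (induction N)
      case (Suc N)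
      have "(\<Sum>i<Suc N. x ^ i) * (1 - x) = 1 - x ^ N + x ^ N * (1 - x)"
        using Suc by (simp add: distrib_right)
      then show ?case by (simp add: right_diff_distrib power_commutes)
    qed simp
    ultimately have "(\<Sum>i<M. x ^ i) * (1 - x) = 1" by simp
    moreover have "y = (1 - x) * e" using x xy by (simp add: algebra_simps)
    ultimately have "(\<Sum>i<M. x ^ i) * y = e" by (simp flip: mult.assoc)
    then show ?thesis by blast
  next
    case 2
    then have "r ^ M * x ^ M = e" by (simp add: u_def rp)
    then have "r ^ M * x ^ m * x = e" by (simp only: M_def power_Suc2 mult.assoc)
    then show ?thesis by blast
  qed
qed

lemma Pmod_car:
  assumes "e * e = e"
  shows "x \<in> car (Pmod e) \<longleftrightarrow> x * e = x"
  using assms by (auto simp: Pmod_def mult.assoc intro: sym)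

lemma Pmod_act: "act (Pmod e) = (*)"
  by (simp add: Pmod_def)

text \<open>
  Two proper submodules of \<open>A e\<close> do not add up to \<open>A e\<close>; one multiplies by \<open>e\<close> from the left to get into
  the corner ring.
\<close>

lemma indec_projective_local:
  fixes sc :: "'k::field \<Rightarrow> 'a::ring_1 \<Rightarrow> 'a" and e :: 'a
  assumes fd: "fd_algebra sc" and e: "primitive_idem e"
    and x: "x * e = x" and xy: "e = x + (y::'a::ring_1)"
  shows "(\<exists>c. c * x = e) \<or> (\<exists>c. c * y = e)"
proof -
  have ee: "e * e = e" using e by (simp add: primitive_idem_def)
  have "e * e = e * (x + y)" using xy by simp
  then have "e = e * x + e * y" using ee by (simp add: algebra_simps)
  moreover have "e * (e * x) = e * x" by (simp add: ee flip: mult.assoc)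
  moreover have "e * x * e = e * x" using x by (simp add: mult.assoc)
  ultimately have "(\<exists>c. c * (e * x) = e) \<or> (\<exists>c. c * (e * y) = e)"
    using corner_local[OF fd e] by blast
  then show ?thesis by (metis mult.assoc)
qed

text \<open>
  A maximal submodule that misses \<open>y\<close> would together with \<open>A y\<close> be all of \<open>A e\<close>, against locality.
\<close>

lemma nongenerator_in_radical:
  fixes sc :: "'k::field \<Rightarrow> 'a::ring_1 \<Rightarrow> 'a" and e :: 'a
  assumes fd: "fd_algebra sc" and e: "primitive_idem e"
    and y: "y * e = y" "\<And>c. c * y \<noteq> e"
  shows "y \<in> radical (Pmod e)"
proof -
  have ee: "e * e = e" using e by (simp add: primitive_idem_def)
  note P = Pmod_car[OF ee] Pmod_act
  have "y \<in> N" if N: "submodule N (Pmod e)" "N \<noteq> car (Pmod e)"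
    and mx: "\<forall>L. submodule L (Pmod e) \<and> N \<subseteq> L \<longrightarrow> L = N \<or> L = car (Pmod e)" for N
  proof (rule ccontr)
    assume yN: "y \<notin> N"
    note N' = N(1)[unfolded submodule_def P]
    let ?L = "{u + a * y | u a. u \<in> N}"
    have "submodule ?L (Pmod e)"
      unfolding submodule_def P
    proof (intro conjI ballI allI)
      show "?L \<subseteq> car (Pmod e)" using N' y by (auto simp: P algebra_simps)
      show "0 \<in> ?L" using N' by (intro CollectI exI[of _ 0]) simp
      show "v + w \<in> ?L" if "v \<in> ?L" "w \<in> ?L" for v w
      proof -
        from that obtain u a u' a' where "v = u + a * y" "w = u' + a' * y" "u \<in> N" "u' \<in> N"
          unfolding mem_Collect_eq by metis
        then show ?thesis using N' by (intro CollectI exI[of _ "u + u'"] exI[of _ "a + a'"]) (simp add: algebra_simps)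
      qed
      show "b * v \<in> ?L" if "v \<in> ?L" for b v
      proof -
        from that obtain u a where "v = u + a * y" "u \<in> N" unfolding mem_Collect_eq by metis
        then show ?thesis using N' by (intro CollectI exI[of _ "b * u"] exI[of _ "b * a"]) (simp add: algebra_simps)
      qed
    qed
    moreover have "N \<subseteq> ?L"
      by (rule subsetI, rule CollectI, rule exI, rule exI[of _ 0]) simp
    moreover have "y \<in> ?L" using N' by (intro CollectI exI[of _ 0] exI[of _ 1]) simp
    ultimately have "?L = car (Pmod e)" using mx yN by blast
    moreover have "e \<in> car (Pmod e)" by (simp add: P ee)
    ultimately obtain u a where ua: "e = u + a * y" "u \<in> N" by blast
    then have "u \<in> car (Pmod e)" using N' by blast
    then have "u * e = u" by (simp add: P)
    then consider c where "c * u = e" | c where "c * (a * y) = e"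
      using indec_projective_local[OF fd e _ ua(1)] by blast
    then show False
    proof cases
      case 1
      then have "e \<in> N" using ua N' by metis
      then have "car (Pmod e) \<subseteq> N" using N' by (auto simp: P) (metis)
      then show False using N N' by blast
    next
      case 2
      then show False using y by (metis mult.assoc)
    qed
  qed
  then show ?thesis using y by (auto simp: radical_def P)
qed

text \<open>
  By locality, the elements of \<open>A e\<close> that do not generate it form a submodule, which then is the
  unique maximal one.
\<close>

lemma idem_notin_radical:
  fixes sc :: "'k::field \<Rightarrow> 'a::ring_1 \<Rightarrow> 'a" and e :: 'a
  assumes fd: "fd_algebra sc" and e: "primitive_idem e"
  shows "e \<notin> radical (Pmod e)"
proof -
  have ee: "e * e = e" "e \<noteq> 0" using e by (simp_all add: primitive_idem_def)
  note P = Pmod_car[OF ee(1)] Pmod_act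
  let ?N = "{y. y * e = y \<and> (\<forall>c. c * y \<noteq> e)}"
  have "submodule ?N (Pmod e)"
    unfolding submodule_def P
  proof (intro conjI ballI allI)
    show "?N \<subseteq> car (Pmod e)" by (auto simp: P)
    show "0 \<in> ?N" using ee by simp
    show "v + w \<in> ?N" if "v \<in> ?N" "w \<in> ?N" for v w
    proof -
      have "c * (v + w) \<noteq> e" for c
      proof
        assume "c * (v + w) = e"
        then have "e = c * v + c * w" by (simp add: algebra_simps)
        moreover have "c * v * e = c * v" using that by (simp add: mult.assoc)
        ultimately have "(\<exists>d. d * (c * v) = e) \<or> (\<exists>d. d * (c * w) = e)"
          using indec_projective_local[OF fd e] by blast
        then show False using that by (auto simp flip: mult.assoc)
      qed
      then show ?thesis using that by (simp add: algebra_simps)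
    qed
    show "b * v \<in> ?N" if "v \<in> ?N" for b v
      using that by (auto simp: mult.assoc) (metis mult.assoc)
  qed
  moreover have "e \<in> car (Pmod e)" "e \<notin> ?N" using ee by (auto simp: P intro: exI[of _ 1])
  moreover have "L = ?N \<or> L = car (Pmod e)" if L: "submodule L (Pmod e)" "?N \<subseteq> L" for L
  proof (rule disjCI)
    note L' = L(1)[unfolded submodule_def P]
    assume "L \<noteq> car (Pmod e)"
    have "y \<in> ?N" if "y \<in> L" for y
    proof -
      have "c * y \<noteq> e" for c
      proof
        assume "c * y = e"
        then have "e \<in> L" using that L' by metis
        then have "car (Pmod e) \<subseteq> L" using L' by (auto simp: P) (metis)
        then show False using L' \<open>L \<noteq> car (Pmod e)\<close> by blast
      qed
      then show ?thesis using L' that by (auto simp: P)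
    qed
    then show "L = ?N" using L(2) by blast
  qed
  ultimately show ?thesis unfolding radical_def by blast
qed

text \<open>
  A root \<open>c\<close> of an annihilating polynomial of least degree splits off a linear factor, and the cofactor
  does not annihilate; so it yields an element on which \<open>x\<close> acts as \<open>c\<close>.
\<close>

lemma eigenvector:
  fixes sc :: "'k::alg_closed_field \<Rightarrow> 'a::ring_1 \<Rightarrow> 'a"
  assumes fd: "fd_algebra sc" and z: "z \<noteq> 0"
  shows "\<exists>c p. peval sc x z p \<noteq> 0 \<and> x * peval sc x z p = sc c (peval sc x z p)"
proof -
  let ?Q = "\<lambda>p. p \<noteq> 0 \<and> peval sc x z p = 0"
  obtain p0 where "?Q p0" using annihilating_poly[OF fd] by blast
  then obtain p where p: "?Q p" and mn: "\<And>q. ?Q q \<Longrightarrow> degree p \<le> degree q"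
    using ex_has_least_nat[of ?Q p0 degree] by blast
  have "degree p > 0"
  proof (rule ccontr)
    assume "\<not> 0 < degree p"
    then obtain a where a: "p = [:a:]" by (auto elim: degree_eq_zeroE)
    then have "sc a z = 0" "a \<noteq> 0" using p by (simp_all add: peval_pCons[OF fd] peval_0[OF fd])
    then have "sc (inverse a) (sc a z) = 0" by (simp add: sc_alg[OF fd])
    then show False using \<open>a \<noteq> 0\<close> z by (simp add: sc_alg[OF fd])
  qed
  then obtain c where "poly p c = 0" using alg_closed_imp_poly_has_root by blast
  then obtain q where q: "p = [:- c, 1:] * q" by (auto simp: poly_eq_0_iff_dvd)
  then have "q \<noteq> 0" using p by auto
  then have "degree q < degree p" unfolding q by (subst degree_mult_eq) auto
  then have "peval sc x z q \<noteq> 0" using mn[of q] \<open>q \<noteq> 0\<close> by force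
  moreover have "x * peval sc x z q = sc c (peval sc x z q)"
    using p unfolding q peval_linear_factor[OF fd] by simp
  ultimately show ?thesis by blast
qed

lemma peval_corner:
  fixes sc :: "'k::field \<Rightarrow> 'a::ring_1 \<Rightarrow> 'a"
  assumes fd: "fd_algebra sc" and "e * e = e" "e * x = x"
  shows "e * peval sc x e p = peval sc x e p"
  by (induction p) (use assms in \<open>simp_all add: peval_0[OF fd] peval_pCons[OF fd] sc_alg[OF fd] distrib_left flip: mult.assoc\<close>)

lemma left_moduleD:
  assumes "left_module M"
  shows "0 \<in> car M" "\<And>x y. x \<in> car M \<Longrightarrow> y \<in> car M \<Longrightarrow> x + y \<in> car M"
    "\<And>a x. x \<in> car M \<Longrightarrow> act M a x \<in> car M"
    "\<And>a x y. x \<in> car M \<Longrightarrow> y \<in> car M \<Longrightarrow> act M a (x + y) = act M a x + act M a y"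
    "\<And>a b x. x \<in> car M \<Longrightarrow> act M (a + b) x = act M a x + act M b x"
    "\<And>a b x. x \<in> car M \<Longrightarrow> act M (a * b) x = act M a (act M b x)"
    "\<And>x. x \<in> car M \<Longrightarrow> act M 1 x = x"
    "\<And>x. x \<in> car M \<Longrightarrow> act M 0 x = 0" "\<And>a. act M a 0 = 0"
    "\<And>a x. x \<in> car M \<Longrightarrow> act M (- a) x = - act M a x"
    "\<And>x. x \<in> car M \<Longrightarrow> - x \<in> car M"
    "\<And>x y. x \<in> car M \<Longrightarrow> y \<in> car M \<Longrightarrow> x - y \<in> car M"
    "\<And>a x. x \<in> car M \<Longrightarrow> act M a (- x) = - act M a x"
    "\<And>a x y. x \<in> car M \<Longrightarrow> y \<in> car M \<Longrightarrow> act M a (x - y) = act M a x - act M a y"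
proof -
  show 1: "0 \<in> car M" "\<And>x y. x \<in> car M \<Longrightarrow> y \<in> car M \<Longrightarrow> x + y \<in> car M"
    "\<And>a x. x \<in> car M \<Longrightarrow> act M a x \<in> car M"
    "\<And>a x y. x \<in> car M \<Longrightarrow> y \<in> car M \<Longrightarrow> act M a (x + y) = act M a x + act M a y"
    "\<And>a b x. x \<in> car M \<Longrightarrow> act M (a + b) x = act M a x + act M b x"
    "\<And>a b x. x \<in> car M \<Longrightarrow> act M (a * b) x = act M a (act M b x)"
    "\<And>x. x \<in> car M \<Longrightarrow> act M 1 x = x"
    using assms by (auto simp: left_module_def)
  show 2: "act M 0 x = 0" if "x \<in> car M" for x
    using 1(5)[OF that, of 0 0] by simp
  show 3: "act M a 0 = 0" for a
    using 1(4)[OF 1(1) 1(1), of a] by simp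
  show 4: "act M (- a) x = - act M a x" if "x \<in> car M" for a x
    using 1(5)[OF that, of a "- a"] 2[OF that] by (simp add: eq_neg_iff_add_eq_0 add.commute)
  show 5: "- x \<in> car M" if "x \<in> car M" for x
    using 4[OF that, of 1] 1(3)[OF that, of "- 1"] 1(7)[OF that] by simp
  show 6: "x - y \<in> car M" if "x \<in> car M" "y \<in> car M" for x y
    using 1(2)[OF that(1) 5[OF that(2)]] by simp
  show 7: "act M a (- x) = - act M a x" if "x \<in> car M" for a x
    using 1(4)[OF that 5[OF that], of a] 3[of a] by (simp add: eq_neg_iff_add_eq_0 add.commute)
  show "act M a (x - y) = act M a x - act M a y" if "x \<in> car M" "y \<in> car M" for a x y
    using 1(4)[OF that(1) 5[OF that(2)], of a] 7[OF that(2)] by simp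
qed

text \<open>
  Stated for maps that are additive only on a carrier, so that it serves homomorphisms, twisted maps
  and actions alike.
\<close>

lemma additive_sum:
  assumes M: "left_module M" and u: "\<And>x y. x \<in> car M \<Longrightarrow> y \<in> car M \<Longrightarrow> u (x + y) = u x + (u y :: 'n::ab_group_add)"
    and z: "\<And>k. k \<in> K \<Longrightarrow> z k \<in> car M"
  shows "(\<Sum>k\<in>K. z k) \<in> car M \<and> u (\<Sum>k\<in>K. z k) = (\<Sum>k\<in>K. u (z k))"
proof -
  have "u 0 = 0" using u[of 0 0] left_moduleD(1)[OF M] by simp
  then show ?thesis using z
    by (induction K rule: infinite_finite_induct) (auto simp: left_moduleD(1,2)[OF M] u)
qed

section \<open>The annihilator of the sum of the simple modules\<close>

locale star_setting =
  fixes sc :: "'k::alg_closed_field \<Rightarrow> 'a::ring_1 \<Rightarrow> 'a"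
    and f :: "'a \<Rightarrow> 'a \<Rightarrow> 'a"
    and n :: nat and e :: "nat \<Rightarrow> 'a"
    and S :: "('a, 's::ab_group_add) lmod"
    and R :: "('a, 's) resolution"
    and C :: "nat \<Rightarrow> nat \<Rightarrow> nat \<Rightarrow> 'a"
  assumes fd: "fd_algebra sc"
    and coc: "hochschild_2_cocycle sc f"
    and idem: "idempotent_decomposition n e"
    and simples: "sum_of_simples n e S"
    and star: "star_resolution n e f S R"
    and adm: "admissible_C e f R C"
begin

lemma prim: "i < n \<Longrightarrow> primitive_idem (e i)"
  and orth: "i < n \<Longrightarrow> j < n \<Longrightarrow> i \<noteq> j \<Longrightarrow> e i * e j = 0"
  and sum_e: "(\<Sum>i<n. e i) = 1"
  and non_iso: "i < n \<Longrightarrow> j < n \<Longrightarrow> iso_mod (Pmod (e i)) (Pmod (e j)) \<Longrightarrow> i = j"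
  using idem unfolding idempotent_decomposition_def by blast+

lemma ee: "i < n \<Longrightarrow> e i * e i = e i"
  and e_nonzero: "i < n \<Longrightarrow> e i \<noteq> 0"
  using prim unfolding primitive_idem_def by blast+

lemma S_module: "left_module S"
  using simples by (simp add: sum_of_simples_def)

lemmas S_simps = left_moduleD[OF S_module]

definition J :: "'a set" where "J = {a. \<forall>s\<in>car S. act S a s = 0}"

lemma J_closed:
  "0 \<in> J" "x \<in> J \<Longrightarrow> y \<in> J \<Longrightarrow> x + y \<in> J" "x \<in> J \<Longrightarrow> - x \<in> J" "x \<in> J \<Longrightarrow> y \<in> J \<Longrightarrow> x - y \<in> J"
  "x \<in> J \<Longrightarrow> a * x \<in> J" "x \<in> J \<Longrightarrow> x * a \<in> J" "x \<in> J \<Longrightarrow> sc c x \<in> J"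
proof -
  show "0 \<in> J" and add: "x \<in> J \<Longrightarrow> y \<in> J \<Longrightarrow> x + y \<in> J" and neg: "x \<in> J \<Longrightarrow> - x \<in> J"
    and *: "x \<in> J \<Longrightarrow> a * x \<in> J" "x \<in> J \<Longrightarrow> x * a \<in> J" for x y a
    by (auto simp: J_def S_simps)
  show "x - y \<in> J" if "x \<in> J" "y \<in> J"
    using add[OF that(1) neg[OF that(2)]] by simp
  have "sc c x = sc c 1 * x" by (simp add: sc_alg[OF fd])
  then show "x \<in> J \<Longrightarrow> sc c x \<in> J" using * by simp
qed

lemma J_sum: "(\<And>k. k \<in> K \<Longrightarrow> x k \<in> J) \<Longrightarrow> (\<Sum>k\<in>K. x k) \<in> J"
  by (induction K rule: infinite_finite_induct) (auto simp: J_closed)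

lemma simple_tops:
  obtains V q where "\<And>i. i < n \<Longrightarrow> submodule (V i) S" "\<And>i. i < n \<Longrightarrow> q i \<in> hom (Pmod (e i)) S"
    "\<And>i. i < n \<Longrightarrow> q i ` car (Pmod (e i)) = V i"
    "\<And>i. i < n \<Longrightarrow> ker (Pmod (e i)) (q i) = radical (Pmod (e i))"
    "\<And>x. x \<in> car S \<Longrightarrow> \<exists>y. (\<forall>i<n. y i \<in> V i) \<and> x = (\<Sum>i<n. y i)"
proof -
  obtain V q where Vq: "\<forall>i<n. submodule (V i) S \<and> q i \<in> hom (Pmod (e i)) S \<and>
      q i ` car (Pmod (e i)) = V i \<and> ker (Pmod (e i)) (q i) = radical (Pmod (e i))"
    and sp: "\<forall>x\<in>car S. \<exists>y. (\<forall>i<n. y i \<in> V i) \<and> x = (\<Sum>i<n. y i)"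
    using simples unfolding sum_of_simples_def by (elim conjE exE) (rule that)
  have V: "submodule (V i) S" "q i \<in> hom (Pmod (e i)) S" "q i ` car (Pmod (e i)) = V i"
    "ker (Pmod (e i)) (q i) = radical (Pmod (e i))" if "i < n" for i
    using Vq that by simp_all
  show thesis by (rule that[of V q]) (use V sp in auto)
qed

text \<open>
  \<open>S\<close> is the sum of the tops of the \<open>A e\<^sub>k\<close>, and an element of \<open>A e\<^sub>k\<close> that does not generate \<open>A e\<^sub>k\<close> vanishes
  in the top.
\<close>

lemma J_I:
  assumes a: "\<And>k b c. k < n \<Longrightarrow> c * (a * b * e k) \<noteq> e k"
  shows "a \<in> J"
proof -
  obtain V q where V: "\<And>i. i < n \<Longrightarrow> submodule (V i) S" "\<And>i. i < n \<Longrightarrow> q i \<in> hom (Pmod (e i)) S"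
    "\<And>i. i < n \<Longrightarrow> q i ` car (Pmod (e i)) = V i"
    "\<And>i. i < n \<Longrightarrow> ker (Pmod (e i)) (q i) = radical (Pmod (e i))"
    and sp: "\<And>x. x \<in> car S \<Longrightarrow> \<exists>y. (\<forall>i<n. y i \<in> V i) \<and> x = (\<Sum>i<n. y i)"
    by (rule simple_tops) (rule that)
  have *: "act S a y = 0" if k: "k < n" and y: "y \<in> V k" for k y
  proof -
    obtain z where z: "z \<in> car (Pmod (e k))" "y = q k z" using V(3)[OF k] y by blast
    have ze: "z * e k = z" using z k by (simp add: Pmod_car ee)
    have "a * z \<in> radical (Pmod (e k))"
    proof (rule nongenerator_in_radical[OF fd prim[OF k]])
      show "a * z * e k = a * z" using ze by (simp add: mult.assoc)
      show "c * (a * z) \<noteq> e k" for c using a[OF k, of c z] ze by (simp add: mult.assoc)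
    qed
    then have "q k (a * z) = 0" using V(4)[OF k] by (auto simp: ker_def)
    then show ?thesis using V(2)[OF k] z by (simp add: hom_def Pmod_act)
  qed
  have "act S a s = 0" if s: "s \<in> car S" for s
  proof -
    obtain y where y: "\<And>i. i < n \<Longrightarrow> y i \<in> V i" "s = (\<Sum>i<n. y i)" using sp[OF s] by metis
    have "y i \<in> car S" if "i < n" for i using y(1)[OF that] V(1)[OF that] by (auto simp: submodule_def)
    then have "act S a s = (\<Sum>i<n. act S a (y i))"
      unfolding y(2) using additive_sum[OF S_module, where u = "act S a" and K = "{..<n}" and z = y] S_simps(4) by auto
    then show ?thesis using * y(1) by simp
  qed
  then show ?thesis by (simp add: J_def)
qed

lemma e_notin_J: assumes i: "i < n" shows "e i \<notin> J"
proof
  assume eJ: "e i \<in> J"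
  obtain q where q: "q \<in> hom (Pmod (e i)) S" "ker (Pmod (e i)) q = radical (Pmod (e i))"
    using simple_tops i by metis
  have eP: "e i \<in> car (Pmod (e i))" using i by (simp add: Pmod_car ee)
  have "q (e i) \<in> car S" using q(1) eP by (simp add: hom_def)
  then have "act S (e i) (q (e i)) = 0" using eJ by (simp add: J_def)
  then have "q (e i * e i) = 0" using q(1) eP by (simp add: hom_def Pmod_act)
  then have "e i \<in> ker (Pmod (e i)) q" using eP i by (simp add: ker_def ee)
  then show False using q(2) idem_notin_radical[OF fd prim[OF i]] by simp
qed

text \<open>
  If \<open>e\<^sub>k\<close> factors through \<open>e\<^sub>i\<close>, then multiplication by the two factors gives mutually inverse maps
  between \<open>A e\<^sub>k\<close> and \<open>A e\<^sub>i\<close>: the product in the other order is a nonzero idempotent below \<open>e\<^sub>i\<close>.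
\<close>

lemma factor_idem:
  assumes i: "i < n" "k < n" and uv: "u * v = e k" "u * e i = u" "e i * v = v" "v * e k = v"
  shows "i = k"
proof -
  \<comment> \<open>Only \<open>u\<close> may lie outside \<open>e\<^sub>k A e\<^sub>i\<close>.\<close>
  define u' where "u' = e k * u"
  have u': "u' * v = e k" "u' * e i = u'" "e k * u' = u'"
    using uv i by (simp_all add: u'_def mult.assoc ee) (simp_all add: ee flip: mult.assoc)
  have "v * u' = 0 \<or> v * u' = e i"
  proof (rule primitive_idem_corner[OF prim[OF i(1)]])
    show "v * u' * (v * u') = v * u'" using u' by (metis mult.assoc)
    show "e i * (v * u') = v * u'" "v * u' * e i = v * u'" using uv u' by (metis mult.assoc)+
  qed
  moreover have "u' * (v * u') * v = e k" using u' i by (metis mult.assoc ee)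
  ultimately have vu: "v * u' = e i" using e_nonzero i by fastforce
  let ?h = "restr0 (car (Pmod (e k))) (\<lambda>x. x * u')"
  note P = Pmod_car[OF ee[OF i(1)]] Pmod_car[OF ee[OF i(2)]] Pmod_act
  have "?h \<in> hom (Pmod (e k)) (Pmod (e i))"
    by (auto simp: hom_def restr0_def P algebra_simps u')
  moreover have "bij_betw ?h (car (Pmod (e k))) (car (Pmod (e i)))"
    by (rule bij_betw_byWitness[where f' = "\<lambda>x. x * v"])
      (auto simp: restr0_def P mult.assoc u' vu uv)
  ultimately have "iso_mod (Pmod (e k)) (Pmod (e i))" by (auto simp: iso_mod_def)
  then show ?thesis using non_iso i by blast
qed

text \<open>
  If it moved some simple module, then \<open>e\<^sub>k\<close> would factor both through \<open>e\<^sub>i\<close> and through \<open>e\<^sub>j\<close>.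
\<close>

lemma off_diagonal_in_J:
  assumes ij: "i < n" "j < n" "i \<noteq> j" shows "e i * a * e j \<in> J"
proof (rule J_I, rule notI)
  fix k b c assume k: "k < n" and *: "c * (e i * a * e j * b * e k) = e k"
  have "i = k"
    using * k ij by (intro factor_idem[where u = "c * e i" and v = "e i * a * e j * b * e k"])
      (simp_all add: mult.assoc ee, simp_all add: ee flip: mult.assoc)
  moreover have "j = k"
    using * k ij by (intro factor_idem[where u = "c * e i * a * e j" and v = "e j * b * e k"])
      (simp_all add: mult.assoc ee, simp_all add: ee flip: mult.assoc)
  ultimately show False using ij by simp
qed

text \<open>
  This is where the field has to be algebraically closed.  Subtracting an eigenvalue makes \<open>e\<^sub>i a e\<^sub>i\<close> a
  zero divisor in \<open>e\<^sub>i A e\<^sub>i\<close>.  If the difference \<open>y\<close> were not in \<open>J\<close>, then \<open>e\<^sub>i\<close> would factor through \<open>y\<close>,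
  hence \<open>y\<close> would be left invertible in \<open>e\<^sub>i A e\<^sub>i\<close>.
\<close>

lemma diagonal_scalar_mod_J:
  assumes i: "i < n" shows "\<exists>c. e i * a * e i - sc c (e i) \<in> J"
proof -
  let ?e = "e i"
  note eei = ee[OF i]
  define x where "x = ?e * a * ?e"
  have x: "?e * x = x" "x * ?e = x" by (simp_all add: x_def eei mult.assoc) (simp add: eei flip: mult.assoc)
  obtain c p where cp: "peval sc x ?e p \<noteq> 0" "x * peval sc x ?e p = sc c (peval sc x ?e p)"
    using eigenvector[OF fd e_nonzero[OF i]] by blast
  define q where "q = peval sc x ?e p"
  have q: "q \<noteq> 0" "x * q = sc c q" "?e * q = q" using cp peval_corner[OF fd eei x(1)] by (simp_all add: q_def)
  define y where "y = x - sc c ?e"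
  have y: "?e * y = y" "y * ?e = y" "y * q = 0"
    using x q by (simp_all add: y_def algebra_simps sc_alg[OF fd] eei)
  have "y \<in> J"
  proof (rule J_I, rule notI)
    fix k b d assume k: "k < n" and *: "d * (y * b * e k) = e k"
    have "i = k"
      using * k i y by (intro factor_idem[where u = "d * ?e" and v = "y * b * e k"])
      (simp_all add: mult.assoc ee, simp_all add: ee flip: mult.assoc)
    then have *: "d * y * (b * ?e) = ?e" using * by (simp add: mult.assoc)
    let ?w = "?e * b * ?e * d * y"
    have "?w = 0 \<or> ?w = ?e"
    proof (rule primitive_idem_corner[OF prim[OF i]])
      have "?w * ?w = ?e * b * (?e * (d * y * (b * ?e))) * d * y" using y by (metis mult.assoc)
      also have "\<dots> = ?w" unfolding * by (simp add: eei mult.assoc)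
      finally show "?w * ?w = ?w" .
      show "?e * ?w = ?w" by (simp add: eei flip: mult.assoc)
      show "?w * ?e = ?w" using y by (simp add: mult.assoc)
    qed
    then show False
    proof
      assume "?w = 0"
      then have "d * y * ?w * (b * ?e) = 0" by simp
      moreover have "d * y * ?w * (b * ?e) = (d * y * (b * ?e)) * (d * y * (b * ?e))" using y by (metis mult.assoc)
      ultimately show False using * eei e_nonzero[OF i] by simp
    next
      assume "?w = ?e"
      then have "?w * q = q" using q by simp
      then show False using y q by (simp add: mult.assoc)
    qed
  qed
  then show ?thesis unfolding y_def x_def by blast
qed

text \<open>
  Modulo \<open>J\<close> such an element is a nonzero multiple of \<open>e\<^sub>i\<close>, and \<open>e\<^sub>i \<notin> J\<close>; so locality leaves only the
  possibility that it generates.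
\<close>

lemma generator_if_notin_J:
  assumes i: "i < n" and x: "x * e i = x" "x \<notin> J"
  shows "\<exists>c. c * x = e i"
proof -
  have "x = (\<Sum>k<n. e k * x)" by (simp add: sum_e flip: sum_distrib_right)
  also have "\<dots> = e i * x + (\<Sum>k\<in>{..<n} - {i}. e k * x)" using i by (simp add: sum.remove)
  finally have "x = e i * x + (\<Sum>k\<in>{..<n} - {i}. e k * x)" .
  moreover have "(\<Sum>k\<in>{..<n} - {i}. e k * x) \<in> J"
  proof (rule J_sum)
    fix k assume "k \<in> {..<n} - {i}"
    then have "e k * x * e i \<in> J" using off_diagonal_in_J i by simp
    then show "e k * x \<in> J" using x by (simp add: mult.assoc)
  qed
  ultimately have eix: "e i * x \<notin> J" using x J_closed by metis
  obtain c where c: "e i * x * e i - sc c (e i) \<in> J" using diagonal_scalar_mod_J[OF i] by blast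
  define j where "j = e i * x - sc c (e i)"
  have j: "j \<in> J" "j * e i = j" "e i * j = j"
    using c x by (simp_all add: j_def mult.assoc algebra_simps sc_alg[OF fd] ee i) (simp add: ee i flip: mult.assoc)
  have c0: "c \<noteq> 0" using eix j by (auto simp: j_def sc_alg[OF fd])
  have "e i * x = sc c (e i) + j" by (simp add: j_def)
  then have "sc (inverse c) (e i * x) = e i + sc (inverse c) j" using c0 by (simp add: sc_alg[OF fd])
  then have "e i = sc (inverse c) (e i * x) + (- sc (inverse c) j)" by simp
  moreover have "sc (inverse c) (e i * x) * e i = sc (inverse c) (e i * x)"
    using x by (simp add: sc_alg[OF fd] mult.assoc)
  ultimately consider d where "d * sc (inverse c) (e i * x) = e i" | d where "d * (- sc (inverse c) j) = e i"
    using indec_projective_local[OF fd prim[OF i]] by blast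
  then show ?thesis
  proof cases
    case 1
    then have "sc (inverse c) (d * e i) * x = e i" by (simp add: sc_alg[OF fd] mult.assoc)
    then show ?thesis by blast
  next
    case 2
    then have "e i \<in> J" using j J_closed by metis
    then show ?thesis using e_notin_J[OF i] by simp
  qed
qed

end

section \<open>Row vectors, matrices and homomorphisms\<close>

text \<open>
  The action of \<open>A\<close> on rows of any length.  It satisfies the module laws without reference to a carrier.
\<close>

definition smul :: "'a::ring_1 \<Rightarrow> (nat \<Rightarrow> 'a) \<Rightarrow> nat \<Rightarrow> 'a" (infixr "\<odot>" 75) where
  "a \<odot> x = (\<lambda>r. a * x r)"

lemma smul_apply: "(a \<odot> x) r = a * x r"
  by (simp add: smul_def)

lemma smul_simps:
  "a \<odot> (x + y) = a \<odot> x + a \<odot> y" "(a + b) \<odot> x = a \<odot> x + b \<odot> x" "(a * b) \<odot> x = a \<odot> b \<odot> x"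
  "a \<odot> (x - y) = a \<odot> x - a \<odot> y" "(a - b) \<odot> x = a \<odot> x - b \<odot> x"
  "a \<odot> (- x) = - (a \<odot> x)" "(- a) \<odot> x = - (a \<odot> x)" "1 \<odot> x = x" "0 \<odot> x = 0" "a \<odot> 0 = 0"
  by (auto simp: smul_def fun_eq_iff algebra_simps)

lemma smul_sum: "a \<odot> (\<Sum>k\<in>K. x k) = (\<Sum>k\<in>K. a \<odot> x k)" "(\<Sum>k\<in>K. b k) \<odot> y = (\<Sum>k\<in>K. b k \<odot> y)"
  by (induction K rule: infinite_finite_induct) (simp_all add: smul_simps)

lemma sum_apply: "(\<Sum>k\<in>K. x k) r = (\<Sum>k\<in>K. x k r)"
  by (induction K rule: infinite_finite_induct) auto

lemma diag_apply: "diag e is r j = (if j = r \<and> r < length is then e (is ! r) else 0)"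
  by (auto simp: diag_def)

lemma row_mult_diag:
  "row_mult (length is) x (diag e is) j = (if j < length is then x j * e (is ! j) else 0)"
proof -
  have "row_mult (length is) x (diag e is) j
      = (\<Sum>r<length is. if r = j then x j * e (is ! j) else 0)"
    unfolding row_mult_def by (intro sum.cong) (auto simp: diag_apply)
  then show ?thesis by simp
qed

lemma mat_between_entries:
  assumes "mat_between e is js B"
  shows "B r j = (if r < length is \<and> j < length js then e (is ! r) * B r j * e (js ! j) else 0)"
proof -
  have 1: "mat_mult (length is) (diag e is) B r t = (if r < length is then e (is ! r) * B r t else 0)" for t
  proof -
    have "mat_mult (length is) (diag e is) B r t
        = (\<Sum>s<length is. if s = r then e (is ! r) * B r t else 0)"
      unfolding mat_mult_def row_mult_def by (intro sum.cong) (auto simp: diag_apply)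
    then show ?thesis by simp
  qed
  have "B r j = row_mult (length js) (mat_mult (length is) (diag e is) B r) (diag e js) j"
    using assms unfolding mat_between_def by (metis mat_mult_def)
  also have "\<dots> = (if r < length is \<and> j < length js then e (is ! r) * B r j * e (js ! j) else 0)"
    by (simp add: row_mult_diag 1)
  finally show ?thesis .
qed

lemma homD:
  assumes "u \<in> hom M N" "left_module M"
  shows "x \<in> car M \<Longrightarrow> u x \<in> car N" "x \<in> car M \<Longrightarrow> y \<in> car M \<Longrightarrow> u (x + y) = u x + u y"
    "x \<in> car M \<Longrightarrow> u (act M a x) = act N a (u x)" "x \<notin> car M \<Longrightarrow> u x = 0" "u 0 = 0"
    "x \<in> car M \<Longrightarrow> u (- x) = - u x" "x \<in> car M \<Longrightarrow> y \<in> car M \<Longrightarrow> u (x - y) = u x - u y"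
    "(\<And>k. k \<in> K \<Longrightarrow> z k \<in> car M) \<Longrightarrow> u (\<Sum>k\<in>K. z k) = (\<Sum>k\<in>K. u (z k))"
proof -
  show 1: "x \<in> car M \<Longrightarrow> u x \<in> car N" "x \<in> car M \<Longrightarrow> y \<in> car M \<Longrightarrow> u (x + y) = u x + u y"
    "x \<in> car M \<Longrightarrow> u (act M a x) = act N a (u x)" "x \<notin> car M \<Longrightarrow> u x = 0" for x y a
    using assms by (auto simp: hom_def)
  show 2: "u 0 = 0" using 1(2)[of 0 0] left_moduleD(1)[OF assms(2)] by simp
  show 3: "u (- x) = - u x" if "x \<in> car M" for x
    using 1(2)[OF that left_moduleD(11)[OF assms(2) that]] 2 by (simp add: eq_neg_iff_add_eq_0 add.commute)
  show "u (x - y) = u x - u y" if "x \<in> car M" "y \<in> car M"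
    using 1(2)[OF that(1) left_moduleD(11)[OF assms(2) that(2)]] 3[OF that(2)] by simp
  show "(\<And>k. k \<in> K \<Longrightarrow> z k \<in> car M) \<Longrightarrow> u (\<Sum>k\<in>K. z k) = (\<Sum>k\<in>K. u (z k))"
    using additive_sum[OF assms(2) 1(2), of K z] by simp
qed

lemma hom_comp:
  assumes "u \<in> hom M N" "v \<in> hom N L" "left_module N"
  shows "v \<circ> u \<in> hom M L"
proof -
  have "v 0 = 0" using homD(5)[OF assms(2,3)] .
  then show ?thesis using assms(1,2) by (auto simp: hom_def)
qed

lemma hom_diff:
  assumes "u \<in> hom M N" "v \<in> hom M N" "left_module M" "left_module N"
  shows "(\<lambda>x. u x - v x) \<in> hom M N"
  unfolding hom_def
  by (intro CollectI conjI ballI allI impI;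
      simp add: homD(1-4)[OF assms(1,3)] homD(1-4)[OF assms(2,3)] left_moduleD[OF assms(3)] left_moduleD[OF assms(4)])

lemma hom_add:
  assumes "u \<in> hom M N" "v \<in> hom M N" "left_module M" "left_module N"
  shows "(\<lambda>x. u x + v x) \<in> hom M N"
  unfolding hom_def
  by (intro CollectI conjI ballI allI impI;
      simp add: homD(1-4)[OF assms(1,3)] homD(1-4)[OF assms(2,3)] left_moduleD[OF assms(3)] left_moduleD[OF assms(4)])

lemma zero_hom: "left_module N \<Longrightarrow> (\<lambda>x. 0) \<in> hom M N"
  by (simp add: hom_def left_moduleD(1,9))

context star_setting
begin

section \<open>The projective modules of the resolution and their radicals\<close>

lemma f_simps:
  "f a (x + y) = f a x + f a y" "f (a + b) x = f a x + f b x"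
  "f a (- x) = - f a x" "f (- a) x = - f a x" "f a 0 = 0" "f 0 a = 0"
proof -
  have l: "Vector_Spaces.linear sc sc (f a)" "Vector_Spaces.linear sc sc (\<lambda>a. f a b)" for a b
    using coc by (auto simp: hochschild_2_cocycle_def)
  show 1: "f a (x + y) = f a x + f a y" "f (a + b) x = f a x + f b x" for a b x y
    using l(1)[of a] l(2)[of x] unfolding Vector_Spaces.linear_def module_hom_def module_hom_axioms_def by blast+
  show 2: "f a 0 = 0" "f 0 a = 0" for a using 1(1)[of a 0 0] 1(2)[of 0 0 a] by simp_all
  show "f a (- x) = - f a x" "f (- a) x = - f a x"
    using 1(1)[of a "- x" x] 1(2)[of "- a" a x] 2 by (simp_all add: eq_neg_iff_add_eq_0)
qed

lemma cocycle: "f (a * b) c = a * f b c + f a (b * c) - f a b * c"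
proof -
  have "a * f b c - f (a * b) c + f a (b * c) - f a b * c = 0"
    using coc by (simp add: hochschild_2_cocycle_def)
  then show ?thesis by (simp add: algebra_simps)
qed

text \<open>
  For \<open>y \<in> J\<close> with \<open>y e = y\<close> this shows \<open>f(y, e) e \<in> J\<close>.
\<close>

lemma f_idem: "y * u = y \<Longrightarrow> u * u = u \<Longrightarrow> f y u * u = y * f u u"
  using cocycle[of y u u] by simp

lemma resolution: "minimal_resolution n e S R"
  using star by (simp add: star_resolution_def)

abbreviation vx :: "nat \<Rightarrow> nat \<Rightarrow> nat" where "vx k r \<equiv> verts R k ! r"

lemma vx: "r < rk R k \<Longrightarrow> vx k r < n"
proof -
  assume "r < rk R k"
  then have "vx k r \<in> set (verts R k)" by (simp add: rk_def)
  then show ?thesis using resolution by (auto simp: minimal_resolution_def)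
qed

lemma vx_idem [simp]: "r < rk R k \<Longrightarrow> e (vx k r) * e (vx k r) = e (vx k r)"
  using ee[OF vx] .

abbreviation Q :: "nat \<Rightarrow> (nat \<Rightarrow> 'a) set" where "Q k \<equiv> car (Qres e R k)"

lemma Q_iff: "x \<in> Q k \<longleftrightarrow> (\<forall>r<rk R k. x r * e (vx k r) = x r) \<and> (\<forall>r\<ge>rk R k. x r = 0)"
  using Pmod_car[OF vx_idem] by (auto simp: Qres_def Qmod_def rk_def)

lemma Q_D: "x \<in> Q k \<Longrightarrow> r < rk R k \<Longrightarrow> x r * e (vx k r) = x r" "x \<in> Q k \<Longrightarrow> \<not> r < rk R k \<Longrightarrow> x r = 0"
  by (auto simp: Q_iff)

lemma Q_act: "act (Qres e R k) = (\<odot>)"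
  by (simp add: Qres_def Qmod_def smul_def fun_eq_iff)

lemma Q_module: "left_module (Qres e R k)"
  by (auto simp: left_module_def Q_act Q_iff smul_simps smul_apply distrib_right mult.assoc)

lemmas Q_simps = left_moduleD[OF Q_module, unfolded Q_act]

lemma Q_sum: "(\<And>i. i \<in> K \<Longrightarrow> x i \<in> Q k) \<Longrightarrow> (\<Sum>i\<in>K. x i) \<in> Q k"
  using additive_sum[OF Q_module, where u = "\<lambda>x. x"] by blast

text \<open>
  The generator of the \<open>r\<close>-th summand of \<open>Q\<^sub>k\<close>, as a row of the diagonal matrix of \<open>Q\<^sub>k\<close>.
\<close>

abbreviation eps :: "nat \<Rightarrow> nat \<Rightarrow> nat \<Rightarrow> 'a" where "eps k r \<equiv> diag e (verts R k) r"

lemma eps_apply: "eps k r j = (if j = r \<and> r < rk R k then e (vx k r) else 0)"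
  by (simp add: diag_apply rk_def)

lemma eps_in: "eps k r \<in> Q k"
  by (auto simp: Q_iff eps_apply)

lemma e_eps: "r < rk R k \<Longrightarrow> e (vx k r) \<odot> eps k r = eps k r"
  by (auto simp: smul_def eps_apply fun_eq_iff)

lemma Q_expand: assumes "x \<in> Q k" shows "(\<Sum>r<rk R k. x r \<odot> eps k r) = x"
proof
  fix j
  have "(\<Sum>r<rk R k. x r \<odot> eps k r) j = (\<Sum>r<rk R k. if r = j then x j * e (vx k j) else 0)"
    unfolding sum_apply smul_apply by (intro sum.cong) (auto simp: eps_apply)
  then show "(\<Sum>r<rk R k. x r \<odot> eps k r) j = x j" using Q_D[OF assms] by simp
qed

lemmas QhomD = homD[OF _ Q_module, unfolded Q_act]

lemma hom_expand:
  assumes u: "u \<in> hom (Qres e R k) N" and x: "x \<in> Q k"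
  shows "u x = (\<Sum>r<rk R k. act N (x r) (u (eps k r)))"
proof -
  have "u (\<Sum>r<rk R k. x r \<odot> eps k r) = (\<Sum>r<rk R k. u (x r \<odot> eps k r))"
    by (rule QhomD(8)[OF u]) (simp add: Q_simps eps_in)
  then show ?thesis by (simp add: Q_expand[OF x] QhomD(3)[OF u] eps_in)
qed

lemma hom_on_generators:
  assumes N: "left_module N" and w: "\<And>r. r < rk R k \<Longrightarrow> w r \<in> car N" "\<And>r. r < rk R k \<Longrightarrow> act N (e (vx k r)) (w r) = w r"
  obtains u where "u \<in> hom (Qres e R k) N" "\<And>r. r < rk R k \<Longrightarrow> u (eps k r) = w r"
proof
  note N' = left_moduleD[OF N]
  let ?u = "restr0 (Q k) (\<lambda>x. \<Sum>r<rk R k. act N (x r) (w r))"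
  have sm: "(\<Sum>r<rk R k. z r) \<in> car N" "act N a (\<Sum>r<rk R k. z r) = (\<Sum>r<rk R k. act N a (z r))"
    if "\<And>r. r < rk R k \<Longrightarrow> z r \<in> car N" for z a
    using additive_sum[OF N, where u = "act N a" and z = z and K = "{..<rk R k}"] that N'(4) by auto
  show "?u \<in> hom (Qres e R k) N"
    by (auto simp: hom_def restr0_def Q_act Q_simps sm N' w smul_apply sum.distrib)
  show "?u (eps k r) = w r" if "r < rk R k" for r
  proof -
    have "?u (eps k r) = (\<Sum>t<rk R k. act N (eps k r t) (w t))"
      by (simp add: restr0_def eps_in)
    also have "\<dots> = (\<Sum>t<rk R k. if t = r then w r else 0)"
      by (intro sum.cong) (auto simp: eps_apply w N')
    finally show ?thesis using that by simp
  qed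
qed

text \<open>
  As \<open>J\<close> is the Jacobson radical of \<open>A\<close>, this is the radical of \<open>Q\<^sub>k\<close>.  The description by entries is the
  one that the cocycle can be applied to.
\<close>

definition rad :: "nat \<Rightarrow> (nat \<Rightarrow> 'a) set" where "rad k = {x \<in> Q k. \<forall>r. x r \<in> J}"

lemma radI: "x \<in> Q k \<Longrightarrow> (\<And>r. r < rk R k \<Longrightarrow> x r \<in> J) \<Longrightarrow> x \<in> rad k"
  unfolding rad_def using Q_D(2)[of x k] J_closed(1) by (intro CollectI conjI allI) (simp, metis)

lemma rad_closed:
  "x \<in> rad k \<Longrightarrow> x \<in> Q k" "0 \<in> rad k" "x \<in> rad k \<Longrightarrow> y \<in> rad k \<Longrightarrow> x + y \<in> rad k"
  "x \<in> rad k \<Longrightarrow> y \<in> rad k \<Longrightarrow> x - y \<in> rad k" "x \<in> rad k \<Longrightarrow> a \<odot> x \<in> rad k"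
  "a \<in> J \<Longrightarrow> y \<in> Q k \<Longrightarrow> a \<odot> y \<in> rad k" "(\<And>i. i \<in> K \<Longrightarrow> z i \<in> rad k) \<Longrightarrow> (\<Sum>i\<in>K. z i) \<in> rad k"
proof -
  show 1: "x \<in> rad k \<Longrightarrow> x \<in> Q k" "0 \<in> rad k" "x \<in> rad k \<Longrightarrow> y \<in> rad k \<Longrightarrow> x + y \<in> rad k"
    "x \<in> rad k \<Longrightarrow> y \<in> rad k \<Longrightarrow> x - y \<in> rad k" "x \<in> rad k \<Longrightarrow> a \<odot> x \<in> rad k"
    "a \<in> J \<Longrightarrow> y \<in> Q k \<Longrightarrow> a \<odot> y \<in> rad k" for x y a
    by (auto simp: rad_def Q_simps J_closed smul_apply)
  show "(\<And>i. i \<in> K \<Longrightarrow> z i \<in> rad k) \<Longrightarrow> (\<Sum>i\<in>K. z i) \<in> rad k"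
    by (induction K rule: infinite_finite_induct) (auto simp: 1)
qed

lemma hom_rad:
  assumes u: "u \<in> hom (Qres e R k) (Qres e R j)" and x: "x \<in> rad k"
  shows "u x \<in> rad j"
proof -
  have "u x = (\<Sum>r<rk R k. x r \<odot> u (eps k r))"
    using hom_expand[OF u rad_closed(1)[OF x]] by (simp add: Q_act)
  also have "\<dots> \<in> rad j"
    by (intro rad_closed(6,7)) (use x QhomD(1)[OF u eps_in] in \<open>auto simp: rad_def\<close>)
  finally show ?thesis .
qed

lemma hom_S_rad: "g \<in> hom (Qres e R k) S \<Longrightarrow> x \<in> rad k \<Longrightarrow> g x = 0"
  using hom_expand[of g k S x] QhomD(1)[OF _ eps_in, of g k S] by (auto simp: rad_def J_def)

text \<open>
  If the \<open>r\<close>-th entry of an element of \<open>K\<close> is not in \<open>J\<close>, then it generates the \<open>r\<close>-th summand, so \<open>K\<close> and the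
  other summands add up to \<open>Q\<^sub>k\<close>.
\<close>

lemma superfluous_in_rad:
  assumes sf: "superfluous K (Qres e R k)" and K: "K \<subseteq> Q k" "\<And>a x. x \<in> K \<Longrightarrow> a \<odot> x \<in> K"
  shows "K \<subseteq> rad k"
proof
  fix x assume xK: "x \<in> K"
  then have xQ: "x \<in> Q k" using K by blast
  show "x \<in> rad k"
  proof (rule radI[OF xQ], rule ccontr)
    fix r assume r: "r < rk R k" and xJ: "x r \<notin> J"
    obtain c where c: "c * x r = e (vx k r)"
      using generator_if_notin_J[OF vx[OF r] Q_D(1)[OF xQ r] xJ] by blast
    let ?N = "{z \<in> Q k. z r = 0}"
    have "submodule ?N (Qres e R k)"
      by (auto simp: submodule_def Q_simps Q_act smul_apply)
    moreover have "{x + y |x y. x \<in> K \<and> y \<in> ?N} = Q k"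
    proof (intro equalityI subsetI)
      show "z \<in> {x + y |x y. x \<in> K \<and> y \<in> ?N} \<Longrightarrow> z \<in> Q k" for z
        using K by (auto simp: Q_simps(2) subsetD)
      fix z assume z: "z \<in> Q k"
      \<comment> \<open>The multiple of \<open>x\<close> with the same \<open>r\<close>-th entry as \<open>z\<close>.\<close>
      let ?y = "(z r * c) \<odot> x"
      have "?y \<in> K" using K xK by blast
      moreover have "z - ?y \<in> ?N"
        using z xQ Q_D(1)[OF z r] by (simp add: Q_simps smul_apply mult.assoc c)
      moreover have "z = ?y + (z - ?y)" by simp
      ultimately show "z \<in> {x + y |x y. x \<in> K \<and> y \<in> ?N}" by blast
    qed
    ultimately have "?N = Q k" using spec[OF sf[unfolded superfluous_def], of ?N] by (rule mp[rotated, OF conjI])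
    then have "eps k r \<in> ?N" using eps_in[of k r] by (rule ssubst)
    then have "eps k r r = 0" by simp
    then show False using r e_nonzero[OF vx[OF r]] by (simp add: eps_apply)
  qed
qed

text \<open>
  The differential from \<open>Q\<^bsub>k+1\<^esub>\<close> to \<open>Q\<^sub>k\<close>.  It is indexed by its target, as are \<open>B\<close>, \<open>T\<close> and \<open>T'\<close>, so that every index
  makes sense.
\<close>

abbreviation dl :: "nat \<Rightarrow> (nat \<Rightarrow> 'a) \<Rightarrow> nat \<Rightarrow> 'a" where "dl k \<equiv> delta e R (Suc k)"

abbreviation B :: "nat \<Rightarrow> nat \<Rightarrow> nat \<Rightarrow> 'a" where "B k \<equiv> bmat R (Suc k)"

text \<open>
  To be applied to the matrices of the differentials and to the correction terms \<open>C\<close>.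
\<close>

lemma mat_rows:
  assumes "mat_between e (verts R (Suc k)) (verts R k) M"
  shows "M r \<in> Q k" "r < rk R (Suc k) \<Longrightarrow> e (vx (Suc k) r) \<odot> M r = M r"
    "restr0 (Q (Suc k)) (\<lambda>x. row_mult (rk R (Suc k)) x M) \<in> hom (Qres e R (Suc k)) (Qres e R k)"
    "row_mult (rk R (Suc k)) (eps (Suc k) r) M = M r"
proof -
  note M = mat_between_entries[OF assms, folded rk_def]
  show 1: "M r \<in> Q k" for r
    unfolding Q_iff
  proof (intro conjI allI impI)
    fix j
    show "M r j * e (vx k j) = M r j" if j: "j < rk R k"
      by (subst (1 2) M) (simp add: j mult.assoc)
    show "M r j = 0" if j: "rk R k \<le> j"
      by (subst M) (use j in simp)
  qed
  show 2: "e (vx (Suc k) r) \<odot> M r = M r" if r: "r < rk R (Suc k)" for r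
  proof
    fix j
    show "(e (vx (Suc k) r) \<odot> M r) j = M r j"
      unfolding smul_apply by (subst (1 2) M) (simp add: r flip: mult.assoc)
  qed
  have rm: "row_mult (rk R (Suc k)) x M = (\<Sum>r<rk R (Suc k). x r \<odot> M r)" for x
    by (auto simp: row_mult_def fun_eq_iff sum_apply smul_apply)
  show "restr0 (Q (Suc k)) (\<lambda>x. row_mult (rk R (Suc k)) x M) \<in> hom (Qres e R (Suc k)) (Qres e R k)"
    by (auto simp: hom_def restr0_def Q_act Q_simps rm Q_sum 1 smul_apply smul_simps smul_sum sum.distrib)
  show "row_mult (rk R (Suc k)) (eps (Suc k) r) M = M r"
  proof (cases "r < rk R (Suc k)")
    case True
    have "row_mult (rk R (Suc k)) (eps (Suc k) r) M = (\<Sum>t<rk R (Suc k). if t = r then M r else 0)"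
      unfolding rm using 2[OF True] True by (intro sum.cong) (auto simp: eps_apply smul_simps)
    then show ?thesis using True by simp
  next
    case False
    have "M r j = 0" for j by (subst M) (use False in simp)
    then have "M r = 0" by (simp add: fun_eq_iff)
    moreover have "row_mult (rk R (Suc k)) (eps (Suc k) r) M = 0"
      unfolding rm using False by (intro sum.neutral) (auto simp: eps_apply smul_simps)
    ultimately show ?thesis by simp
  qed
qed

lemma B_between: "mat_between e (verts R (Suc k)) (verts R k) (B k)"
proof -
  have "\<forall>i\<ge>1. mat_between e (verts R i) (verts R (i - 1)) (bmat R i)"
    using resolution by (simp add: minimal_resolution_def)
  from this[rule_format, of "Suc k"] show ?thesis by simp
qed

lemma dl_hom: "dl k \<in> hom (Qres e R (Suc k)) (Qres e R k)"
  using mat_rows(3)[OF B_between] by (simp add: delta_def)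

lemma dl_eps: "dl k (eps (Suc k) r) = B k r"
  using mat_rows(4)[OF B_between] eps_in by (simp add: delta_def restr0_def)

lemma aug_hom: "aug R \<in> hom (Qres e R 0) S"
  and aug_surj: "aug R ` Q 0 = car S"
  and aug_exact: "dl 0 ` Q 1 = ker (Qres e R 0) (aug R)"
  and superfluous_aug: "superfluous (ker (Qres e R 0) (aug R)) (Qres e R 0)"
  using resolution by (simp_all add: minimal_resolution_def)

lemma dl_exact: "dl (Suc k) ` Q (Suc (Suc k)) = ker (Qres e R (Suc k)) (dl k)"
  and superfluous_dl: "superfluous (ker (Qres e R (Suc k)) (dl k)) (Qres e R (Suc k))"
proof -
  have "\<forall>i\<ge>1. delta e R (i + 1) ` car (Qres e R (i + 1)) = ker (Qres e R i) (delta e R i)"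
    "\<forall>i\<ge>1. superfluous (ker (Qres e R i) (delta e R i)) (Qres e R i)"
    using resolution by (simp_all add: minimal_resolution_def)
  from this[rule_format, of "Suc k"] show "dl (Suc k) ` Q (Suc (Suc k)) = ker (Qres e R (Suc k)) (dl k)"
    "superfluous (ker (Qres e R (Suc k)) (dl k)) (Qres e R (Suc k))" by simp_all
qed

lemma aug_kernel_rad: "x \<in> Q 0 \<Longrightarrow> aug R x = 0 \<Longrightarrow> x \<in> rad 0"
proof -
  have "ker (Qres e R 0) (aug R) \<subseteq> rad 0"
    by (rule superfluous_in_rad[OF superfluous_aug])
      (auto simp: ker_def Q_simps QhomD[OF aug_hom] S_simps)
  then show "x \<in> Q 0 \<Longrightarrow> aug R x = 0 \<Longrightarrow> x \<in> rad 0" by (auto simp: ker_def)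
qed

lemma dl_kernel_rad: "x \<in> Q (Suc k) \<Longrightarrow> dl k x = 0 \<Longrightarrow> x \<in> rad (Suc k)"
proof -
  have "ker (Qres e R (Suc k)) (dl k) \<subseteq> rad (Suc k)"
    by (rule superfluous_in_rad[OF superfluous_dl])
      (auto simp: ker_def Q_simps QhomD[OF dl_hom, unfolded Q_act])
  then show "x \<in> Q (Suc k) \<Longrightarrow> dl k x = 0 \<Longrightarrow> x \<in> rad (Suc k)" by (auto simp: ker_def)
qed

lemma aug_dl: "x \<in> Q (Suc 0) \<Longrightarrow> aug R (dl 0 x) = 0"
  using aug_exact by (auto simp: ker_def)

lemma dl_dl: "x \<in> Q (Suc (Suc k)) \<Longrightarrow> dl k (dl (Suc k) x) = 0"
  using dl_exact by (auto simp: ker_def)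

lemma dl_rad: assumes "x \<in> Q (Suc k)" shows "dl k x \<in> rad k"
proof (cases k)
  case 0
  then show ?thesis using aug_kernel_rad[of "dl 0 x"] aug_dl[of x] QhomD(1)[OF dl_hom, of x 0] assms by simp
next
  case (Suc l)
  then show ?thesis using dl_kernel_rad[of "dl k x" l] dl_dl[of x l] QhomD(1)[OF dl_hom, of x k] assms by simp
qed


section \<open>Twisted maps\<close>

abbreviation fQ :: "nat \<Rightarrow> 'a \<Rightarrow> (nat \<Rightarrow> 'a) \<Rightarrow> nat \<Rightarrow> 'a" where "fQ k \<equiv> f_Q e f (verts R k)"

lemma fQ_apply: "fQ k a x r = (if r < rk R k then f a (x r) * e (vx k r) else 0)"
  by (simp add: f_Q_def rk_def)

lemma fQ_in: "fQ k a x \<in> Q k"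
  by (simp add: Q_iff fQ_apply mult.assoc)

lemma fQ_simps:
  "fQ k a (x + y) = fQ k a x + fQ k a y" "fQ k (a + b) x = fQ k a x + fQ k b x" "fQ k a 0 = 0" "fQ k 0 x = 0"
  "fQ k a (- x) = - fQ k a x" "fQ k a (x - y) = fQ k a x - fQ k a y"
  using f_simps(1)[of a "x r" "- y r" for r]
  by (auto simp: fun_eq_iff fQ_apply f_simps distrib_right left_diff_distrib)

lemma fQ_sum: "fQ k a (\<Sum>i\<in>K. x i) = (\<Sum>i\<in>K. fQ k a (x i))"
  by (induction K rule: infinite_finite_induct)
    (simp_all only: sum.infinite sum.empty sum.insert fQ_simps not_False_eq_True)

lemma fQ_cocycle: "fQ k (a * b) x = a \<odot> fQ k b x + fQ k a (b \<odot> x) - f a b \<odot> x" if "x \<in> Q k"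
  using Q_D[OF that] by (auto simp: fun_eq_iff fQ_apply smul_apply cocycle algebra_simps)

text \<open>
  The canonical twisted map over \<open>u\<close>.  For \<open>u = \<delta>\<close> it is \<open>f\<close>-tilde on \<open>[x] \<otimes> B\<close>, followed by multiplication
  with the idempotents (lemma \<open>f_row_twist\<close>).
\<close>

definition twist :: "nat \<Rightarrow> nat \<Rightarrow> ((nat \<Rightarrow> 'a) \<Rightarrow> nat \<Rightarrow> 'a) \<Rightarrow> (nat \<Rightarrow> 'a) \<Rightarrow> nat \<Rightarrow> 'a" where
  "twist k j u = restr0 (Q k) (\<lambda>x. \<Sum>r<rk R k. fQ j (x r) (u (eps k r)))"

text \<open>
  The condition on the component \<open>u\<^sub>1\<close> of a morphism over \<open>A\<^sub>f\<close> whose other components are \<open>u\<close>.  Linearity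
  over the field is a consequence.
\<close>

definition twisted :: "nat \<Rightarrow> nat \<Rightarrow> ((nat \<Rightarrow> 'a) \<Rightarrow> nat \<Rightarrow> 'a) \<Rightarrow> ((nat \<Rightarrow> 'a) \<Rightarrow> nat \<Rightarrow> 'a) \<Rightarrow> bool" where
  "twisted k j u d \<longleftrightarrow> u \<in> hom (Qres e R k) (Qres e R j) \<and>
     (\<forall>x\<in>Q k. d x \<in> Q j) \<and> (\<forall>x\<in>Q k. \<forall>y\<in>Q k. d (x + y) = d x + d y) \<and>
     (\<forall>a. \<forall>x\<in>Q k. d (a \<odot> x) = a \<odot> d x - u (fQ k a x) + fQ j a (u x)) \<and> (\<forall>x. x \<notin> Q k \<longrightarrow> d x = 0)"

lemma twistedD:
  assumes "twisted k j u d"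
  shows "u \<in> hom (Qres e R k) (Qres e R j)"
    "x \<in> Q k \<Longrightarrow> d x \<in> Q j" "x \<in> Q k \<Longrightarrow> y \<in> Q k \<Longrightarrow> d (x + y) = d x + d y"
    "x \<in> Q k \<Longrightarrow> d (a \<odot> x) = a \<odot> d x - u (fQ k a x) + fQ j a (u x)" "x \<notin> Q k \<Longrightarrow> d x = 0"
  using assms by (auto simp: twisted_def)

lemma twisted_sum:
  assumes "twisted k j u d" "\<And>i. i \<in> K \<Longrightarrow> x i \<in> Q k"
  shows "d (\<Sum>i\<in>K. x i) = (\<Sum>i\<in>K. d (x i))"
  using additive_sum[OF Q_module, of k d K x] twistedD(3)[OF assms(1)] assms(2) by blast

lemma twisted_zero: "twisted k j u d \<Longrightarrow> d 0 = 0"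
  using twistedD(3)[of k j u d 0 0] Q_simps(1) by simp

lemma twisted_neg_one:
  assumes d: "twisted k j u d" and x: "x \<in> Q k"
  shows "d (((- 1) ^ m) \<odot> x) = ((- 1) ^ m) \<odot> d x"
proof (cases "even m")
  case False
  have "d x + d (- x) = 0" using twistedD(3)[OF d x Q_simps(11)[OF x]] twisted_zero[OF d] by simp
  then have "d (- x) = - d x" by (simp add: eq_neg_iff_add_eq_0 add.commute)
  then show ?thesis using False by (simp add: smul_simps)
qed (simp add: smul_simps)

text \<open>
  The three terms of the twisting rule are those of the cocycle identity, applied to each entry of \<open>x\<close>.
\<close>

lemma twist_twisted:
  assumes u: "u \<in> hom (Qres e R k) (Qres e R j)"
  shows "twisted k j u (twist k j u)"
  unfolding twisted_def
proof (intro conjI ballI allI impI)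
  note uD = QhomD[OF u, unfolded Q_act]
  have tw: "twist k j u x = (\<Sum>r<rk R k. fQ j (x r) (u (eps k r)))" if "x \<in> Q k" for x
    using that by (simp add: twist_def restr0_def)
  show "u \<in> hom (Qres e R k) (Qres e R j)" by (rule u)
  show "twist k j u x \<in> Q j" if "x \<in> Q k" for x using that by (simp add: tw Q_sum fQ_in)
  show "twist k j u (x + y) = twist k j u x + twist k j u y" if "x \<in> Q k" "y \<in> Q k" for x y
    using that by (simp add: tw Q_simps fQ_simps sum.distrib)
  show "twist k j u x = 0" if "x \<notin> Q k" for x using that by (simp add: twist_def restr0_def)
  fix a x assume x: "x \<in> Q k"
  have "twist k j u (a \<odot> x) = (\<Sum>r<rk R k. fQ j (a * x r) (u (eps k r)))"
    using x by (simp add: tw Q_simps smul_apply)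
  also have "\<dots> = (\<Sum>r<rk R k. a \<odot> fQ j (x r) (u (eps k r)) + fQ j a (x r \<odot> u (eps k r)) - f a (x r) \<odot> u (eps k r))"
    by (intro sum.cong refl fQ_cocycle uD(1) eps_in)
  also have "\<dots> = a \<odot> twist k j u x + fQ j a (u x) - (\<Sum>r<rk R k. f a (x r) \<odot> u (eps k r))"
    using hom_expand[OF u x] by (simp add: tw x smul_sum fQ_sum Q_act sum.distrib sum_subtractf)
  also have "(\<Sum>r<rk R k. f a (x r) \<odot> u (eps k r)) = u (fQ k a x)"
  proof -
    have "f a (x r) \<odot> u (eps k r) = fQ k a x r \<odot> u (eps k r)" if "r < rk R k" for r
    proof -
      have "f a (x r) \<odot> u (eps k r) = f a (x r) \<odot> u (e (vx k r) \<odot> eps k r)" using that by (simp add: e_eps)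
      also have "\<dots> = fQ k a x r \<odot> u (eps k r)" using that by (simp add: uD(3) eps_in fQ_apply smul_simps(3))
      finally show ?thesis .
    qed
    then show ?thesis using hom_expand[OF u fQ_in] by (simp add: Q_act)
  qed
  finally show "twist k j u (a \<odot> x) = a \<odot> twist k j u x - u (fQ k a x) + fQ j a (u x)"
    by (simp only: diff_add_eq)
qed

lemma twisted_diff:
  assumes "twisted k j u d" "twisted k j u d'"
  shows "(\<lambda>x. d x - d' x) \<in> hom (Qres e R k) (Qres e R j)"
  using twistedD(2-5)[OF assms(1)] twistedD(2-5)[OF assms(2)]
  unfolding hom_def by (intro CollectI conjI ballI allI impI) (simp_all add: Q_simps Q_act smul_simps)

lemma twisted_add_hom:
  assumes "twisted k j u d" "h \<in> hom (Qres e R k) (Qres e R j)"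
  shows "twisted k j u (\<lambda>x. d x + h x)"
  using twistedD[OF assms(1)] QhomD(1-4)[OF assms(2)]
  unfolding twisted_def by (intro conjI ballI allI impI) (simp_all add: Q_simps Q_act smul_simps)

text \<open>
  The second components of a composition of morphisms over \<open>A\<^sub>f\<close>.
\<close>

lemma twisted_comp:
  assumes d: "twisted k j u d" and d': "twisted j l v d'"
  shows "twisted k l (v \<circ> u) (\<lambda>x. v (d x) + d' (u x))"
proof -
  note u = QhomD(1-4)[OF twistedD(1)[OF d], unfolded Q_act]
  note v = QhomD[OF twistedD(1)[OF d'], unfolded Q_act]
  note z = QhomD(5)[OF twistedD(1)[OF d']] twisted_zero[OF d']
  show ?thesis unfolding twisted_def
  proof (intro conjI ballI allI impI)
    show "v \<circ> u \<in> hom (Qres e R k) (Qres e R l)"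
      using hom_comp twistedD(1) d d' Q_module by blast
    fix a x assume x: "x \<in> Q k"
    show "v (d (a \<odot> x)) + d' (u (a \<odot> x))
      = a \<odot> (v (d x) + d' (u x)) - (v \<circ> u) (fQ k a x) + fQ l a ((v \<circ> u) x)"
      using x by (simp add: twistedD(2,4)[OF d] twistedD(2,4)[OF d'] u v Q_simps fQ_in smul_simps)
  qed (use twistedD[OF d] twistedD[OF d'] u v(1,2) z in \<open>auto simp: Q_simps\<close>)
qed

lemma f_row_twist:
  assumes "x \<in> Q (Suc k)"
  shows "row_mult (rk R k) (f_row f (rk R (Suc k)) x (B k)) (diag e (verts R k)) = twist (Suc k) k (dl k) x"
  using assms
  by (auto simp: fun_eq_iff rk_def row_mult_diag twist_def restr0_def dl_eps sum_apply f_row_def f_Q_def sum_distrib_right)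

lemma aug_star: "x \<in> Q (Suc 0) \<Longrightarrow> aug R (twist (Suc 0) 0 (dl 0) x) = 0"
  using star f_row_twist[of x 0] by (auto simp: star_resolution_def)

text \<open>
  It suffices to show that \<open>f(a, y) e\<^sub>i\<close> kills the images in \<open>S\<close> of the generators \<open>\<epsilon>\<close> of \<open>Q\<^sub>0\<close> that belong to
  vertex \<open>i\<close>, since \<open>e\<^sub>i S\<close> is spanned by them.  The cocycle identity expresses
  \<open>f(a, y) \<epsilon>\<close> by \<open>f\<^sub>Q(y, \<epsilon>)\<close> and \<open>f\<^sub>Q(a y, \<epsilon>)\<close>, which lie in the radical, and \<open>f\<^sub>Q(a, y \<epsilon>)\<close>.  As \<open>y \<epsilon>\<close> is a
  boundary \<open>\<delta> w\<close>, the twisting rule for \<open>\<delta>\<close> and condition \<open>(\<ast>A)\<close> show that the last term vanishes in \<open>S\<close>.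
\<close>

lemma f_second_in_J:
  assumes i: "i < n" and y: "y \<in> J" "y * e i = y"
  shows "f a y * e i \<in> J"
proof -
  have ye: "f b y * e i = b * f y (e i) * e i - f (b * y) (e i) * e i + f b (y * e i) * e i" for b
    using arg_cong[OF cocycle[of b y "e i"], of "\<lambda>z. z * e i"]
    by (simp add: distrib_right left_diff_distrib mult.assoc ee[OF i])
  have 1: "aug R ((f a y * e i) \<odot> eps 0 r) = 0" if r: "r < rk R 0" "vx 0 r = i" for r
  proof -
    have fe: "fQ 0 b (eps 0 r) \<in> rad 0" if "b \<in> J" "b * e i = b" for b
      by (rule radI[OF fQ_in]) (use that r i in \<open>auto simp: fQ_apply eps_apply f_idem ee f_simps J_closed\<close>)
    have "y \<odot> eps 0 r \<in> rad 0" using y eps_in by (intro rad_closed(6))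
    then have "aug R (y \<odot> eps 0 r) = 0" using hom_S_rad[OF aug_hom] by blast
    moreover have "y \<odot> eps 0 r \<in> Q 0" by (simp add: Q_simps eps_in)
    ultimately obtain w where w: "w \<in> Q (Suc 0)" "y \<odot> eps 0 r = dl 0 w"
      using aug_exact by (auto simp: ker_def)
    note tw = twist_twisted[OF dl_hom[of 0]]
    have "fQ 0 a (dl 0 w) = twist 1 0 (dl 0) (a \<odot> w) - a \<odot> twist 1 0 (dl 0) w + dl 0 (fQ 1 a w)"
      using twistedD(4)[OF tw w(1), of a] by simp
    moreover have "aug R \<dots> = 0"
      using w(1) twistedD(2)[OF tw] aug_star aug_dl[of "fQ 1 a w"]
      by (simp add: QhomD[OF aug_hom] Q_simps fQ_in QhomD(1)[OF dl_hom] S_simps)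
    ultimately have 2: "aug R (fQ 0 a (y \<odot> eps 0 r)) = 0" using w by simp
    have "(f a y * e i) \<odot> eps 0 r = f a y \<odot> eps 0 r"
      using e_eps[OF r(1)] r by (simp add: smul_simps)
    also have "\<dots> = a \<odot> fQ 0 y (eps 0 r) + fQ 0 a (y \<odot> eps 0 r) - fQ 0 (a * y) (eps 0 r)"
      using fQ_cocycle[OF eps_in, of 0 a y r] by simp
    finally have "(f a y * e i) \<odot> eps 0 r = a \<odot> fQ 0 y (eps 0 r) - fQ 0 (a * y) (eps 0 r) + fQ 0 a (y \<odot> eps 0 r)"
      by simp
    moreover have "a \<odot> fQ 0 y (eps 0 r) - fQ 0 (a * y) (eps 0 r) \<in> rad 0"
      using fe[of y] fe[of "a * y"] y by (simp add: rad_closed J_closed mult.assoc)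
    ultimately show ?thesis using 2 hom_S_rad[OF aug_hom] rad_closed(1)
      by (simp add: QhomD(2)[OF aug_hom] fQ_in)
  qed
  have "act S (f a y * e i) s = 0" if s: "s \<in> car S" for s
  proof -
    obtain z where z: "z \<in> Q 0" "s = aug R z" using aug_surj s by blast
    have "(f a y * e i * z r) \<odot> eps 0 r \<in> ker (Qres e R 0) (aug R)" if r: "r < rk R 0" for r
    proof (cases "vx 0 r = i")
      case False
      have "e i * z r * e (vx 0 r) \<in> J" using off_diagonal_in_J i vx[OF r] False by blast
      then have "f a y * (e i * z r) \<in> J" using Q_D(1)[OF z(1) r] J_closed by (simp add: mult.assoc)
      then have "(f a y * e i * z r) \<odot> eps 0 r \<in> rad 0"
        by (intro rad_closed(6) eps_in) (simp add: mult.assoc)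
      then show ?thesis using hom_S_rad[OF aug_hom] rad_closed(1) by (simp add: ker_def)
    next
      case True
      obtain c where "e i * z r * e i - sc c (e i) \<in> J" using diagonal_scalar_mod_J[OF i] by blast
      then have "f a y * (e i * z r * e i - sc c (e i)) \<in> J" by (rule J_closed)
      then have "(f a y * (e i * z r * e i - sc c (e i))) \<odot> eps 0 r \<in> rad 0" by (intro rad_closed(6) eps_in)
      then have *: "aug R ((f a y * (e i * z r * e i - sc c (e i))) \<odot> eps 0 r) = 0" using hom_S_rad[OF aug_hom] by blast
      have "f a y * e i * z r = f a y * (e i * z r * e i - sc c (e i)) + sc c 1 * (f a y * e i)"
        using Q_D(1)[OF z(1) r] True by (simp add: right_diff_distrib mult.assoc sc_alg[OF fd])
      then have "aug R ((f a y * e i * z r) \<odot> eps 0 r) = act S (sc c 1) (aug R ((f a y * e i) \<odot> eps 0 r))"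
        using * by (simp add: smul_simps(2,3) QhomD[OF aug_hom] Q_simps eps_in)
      then show ?thesis using 1[OF r True] by (simp add: ker_def S_simps Q_simps eps_in)
    qed
    then have "aug R ((f a y * e i * z r) \<odot> eps 0 r) = 0" if "r < rk R 0" for r
      using that by (auto simp: ker_def)
    then have "(\<Sum>r<rk R 0. aug R ((f a y * e i * z r) \<odot> eps 0 r)) = 0" by simp
    moreover have "aug R ((f a y * e i) \<odot> z) = (\<Sum>r<rk R 0. aug R ((f a y * e i * z r) \<odot> eps 0 r))"
      using hom_expand[OF aug_hom, of "(f a y * e i) \<odot> z"] z by (simp add: QhomD[OF aug_hom] Q_simps eps_in smul_apply mult.assoc)
    ultimately show ?thesis using z by (simp add: QhomD[OF aug_hom])
  qed
  then show ?thesis by (simp add: J_def)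
qed

text \<open>
  Write \<open>z\<close> as a multiple of \<open>e\<^sub>i\<close> plus an element of \<open>J\<close>.  The latter is covered by the previous lemma, and
  for \<open>e\<^sub>i\<close> the cocycle identity gives \<open>f(y, e\<^sub>i) e\<^sub>i = y f(e\<^sub>i, e\<^sub>i)\<close>.
\<close>

lemma f_first_in_J:
  assumes ij: "i < n" "j < n" and y: "y \<in> J" "y * e i = y" and z: "e i * z = z" "z * e j = z"
  shows "f y z * e j \<in> J"
proof (cases "i = j")
  case False
  then have "z \<in> J" using off_diagonal_in_J[OF ij, of z] z by simp
  then show ?thesis using f_second_in_J ij z by blast
next
  case True
  obtain c where c: "e i * z * e i - sc c (e i) \<in> J" using diagonal_scalar_mod_J[OF ij(1)] by blast
  define z' where "z' = z - sc c (e i)"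
  have "z' \<in> J" using c z True by (simp add: z'_def)
  moreover have "z' * e i = z'" using z True by (simp add: z'_def left_diff_distrib sc_alg[OF fd] ee ij)
  ultimately have 1: "f y z' * e i \<in> J" using f_second_in_J ij by blast
  have "f y (sc c (e i)) = sc c (f y (e i))"
    using coc unfolding hochschild_2_cocycle_def Vector_Spaces.linear_def module_hom_def module_hom_axioms_def by blast
  then have "f y (sc c (e i)) * e i = sc c (y * f (e i) (e i))"
    using y ij by (simp add: sc_alg[OF fd] f_idem ee)
  then have 2: "f y (sc c (e i)) * e i \<in> J" using y by (simp add: J_closed)
  have "f y z = f y z' + f y (sc c (e i))" by (simp add: z'_def flip: f_simps)
  then show ?thesis using 1 2 True by (simp add: distrib_right J_closed)
qed

lemma fQ_rad: assumes "x \<in> rad k" shows "fQ k a x \<in> rad k"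
  by (rule radI[OF fQ_in]) (use assms Q_D(1) in \<open>auto simp: fQ_apply rad_def intro!: f_second_in_J vx\<close>)

text \<open>
  By additivity it is enough to consider \<open>y \<epsilon>\<close> with \<open>y \<in> J\<close> and a generator \<open>\<epsilon>\<close>; each of the three terms in
  the twisting rule for \<open>d(y \<epsilon>)\<close> lies in the radical.
\<close>

lemma twisted_rad:
  assumes d: "twisted k j u d" and x: "x \<in> rad k"
  shows "d x \<in> rad j"
proof -
  note u = twistedD(1)[OF d]
  have xQ: "x \<in> Q k" using x rad_closed by blast
  have "d (x r \<odot> eps k r) \<in> rad j" if r: "r < rk R k" for r
  proof -
    have xr: "x r \<in> J" "x r * e (vx k r) = x r" using x Q_D(1)[OF xQ r] by (auto simp: rad_def)
    have "fQ k (x r) (eps k r) \<in> rad k"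
      by (rule radI[OF fQ_in]) (use xr r in \<open>auto simp: fQ_apply eps_apply f_idem f_simps J_closed\<close>)
    then have 1: "u (fQ k (x r) (eps k r)) \<in> rad j" by (rule hom_rad[OF u])
    have ue: "e (vx k r) \<odot> u (eps k r) = u (eps k r)"
      using QhomD(3)[OF u eps_in, of "e (vx k r)" r] e_eps[OF r] by (simp add: Q_act)
    have uQ: "u (eps k r) \<in> Q j" by (rule QhomD(1)[OF u eps_in])
    have "f (x r) (u (eps k r) t) * e (vx j t) \<in> J" if t: "t < rk R j" for t
    proof (rule f_first_in_J[OF vx[OF r] vx[OF t] xr])
      show "e (vx k r) * u (eps k r) t = u (eps k r) t" using fun_cong[OF ue, of t] by (simp add: smul_apply)
      show "u (eps k r) t * e (vx j t) = u (eps k r) t" by (rule Q_D(1)[OF uQ t])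
    qed
    then have 2: "fQ j (x r) (u (eps k r)) \<in> rad j" by (intro radI[OF fQ_in]) (auto simp: fQ_apply)
    show ?thesis
      unfolding twistedD(4)[OF d eps_in]
      by (intro rad_closed 1 2 xr(1) twistedD(2)[OF d eps_in])
  qed
  then have "(\<Sum>r<rk R k. d (x r \<odot> eps k r)) \<in> rad j" by (intro rad_closed) auto
  then show ?thesis
    using twisted_sum[OF d, of "{..<rk R k}" "\<lambda>r. x r \<odot> eps k r"] Q_expand[OF xQ]
    by (simp add: Q_simps eps_in)
qed

section \<open>The maps T form a deformation of the resolution\<close>

abbreviation T :: "nat \<Rightarrow> (nat \<Rightarrow> 'a) \<Rightarrow> nat \<Rightarrow> 'a" where "T k \<equiv> Tdelta e f R C (Suc k)"

text \<open>
  The maps \<open>T\<close> with the sign in their definition removed; it is these that are twisted over \<open>\<delta>\<close>.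
\<close>

definition T' :: "nat \<Rightarrow> (nat \<Rightarrow> 'a) \<Rightarrow> nat \<Rightarrow> 'a" where "T' k = (\<lambda>x. ((- 1) ^ k) \<odot> T k x)"

lemma C_between: "mat_between e (verts R (Suc k)) (verts R k) (C (Suc k))"
  and C_one: "C (Suc 0) = 0"
  and C_rel: "mat_mult (rk R k)
          (mat_mult (rk R (Suc (Suc k))) (diag e (verts R (Suc (Suc k)))) (f_mat f (rk R (Suc k)) (B (Suc k)) (B k)))
          (diag e (verts R k))
        = mat_mult (rk R (Suc k)) (C (Suc (Suc k))) (B k) + mat_mult (rk R (Suc k)) (B (Suc k)) (C (Suc k))"
proof -
  have "\<forall>i\<ge>1. mat_between e (verts R i) (verts R (i - 1)) (C i)"
    using adm by (simp add: admissible_C_def)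
  from this[rule_format, of "Suc k"] show "mat_between e (verts R (Suc k)) (verts R k) (C (Suc k))" by simp
  show "C (Suc 0) = 0" using adm by (simp add: admissible_C_def)
  have "\<forall>i\<ge>2. mat_mult (rk R (i - 2))
          (mat_mult (rk R i) (diag e (verts R i)) (f_mat f (rk R (i - 1)) (bmat R i) (bmat R (i - 1))))
          (diag e (verts R (i - 2)))
        = mat_mult (rk R (i - 1)) (C i) (bmat R (i - 1)) + mat_mult (rk R (i - 1)) (bmat R i) (C (i - 1))"
    using adm by (simp add: admissible_C_def)
  from this[rule_format, of "Suc (Suc k)"] show "mat_mult (rk R k)
          (mat_mult (rk R (Suc (Suc k))) (diag e (verts R (Suc (Suc k)))) (f_mat f (rk R (Suc k)) (B (Suc k)) (B k)))
          (diag e (verts R k))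
        = mat_mult (rk R (Suc k)) (C (Suc (Suc k))) (B k) + mat_mult (rk R (Suc k)) (B (Suc k)) (C (Suc k))" by simp
qed

text \<open>
  The homomorphism with matrix \<open>C\<close>, by which \<open>T'\<close> differs from the canonical twisted map.
\<close>

definition C_map :: "nat \<Rightarrow> (nat \<Rightarrow> 'a) \<Rightarrow> nat \<Rightarrow> 'a" where
  "C_map k = restr0 (Q (Suc k)) (\<lambda>x. row_mult (rk R (Suc k)) x (C (Suc k)))"

lemma C_map_hom: "C_map k \<in> hom (Qres e R (Suc k)) (Qres e R k)"
  unfolding C_map_def by (rule mat_rows(3)[OF C_between])

lemma C_map_eps: "C_map k (eps (Suc k) r) = C (Suc k) r"
  using mat_rows(4)[OF C_between] eps_in by (simp add: C_map_def restr0_def)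

lemma T'_eq: "T' k = (\<lambda>x. twist (Suc k) k (dl k) x - C_map k x)"
proof
  fix x
  show "T' k x = twist (Suc k) k (dl k) x - C_map k x"
  proof (cases "x \<in> Q (Suc k)")
    case True
    have "(- 1) ^ k * ((- 1) ^ (Suc k + 1) * z) = z" for z :: 'a
      by (simp flip: mult.assoc power_add)
    then show ?thesis using True f_row_twist[OF True]
      by (auto simp: T'_def Tdelta_def restr0_def C_map_def fun_eq_iff smul_apply)
  next
    case False
    then show ?thesis by (simp add: T'_def Tdelta_def restr0_def C_map_def twist_def smul_simps flip: zero_fun_def)
  qed
qed

lemma T'_twisted: "twisted (Suc k) k (dl k) (T' k)"
proof -
  have "(\<lambda>x. - C_map k x) \<in> hom (Qres e R (Suc k)) (Qres e R k)"
    using hom_diff[OF zero_hom C_map_hom] Q_module by simp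
  from twisted_add_hom[OF twist_twisted[OF dl_hom] this] show ?thesis by (simp add: T'_eq)
qed

lemma T_T': "T k x = ((- 1) ^ k) \<odot> T' k x"
proof -
  have "(- 1) ^ k * (- 1) ^ k = (1 :: 'a)" by (cases "even k") simp_all
  then show ?thesis by (simp add: T'_def smul_simps(8) flip: smul_simps(3))
qed

text \<open>
  Condition \<open>(\<ast>A)\<close>, as \<open>C\<^sub>1 = 0\<close>.
\<close>

lemma aug_T': assumes "x \<in> Q (Suc 0)" shows "aug R (T' 0 x) = 0"
proof -
  have "C_map 0 x = 0" by (auto simp: C_map_def restr0_def row_mult_def C_one)
  then show ?thesis using aug_star assms by (simp add: T'_eq)
qed

text \<open>
  The left-hand side is twisted over \<open>\<delta> \<delta> = 0\<close>, hence a homomorphism, and it suffices to evaluate it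
  on generators.  There it becomes the defining equation of the matrices \<open>C\<close>.
\<close>

lemma dl_T': assumes x: "x \<in> Q (Suc (Suc k))" shows "dl k (T' (Suc k) x) + T' k (dl (Suc k) x) = 0"
proof -
  let ?K = "Suc (Suc k)"
  define d where "d = (\<lambda>x. dl k (T' (Suc k) x) + T' k (dl (Suc k) x))"
  have tw: "twisted ?K k (dl k \<circ> dl (Suc k)) d"
    unfolding d_def by (rule twisted_comp[OF T'_twisted T'_twisted])
  have dd: "(dl k \<circ> dl (Suc k)) y = 0" if "y \<in> Q ?K" for y using dl_dl[OF that] by simp
  have z: "d (eps ?K r) = 0" if r: "r < rk R ?K" for r
  proof -
    let ?e = "e (vx ?K r)"
    have e1: "d (eps ?K r) = ?e \<odot> d (eps ?K r)"
      using twistedD(4)[OF tw eps_in, of ?e r] unfolding e_eps[OF r] dd[OF fQ_in] dd[OF eps_in]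
      by (simp add: fQ_simps)
    have tw1: "twist ?K (Suc k) (dl (Suc k)) (eps ?K r) = fQ (Suc k) ?e (B (Suc k) r)"
    proof -
      have "twist ?K (Suc k) (dl (Suc k)) (eps ?K r)
          = (\<Sum>t<rk R ?K. fQ (Suc k) (eps ?K r t) (B (Suc k) t))"
        by (simp add: twist_def restr0_def eps_in dl_eps)
      also have "\<dots> = (\<Sum>t<rk R ?K. if t = r then fQ (Suc k) ?e (B (Suc k) r) else 0)"
        using r by (intro sum.cong) (auto simp: eps_apply fQ_simps)
      finally show ?thesis using r by simp
    qed
    have 1: "dl k (T' (Suc k) (eps ?K r)) = dl k (fQ (Suc k) ?e (B (Suc k) r)) - dl k (C ?K r)"
      by (simp add: T'_eq tw1 C_map_eps QhomD(7)[OF dl_hom] fQ_in mat_rows(1)[OF C_between])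
    have BQ: "B (Suc k) r \<in> Q (Suc k)" by (rule mat_rows(1)[OF B_between])
    have 2: "T' k (dl (Suc k) (eps ?K r)) = twist (Suc k) k (dl k) (B (Suc k) r) - C_map k (B (Suc k) r)"
      by (simp add: T'_eq dl_eps)
    have eB: "?e \<odot> B (Suc k) r = B (Suc k) r" by (rule mat_rows(2)[OF B_between r])
    have 3: "twist (Suc k) k (dl k) (B (Suc k) r)
        = ?e \<odot> twist (Suc k) k (dl k) (B (Suc k) r) - dl k (fQ (Suc k) ?e (B (Suc k) r))"
      using twistedD(4)[OF twist_twisted[OF dl_hom] BQ, of ?e] dd[OF eps_in, of r]
      by (simp add: eB dl_eps fQ_simps)
    have 4: "?e \<odot> twist (Suc k) k (dl k) (B (Suc k) r) = dl k (C ?K r) + C_map k (B (Suc k) r)"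
    proof -
      have "mat_mult (rk R ?K) (diag e (verts R ?K)) M r = ?e \<odot> M r" for M
      proof
        fix j
        have "mat_mult (rk R ?K) (diag e (verts R ?K)) M r j = (\<Sum>t<rk R ?K. if t = r then ?e * M r j else 0)"
          unfolding mat_mult_def row_mult_def using r by (intro sum.cong) (auto simp: eps_apply)
        then show "mat_mult (rk R ?K) (diag e (verts R ?K)) M r j = (?e \<odot> M r) j" using r by (simp add: smul_apply)
      qed
      moreover have "row_mult (rk R k) (?e \<odot> y) (diag e (verts R k)) = ?e \<odot> row_mult (rk R k) y (diag e (verts R k))" for y
        by (auto simp: row_mult_def smul_apply fun_eq_iff sum_distrib_left mult.assoc)
      ultimately have "?e \<odot> row_mult (rk R k) (f_row f (rk R (Suc k)) (B (Suc k) r) (B k)) (diag e (verts R k))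
          = row_mult (rk R (Suc k)) (C ?K r) (B k) + row_mult (rk R (Suc k)) (B (Suc k) r) (C (Suc k))"
        using fun_cong[OF C_rel[of k], of r] by (simp add: mat_mult_def[of "rk R k"] f_mat_def mat_mult_def[of "rk R (Suc k)"])
      then show ?thesis using f_row_twist[OF BQ] BQ mat_rows(1)[OF C_between]
        by (simp add: delta_def restr0_def C_map_def)
    qed
    show ?thesis using 1 2 3 4 by (simp add: d_def)
  qed
  have "d x = (\<Sum>r<rk R ?K. d (x r \<odot> eps ?K r))"
    using twisted_sum[OF tw, of "{..<rk R ?K}" "\<lambda>r. x r \<odot> eps ?K r"] Q_expand[OF x]
    by (simp add: Q_simps eps_in)
  also have "\<dots> = 0"
    by (rule sum.neutral) (simp add: twistedD(4)[OF tw eps_in] z dl_dl fQ_in eps_in fQ_simps smul_simps)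
  finally show ?thesis by (simp add: d_def)
qed

text \<open>
  The two terms by which \<open>d\<close> fails to be linear have values in the radical.
\<close>

lemma twisted_S_hom:
  assumes d: "twisted k j u d" and u: "\<And>x. x \<in> Q k \<Longrightarrow> u x \<in> rad j" and g: "g \<in> hom (Qres e R j) S"
  shows "g \<circ> d \<in> hom (Qres e R k) S"
proof -
  note gD = QhomD[OF g]
  have uQ: "u x \<in> Q j" if "x \<in> Q k" for x using u[OF that] rad_closed by blast
  have "g (d (a \<odot> x)) = act S a (g (d x))" if x: "x \<in> Q k" for a x
    using hom_S_rad[OF g u[OF fQ_in], of a x] hom_S_rad[OF g fQ_rad[OF u[OF x]], of a]
    by (simp add: twistedD(4)[OF d x] gD twistedD(2)[OF d x] Q_simps uQ fQ_in)
  then show ?thesis using twistedD(2,3,5)[OF d] gD by (auto simp: hom_def Q_act)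
qed

lemma T_S_hom: assumes g: "g \<in> hom (Qres e R k) S" shows "g \<circ> T k \<in> hom (Qres e R (Suc k)) S"
proof -
  have 1: "g \<circ> T' k \<in> hom (Qres e R (Suc k)) S"
    by (rule twisted_S_hom[OF T'_twisted dl_rad g])
  have "(g \<circ> T k) x = act S ((- 1) ^ k) ((g \<circ> T' k) x)" for x
  proof (cases "x \<in> Q (Suc k)")
    case True
    then show ?thesis using QhomD(3)[OF g] twistedD(2)[OF T'_twisted] by (simp add: T_T')
  next
    case False
    then show ?thesis using QhomD(5)[OF g] twistedD(5)[OF T'_twisted] by (simp add: T_T' smul_simps S_simps)
  qed
  moreover have "(\<lambda>x. act S ((- 1) ^ k) ((g \<circ> T' k) x)) \<in> hom (Qres e R (Suc k)) S"
    unfolding hom_def using QhomD(1-4)[OF 1]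
    by (cases "even k") (auto simp: S_simps Q_act)
  ultimately show ?thesis by (metis (no_types, lifting) ext)
qed

lemma T_comp_Ext: "g \<in> Ext_A e S R s \<Longrightarrow> T_comp e f R C g s d \<in> Ext_A e S R (s + d)"
  by (induction d) (auto simp: Ext_A_def intro: T_S_hom)


section \<open>Liftings over A\<close>

text \<open>
  Projectivity of \<open>Q\<^sub>k\<close>: choose preimages of the values at the generators, and multiply them by the idempotents.
\<close>

lemma lift_along_image:
  assumes pi: "\<pi> \<in> hom (Qres e R l) N" and N: "left_module N" and phi: "\<phi> \<in> hom (Qres e R k) N"
    and im: "\<And>x. x \<in> Q k \<Longrightarrow> \<phi> x \<in> \<pi> ` Q l"
  shows "\<exists>h\<in>hom (Qres e R k) (Qres e R l). \<forall>x\<in>Q k. \<pi> (h x) = \<phi> x"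
proof -
  have "\<forall>r. \<exists>y\<in>Q l. \<pi> y = \<phi> (eps k r)" using im[OF eps_in] by (metis imageE)
  then obtain y where y: "\<And>r. y r \<in> Q l" "\<And>r. \<pi> (y r) = \<phi> (eps k r)" by metis
  obtain h where h: "h \<in> hom (Qres e R k) (Qres e R l)"
    "\<And>r. r < rk R k \<Longrightarrow> h (eps k r) = e (vx k r) \<odot> y r"
    using hom_on_generators[of "Qres e R l" k "\<lambda>r. e (vx k r) \<odot> y r"] Q_module y(1)
    by (auto simp: Q_act Q_simps simp flip: smul_simps(3))
  have "\<pi> (h x) = \<phi> x" if x: "x \<in> Q k" for x
  proof -
    have *: "\<pi> (h (eps k r)) = \<phi> (eps k r)" if r: "r < rk R k" for r
      using QhomD(3)[OF phi eps_in, of "e (vx k r)" r] h(2)[OF r] QhomD(3)[OF pi y(1), of "e (vx k r)" r] y(2)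
      by (simp add: e_eps[OF r])
    have "\<pi> \<circ> h \<in> hom (Qres e R k) N" by (rule hom_comp[OF h(1) pi Q_module])
    from hom_expand[OF this x] hom_expand[OF phi x] * show ?thesis by simp
  qed
  then show ?thesis using h(1) by blast
qed

text \<open>
  The augmented complex, treated uniformly in all degrees including 0.
\<close>

definition cycle :: "nat \<Rightarrow> (nat \<Rightarrow> 'a) \<Rightarrow> bool" where
  "cycle j x \<longleftrightarrow> (case j of 0 \<Rightarrow> aug R x = 0 | Suc i \<Rightarrow> dl i x = 0)"

lemma cycle_simps: "cycle 0 x \<longleftrightarrow> aug R x = 0" "cycle (Suc i) x \<longleftrightarrow> dl i x = 0"
  by (simp_all add: cycle_def)

lemma cycle_boundary: "x \<in> Q (Suc j) \<Longrightarrow> cycle j (dl j x)"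
  by (cases j) (auto simp: cycle_simps aug_dl dl_dl)

lemma cycle_image: "x \<in> Q j \<Longrightarrow> cycle j x \<Longrightarrow> x \<in> dl j ` Q (Suc j)"
  using aug_exact dl_exact by (cases j) (auto simp: cycle_simps ker_def)

lemma cycle_diff: "x \<in> Q j \<Longrightarrow> y \<in> Q j \<Longrightarrow> cycle j x \<Longrightarrow> cycle j y \<Longrightarrow> cycle j (x - y)"
  by (cases j) (simp_all add: cycle_simps QhomD(7)[OF aug_hom] QhomD(7)[OF dl_hom])

lemma lift_cycle:
  assumes "\<phi> \<in> hom (Qres e R k) (Qres e R j)" "\<And>x. x \<in> Q k \<Longrightarrow> cycle j (\<phi> x)"
  shows "\<exists>h\<in>hom (Qres e R k) (Qres e R (Suc j)). \<forall>x\<in>Q k. dl j (h x) = \<phi> x"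
  using lift_along_image[OF dl_hom Q_module assms(1)] cycle_image assms(2) QhomD(1)[OF assms(1)] by blast

text \<open>
  \<open>lifting_A\<close>, with its equations restricted to carriers and the degrees shifted so that no subtraction
  occurs; see \<open>lifting_A_iff\<close>.
\<close>

definition A_lift :: "nat \<Rightarrow> ((nat \<Rightarrow> 'a) \<Rightarrow> 's) \<Rightarrow> (nat \<Rightarrow> (nat \<Rightarrow> 'a) \<Rightarrow> nat \<Rightarrow> 'a) \<Rightarrow> bool" where
  "A_lift l g \<gamma> \<longleftrightarrow> (\<forall>j. \<gamma> j \<in> hom (Qres e R (l + j)) (Qres e R j)) \<and>
     (\<forall>x\<in>Q l. aug R (\<gamma> 0 x) = g x) \<and>
     (\<forall>j. \<forall>x\<in>Q (Suc (l + j)). dl j (\<gamma> (Suc j) x) = \<gamma> j (dl (l + j) x))"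

lemma A_liftD:
  assumes "A_lift l g \<gamma>"
  shows "\<gamma> j \<in> hom (Qres e R (l + j)) (Qres e R j)" "x \<in> Q l \<Longrightarrow> aug R (\<gamma> 0 x) = g x"
    "x \<in> Q (Suc (l + j)) \<Longrightarrow> dl j (\<gamma> (Suc j) x) = \<gamma> j (dl (l + j) x)"
  using assms by (auto simp: A_lift_def)

lemma A_lift_comp:
  assumes "A_lift l g \<gamma>" shows "dl j \<circ> \<gamma> (Suc j) = \<gamma> j \<circ> dl (l + j)"
proof
  fix x
  show "(dl j \<circ> \<gamma> (Suc j)) x = (\<gamma> j \<circ> dl (l + j)) x"
  proof (cases "x \<in> Q (Suc (l + j))")
    case False
    then show ?thesis
      using QhomD(4)[OF A_liftD(1)[OF assms], of x "Suc j"] QhomD(4)[OF dl_hom]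
        QhomD(5)[OF dl_hom] QhomD(5)[OF A_liftD(1)[OF assms]] by simp
  qed (simp add: A_liftD(3)[OF assms])
qed

lemma lifting_A_iff:
  assumes g: "g \<in> hom (Qres e R l) S"
  shows "lifting_A e R l g \<gamma> \<longleftrightarrow> A_lift l g \<gamma>"
proof
  assume L: "lifting_A e R l g \<gamma>"
  have "delta e R (Suc j) \<circ> \<gamma> (Suc j) = \<gamma> j \<circ> delta e R (Suc (l + j))" for j
    using L[unfolded lifting_A_def, THEN conjunct2, THEN conjunct2, rule_format, of "Suc j"] by simp
  then show "A_lift l g \<gamma>"
    using L by (simp add: lifting_A_def A_lift_def fun_eq_iff)
next
  assume L: "A_lift l g \<gamma>"
  have "aug R \<circ> \<gamma> 0 = g"
  proof
    fix x
    show "(aug R \<circ> \<gamma> 0) x = g x"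
      using A_liftD(2)[OF L, of x] QhomD(4)[OF A_liftD(1)[OF L], of x 0] QhomD(4)[OF g, of x] QhomD(5)[OF aug_hom]
      by (cases "x \<in> Q l") simp_all
  qed
  moreover have "delta e R j \<circ> \<gamma> j = \<gamma> (j - 1) \<circ> delta e R (l + j)" if "j \<ge> 1" for j
    using A_lift_comp[OF L, of "j - 1"] that by simp
  ultimately show "lifting_A e R l g \<gamma>" using A_liftD(1)[OF L] by (simp add: lifting_A_def)
qed

lemma A_lift_exists:
  assumes g: "g \<in> hom (Qres e R l) S" shows "\<exists>\<gamma>. A_lift l g \<gamma>"
proof -
  let ?P = "\<lambda>j u. u \<in> hom (Qres e R (l + j)) (Qres e R j) \<and> (j = 0 \<longrightarrow> (\<forall>x\<in>Q l. aug R (u x) = g x)) \<and>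
    (\<forall>x\<in>Q (Suc (l + j)). cycle j (u (dl (l + j) x)))"
  let ?R = "\<lambda>j u u'. \<forall>x\<in>Q (Suc (l + j)). dl j (u' x) = u (dl (l + j) x)"
  have "\<exists>\<gamma>. \<forall>j. ?P j (\<gamma> j) \<and> ?R j (\<gamma> j) (\<gamma> (Suc j))"
  proof (rule dependent_nat_choice)
    have "\<exists>u\<in>hom (Qres e R l) (Qres e R 0). \<forall>x\<in>Q l. aug R (u x) = g x"
      by (rule lift_along_image[OF aug_hom S_module g]) (simp add: aug_surj QhomD(1)[OF g])
    then obtain u where u: "u \<in> hom (Qres e R l) (Qres e R 0)" "\<And>x. x \<in> Q l \<Longrightarrow> aug R (u x) = g x"
      by blast
    have "cycle 0 (u (dl l x))" if "x \<in> Q (Suc l)" for x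
      using u(2)[of "dl l x"] QhomD(1)[OF dl_hom that] hom_S_rad[OF g dl_rad[OF that]] by (simp add: cycle_simps)
    then have "?P 0 u" unfolding add_0_right using u by blast
    then show "\<exists>u. ?P 0 u" by blast
  next
    fix u j assume P: "?P j u"
    then have uh: "u \<in> hom (Qres e R (l + j)) (Qres e R j)" and uc: "\<forall>x\<in>Q (Suc (l + j)). cycle j (u (dl (l + j) x))"
      by blast+
    have "u \<circ> dl (l + j) \<in> hom (Qres e R (Suc (l + j))) (Qres e R j)"
      by (rule hom_comp[OF dl_hom uh Q_module])
    from lift_cycle[OF this] uc obtain u' where
      u': "u' \<in> hom (Qres e R (Suc (l + j))) (Qres e R (Suc j))"
        "\<forall>x\<in>Q (Suc (l + j)). dl j (u' x) = u (dl (l + j) x)" unfolding o_apply by blast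
    have "cycle (Suc j) (u' (dl (Suc (l + j)) x))" if "x \<in> Q (Suc (Suc (l + j)))" for x
    proof -
      have "u 0 = 0" using QhomD(5)[OF uh] .
      moreover have "dl j (u' (dl (Suc (l + j)) x)) = u (dl (l + j) (dl (Suc (l + j)) x))"
        using u'(2) QhomD(1)[OF dl_hom that] by blast
      ultimately show ?thesis using dl_dl[OF that] by (simp add: cycle_simps)
    qed
    then have "?P (Suc j) u'" unfolding add_Suc_right using u'(1) by blast
    then show "\<exists>u'. ?P (Suc j) u' \<and> ?R j u u'" using u'(2) by blast
  qed
  then obtain \<gamma> where *: "\<forall>j. ?P j (\<gamma> j) \<and> ?R j (\<gamma> j) (\<gamma> (Suc j))" ..
  have "A_lift l g \<gamma>" unfolding A_lift_def
    by (intro conjI allI) (use * in blast)+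
  then show ?thesis by blast
qed

text \<open>
  The usual homotopy argument, for chain maps between shifted parts of the resolution.  It is needed for
  a lifting of zero (\<open>b = 0\<close>), and for maps of the whole resolution into a part that starts in
  degree \<open>b > 0\<close>.  A map of the form \<open>\<delta> s + s \<delta>\<close> has values in the radical, and only this is kept of the
  homotopy \<open>s\<close>.
\<close>

lemma chain_map_in_rad:
  assumes hom: "\<And>i. \<beta> i \<in> hom (Qres e R (c + i)) (Qres e R (b + i))"
    and start: "\<And>x. x \<in> Q c \<Longrightarrow> cycle b (\<beta> 0 x)"
    and chain: "\<And>i x. x \<in> Q (Suc (c + i)) \<Longrightarrow> dl (b + i) (\<beta> (Suc i) x) = \<beta> i (dl (c + i) x)"
    and x: "x \<in> Q (c + i)"
  shows "\<beta> i x \<in> rad (b + i)"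
proof -
  have "\<exists>s\<in>hom (Qres e R (c + i)) (Qres e R (Suc (b + i))).
      (\<forall>x\<in>Q (Suc (c + i)). dl (b + i) (s (dl (c + i) x)) = \<beta> i (dl (c + i) x)) \<and>
      (\<forall>x\<in>Q (c + i). \<beta> i x \<in> rad (b + i))"
  proof (induction i)
    case 0
    have "\<exists>h\<in>hom (Qres e R c) (Qres e R (Suc b)). \<forall>x\<in>Q c. dl b (h x) = \<beta> 0 x"
      by (rule lift_cycle) (use hom[of 0] start in auto)
    then obtain s where s: "s \<in> hom (Qres e R c) (Qres e R (Suc b))" "\<And>x. x \<in> Q c \<Longrightarrow> \<beta> 0 x = dl b (s x)"
      by metis
    then show ?case
      by (intro bexI[of _ s]) (simp_all add: s(2) QhomD(1)[OF dl_hom] dl_rad QhomD(1)[OF s(1)])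
  next
    case (Suc i)
    obtain s where s: "s \<in> hom (Qres e R (c + i)) (Qres e R (Suc (b + i)))"
      "\<And>x. x \<in> Q (Suc (c + i)) \<Longrightarrow> dl (b + i) (s (dl (c + i) x)) = \<beta> i (dl (c + i) x)"
      using Suc by blast
    note hS = hom[of "Suc i", simplified]
    have sd: "s \<circ> dl (c + i) \<in> hom (Qres e R (Suc (c + i))) (Qres e R (Suc (b + i)))"
      by (rule hom_comp[OF dl_hom s(1) Q_module])
    have "\<exists>h\<in>hom (Qres e R (Suc (c + i))) (Qres e R (Suc (Suc (b + i)))).
       \<forall>x\<in>Q (Suc (c + i)). dl (Suc (b + i)) (h x) = \<beta> (Suc i) x - (s \<circ> dl (c + i)) x"
    proof (rule lift_cycle)
      show "(\<lambda>x. \<beta> (Suc i) x - (s \<circ> dl (c + i)) x) \<in> hom (Qres e R (Suc (c + i))) (Qres e R (Suc (b + i)))"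
        by (rule hom_diff[OF hS sd Q_module Q_module])
      show "cycle (Suc (b + i)) (\<beta> (Suc i) x - (s \<circ> dl (c + i)) x)" if "x \<in> Q (Suc (c + i))" for x
        using chain[OF that] s(2)[OF that] QhomD(1)[OF hS that] QhomD(1)[OF sd that]
        by (simp add: cycle_simps QhomD(7)[OF dl_hom])
    qed
    then obtain h where h: "h \<in> hom (Qres e R (Suc (c + i))) (Qres e R (Suc (Suc (b + i))))"
      "\<And>x. x \<in> Q (Suc (c + i)) \<Longrightarrow> dl (Suc (b + i)) (h x) = \<beta> (Suc i) x - s (dl (c + i) x)" by auto
    have b: "\<beta> (Suc i) x = s (dl (c + i) x) + dl (Suc (b + i)) (h x)" if "x \<in> Q (Suc (c + i))" for x
      using h(2)[OF that] by simp
    have "\<beta> (Suc i) x \<in> rad (Suc (b + i))" if x: "x \<in> Q (Suc (c + i))" for x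
      unfolding b[OF x] by (intro rad_closed(3) hom_rad[OF s(1)] dl_rad x QhomD(1)[OF h(1)])
    moreover have "dl (Suc (b + i)) (h (dl (Suc (c + i)) x)) = \<beta> (Suc i) (dl (Suc (c + i)) x)"
      if "x \<in> Q (Suc (Suc (c + i)))" for x
      using b[of "dl (Suc (c + i)) x"] QhomD(1)[OF dl_hom that] dl_dl[OF that] QhomD(5)[OF s(1)] by simp
    ultimately show ?case using h(1) by (intro bexI[of _ h]) simp_all
  qed
  then show ?thesis using x by blast
qed

text \<open>
  The difference of two liftings of \<open>g\<close> lifts zero, so it has values in the radical, which \<open>h\<close> kills.
\<close>

lemma yoneda_A_eq:
  assumes g: "g \<in> hom (Qres e R l) S" and h: "h \<in> hom (Qres e R m) S" and L: "A_lift l g \<gamma>"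
  shows "yoneda_A e R m h l g = h \<circ> \<gamma> m"
  unfolding yoneda_A_def lifting_A_iff[OF g]
proof (rule the_equality)
  show "\<exists>\<gamma>'. A_lift l g \<gamma>' \<and> h \<circ> \<gamma> m = h \<circ> \<gamma>' m" using L by blast
next
  fix w assume "\<exists>\<gamma>'. A_lift l g \<gamma>' \<and> w = h \<circ> \<gamma>' m"
  then obtain \<gamma>' where L': "A_lift l g \<gamma>'" and w: "w = h \<circ> \<gamma>' m" by blast
  note a = A_liftD(1)[OF L] A_liftD(1)[OF L']
  show "w = h \<circ> \<gamma> m" unfolding w
  proof
    fix x
    show "(h \<circ> \<gamma>' m) x = (h \<circ> \<gamma> m) x"
    proof (cases "x \<in> Q (l + m)")
      case True
      have "(\<lambda>x. \<gamma> m x - \<gamma>' m x) x \<in> rad (0 + m)"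
      proof (rule chain_map_in_rad[where c = l and \<beta> = "\<lambda>i x. \<gamma> i x - \<gamma>' i x"])
        show "(\<lambda>x. \<gamma> i x - \<gamma>' i x) \<in> hom (Qres e R (l + i)) (Qres e R (0 + i))" for i
          using hom_diff[OF a(1) a(2) Q_module Q_module] by simp
        show "cycle 0 (\<gamma> 0 x - \<gamma>' 0 x)" if "x \<in> Q l" for x
          using that QhomD(1)[OF a(1), of x 0] QhomD(1)[OF a(2), of x 0] A_liftD(2)[OF L] A_liftD(2)[OF L']
          by (simp add: cycle_simps QhomD(7)[OF aug_hom])
        show "dl (0 + i) (\<gamma> (Suc i) x - \<gamma>' (Suc i) x) = \<gamma> i (dl (l + i) x) - \<gamma>' i (dl (l + i) x)"
          if "x \<in> Q (Suc (l + i))" for i x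
          using that QhomD(1)[OF a(1), of x "Suc i"] QhomD(1)[OF a(2), of x "Suc i"] A_liftD(3)[OF L] A_liftD(3)[OF L']
          by (simp add: QhomD(7)[OF dl_hom])
        show "x \<in> Q (l + m)" by (rule True)
      qed
      then have "h (\<gamma> m x - \<gamma>' m x) = 0" using hom_S_rad[OF h] by simp
      then show ?thesis using QhomD(7)[OF h QhomD(1)[OF a(1) True] QhomD(1)[OF a(2) True]] by simp
    next
      case False
      then show ?thesis using QhomD(4)[OF a(1)] QhomD(4)[OF a(2)] by simp
    qed
  qed
qed

section \<open>The obstruction to deforming a lifting\<close>

text \<open>
  The maps \<open>d\<^sub>j\<close> are chosen one after the other.  Given \<open>d\<^sub>j\<close>, take the canonical twisted map \<open>F\<close> over
  \<open>\<gamma>\<^bsub>j+1\<^esub>\<close>.  What the equation lacks with \<open>F\<close> in the place of \<open>d\<^bsub>j+1\<^esub>\<close> is a difference of maps that are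
  twisted over the same homomorphism, so it is \<open>A\<close>-linear; and it takes values in cycles, because the
  equation holds in degree \<open>j\<close> and \<open>\<delta> T' + T' \<delta> = 0\<close>.  It therefore lifts along \<open>\<delta>\<close>, and the lift is added
  to \<open>F\<close>.  In degree 0 the cycle condition says that the obstruction represents \<open>g T\<close> up to sign: of the four terms,
  \<open>aug(d\<^sub>0 \<delta> x)\<close> and \<open>aug(T' \<gamma>\<^sub>1 x)\<close> vanish and the other two cancel.
\<close>

lemma deformed_lift:
  assumes g: "g \<in> hom (Qres e R l) S" and L: "A_lift l g \<gamma>" and L': "A_lift (Suc l) (g \<circ> T l) \<gamma>'"
  shows "\<exists>d. (\<forall>j. twisted (l + j) j (\<gamma> j) (d j)) \<and>
    (\<forall>j. \<forall>x\<in>Q (Suc (l + j)). dl j (d (Suc j) x) + T' j (\<gamma> (Suc j) x)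
       = d j (dl (l + j) x) + \<gamma> j (T' (l + j) x) + (- 1) ^ Suc (l + j) \<odot> \<gamma>' j x)"
proof -
  note ga = A_liftD(1)[OF L] and ga' = A_liftD(1)[OF L', simplified]
  define rhs where "rhs = (\<lambda>j d x. \<gamma> j (T' (l + j) x) + d (dl (l + j) x) + (- 1) ^ Suc (l + j) \<odot> \<gamma>' j x)"
  let ?P = "\<lambda>j d. twisted (l + j) j (\<gamma> j) d \<and>
    (\<forall>x\<in>Q (Suc (l + j)). cycle j (rhs j d x - T' j (\<gamma> (Suc j) x)))"
  let ?R = "\<lambda>j d d'. \<forall>x\<in>Q (Suc (l + j)). dl j (d' x) + T' j (\<gamma> (Suc j) x) = rhs j d x"
  have dlQ: "dl k x \<in> Q k" if "x \<in> Q (Suc k)" for k x by (rule QhomD(1)[OF dl_hom that])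
  have T'Q: "T' k x \<in> Q k" if "x \<in> Q (Suc k)" for k x by (rule twistedD(2)[OF T'_twisted that])
  have gaQ: "\<gamma> j x \<in> Q j" if "x \<in> Q (l + j)" for j x by (rule QhomD(1)[OF ga that])
  have gaQ': "\<gamma>' j x \<in> Q j" if "x \<in> Q (Suc (l + j))" for j x by (rule QhomD(1)[OF ga' that])
  have rhsQ: "rhs j d x \<in> Q j" if "twisted (l + j) j (\<gamma> j) d" "x \<in> Q (Suc (l + j))" for j d x
    using that twistedD(2)[OF that(1)] by (simp add: rhs_def Q_simps dlQ T'Q gaQ gaQ')
  have "\<exists>d. \<forall>j. ?P j (d j) \<and> ?R j (d j) (d (Suc j))"
  proof (rule dependent_nat_choice)
    have tw: "twisted (l + 0) 0 (\<gamma> 0) (twist (l + 0) 0 (\<gamma> 0))" by (rule twist_twisted[OF ga])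
    have "cycle 0 (rhs 0 (twist (l + 0) 0 (\<gamma> 0)) x - T' 0 (\<gamma> (Suc 0) x))" if x: "x \<in> Q (Suc l)" for x
    proof -
      have 1: "aug R (twist l 0 (\<gamma> 0) (dl l x)) = 0"
        using hom_S_rad[OF aug_hom twisted_rad[OF tw]] dl_rad[OF x] by simp
      have 2: "aug R (\<gamma> 0 (T' l x)) = g (T' l x)" using A_liftD(2)[OF L] T'Q x by simp
      have "g (T' l x) = act S ((- 1) ^ l) (g (T l x))"
        using QhomD(3)[OF g T'Q[OF x], of "(- 1) ^ l"] T_T'[of l x] QhomD(1)[OF g T'Q[OF x]]
        by (cases "even l") (simp_all add: S_simps)
      moreover have "aug R (\<gamma>' 0 x) = g (T l x)" using A_liftD(2)[OF L' x] by simp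
      moreover have "g (T l x) \<in> car S" using QhomD(1)[OF T_S_hom[OF g] x] by simp
      ultimately have 3: "aug R ((- 1) ^ Suc l \<odot> \<gamma>' 0 x) = - g (T' l x)"
        using QhomD(3)[OF aug_hom, of "\<gamma>' 0 x" "(- 1) ^ Suc l"] gaQ'[of x 0] x by (simp add: S_simps)
      have 4: "aug R (T' 0 (\<gamma> (Suc 0) x)) = 0" using aug_T' gaQ[of x "Suc 0"] x by simp
      have Q4: "\<gamma> 0 (T' l x) \<in> Q 0" "twist l 0 (\<gamma> 0) (dl l x) \<in> Q 0" "(- 1) ^ Suc l \<odot> \<gamma>' 0 x \<in> Q 0"
        "T' 0 (\<gamma> (Suc 0) x) \<in> Q 0"
        using gaQ[of _ 0] gaQ'[of x 0] gaQ[of x "Suc 0"] twistedD(2)[OF tw] x dlQ[OF x]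
        by (simp_all add: Q_simps(3,11) T'Q dlQ)
      have "aug R (rhs 0 (twist (l + 0) 0 (\<gamma> 0)) x - T' 0 (\<gamma> (Suc 0) x))
         = aug R (\<gamma> 0 (T' l x)) + aug R (twist l 0 (\<gamma> 0) (dl l x)) + aug R ((- 1) ^ Suc l \<odot> \<gamma>' 0 x) - aug R (T' 0 (\<gamma> (Suc 0) x))"
        using Q4 by (simp only: rhs_def QhomD(2)[OF aug_hom] QhomD(7)[OF aug_hom] Q_simps(2) add_0_right)
      then show ?thesis unfolding cycle_simps 1 2 3 4 by simp
    qed
    then show "\<exists>d. ?P 0 d" using tw by (intro exI[of _ "twist (l + 0) 0 (\<gamma> 0)"]) simp
  next
    fix d j assume P: "?P j d"
    then have tw: "twisted (l + j) j (\<gamma> j) d" by blast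
    let ?F = "twist (Suc (l + j)) (Suc j) (\<gamma> (Suc j))"
    have ga1: "\<gamma> (Suc j) \<in> hom (Qres e R (Suc (l + j))) (Qres e R (Suc j))" using ga[of "Suc j"] by simp
    note F = twist_twisted[OF ga1]
    have t1: "twisted (Suc (l + j)) j (\<gamma> j \<circ> dl (l + j)) (\<lambda>x. \<gamma> j (T' (l + j) x) + d (dl (l + j) x))"
      by (rule twisted_comp[OF T'_twisted tw])
    have t2: "twisted (Suc (l + j)) j (\<gamma> j \<circ> dl (l + j)) (\<lambda>x. dl j (?F x) + T' j (\<gamma> (Suc j) x))"
      using twisted_comp[OF F T'_twisted] A_lift_comp[OF L] by simp
    have "(\<lambda>x. (- 1) ^ Suc (l + j) \<odot> \<gamma>' j x) \<in> hom (Qres e R (Suc (l + j))) (Qres e R j)"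
      using QhomD[OF ga'] by (cases "even (l + j)")
        (auto simp: hom_def Q_act Q_simps smul_simps)
    from hom_add[OF twisted_diff[OF t1 t2] this Q_module Q_module]
    have phi: "(\<lambda>x. rhs j d x - (dl j (?F x) + T' j (\<gamma> (Suc j) x))) \<in> hom (Qres e R (Suc (l + j))) (Qres e R j)"
      by (simp add: rhs_def algebra_simps)
    have FQ: "?F x \<in> Q (Suc j)" if "x \<in> Q (Suc (l + j))" for x using twistedD(2)[OF F that] .
    have "cycle j (rhs j d x - (dl j (?F x) + T' j (\<gamma> (Suc j) x)))" if x: "x \<in> Q (Suc (l + j))" for x
    proof -
      have "rhs j d x - T' j (\<gamma> (Suc j) x) \<in> Q j"
        using x by (intro Q_simps(12) rhsQ[OF tw] T'Q gaQ) simp_all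
      from cycle_diff[OF this dlQ[OF FQ[OF x]]] P x cycle_boundary[OF FQ[OF x]]
      show ?thesis by (simp add: algebra_simps)
    qed
    from lift_cycle[OF phi this] obtain h where h: "h \<in> hom (Qres e R (Suc (l + j))) (Qres e R (Suc j))"
      "\<And>x. x \<in> Q (Suc (l + j)) \<Longrightarrow> dl j (h x) = rhs j d x - (dl j (?F x) + T' j (\<gamma> (Suc j) x))" by blast
    define d' where "d' = (\<lambda>x. ?F x + h x)"
    have tw': "twisted (Suc (l + j)) (Suc j) (\<gamma> (Suc j)) d'"
      unfolding d'_def by (rule twisted_add_hom[OF F h(1)])
    have R: "dl j (d' x) + T' j (\<gamma> (Suc j) x) = rhs j d x" if x: "x \<in> Q (Suc (l + j))" for x
      using h(2)[OF x] QhomD(2)[OF dl_hom FQ[OF x] QhomD(1)[OF h(1) x]] by (simp add: d'_def)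
    have "dl j (rhs (Suc j) d' x - T' (Suc j) (\<gamma> (Suc (Suc j)) x)) = 0" if x: "x \<in> Q (Suc (Suc (l + j)))" for x
    proof -
      have y: "dl (Suc (l + j)) x \<in> Q (Suc (l + j))" "T' (Suc (l + j)) x \<in> Q (Suc (l + j))"
        using x by (simp_all add: dlQ T'Q)
      have ga2: "\<gamma> (Suc (Suc j)) x \<in> Q (Suc (Suc j))" "\<gamma>' (Suc j) x \<in> Q (Suc j)"
        using gaQ[of x "Suc (Suc j)"] gaQ'[of x "Suc j"] x by simp_all
      have 1: "dl j (d' (dl (Suc (l + j)) x)) = \<gamma> j (T' (l + j) (dl (Suc (l + j)) x))
          + (- 1) ^ Suc (l + j) \<odot> \<gamma>' j (dl (Suc (l + j)) x) - T' j (\<gamma> (Suc j) (dl (Suc (l + j)) x))"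
        using R[OF y(1)] dl_dl[OF x] twisted_zero[OF tw] by (simp add: rhs_def eq_diff_eq)
      have 2: "dl j (\<gamma> (Suc j) (T' (Suc (l + j)) x)) = - \<gamma> j (T' (l + j) (dl (Suc (l + j)) x))"
      proof -
        have "dl (l + j) (T' (Suc (l + j)) x) = - T' (l + j) (dl (Suc (l + j)) x)"
          using dl_T'[OF x] by (simp add: eq_neg_iff_add_eq_0)
        then show ?thesis using A_liftD(3)[OF L y(2)] QhomD(6)[OF ga T'Q[OF y(1)]] by simp
      qed
      have 3: "dl j ((- 1) ^ Suc (Suc (l + j)) \<odot> \<gamma>' (Suc j) x) = - ((- 1) ^ Suc (l + j) \<odot> \<gamma>' j (dl (Suc (l + j)) x))"
        using QhomD(3)[OF dl_hom ga2(2), of "(- 1) ^ Suc (Suc (l + j))"] A_liftD(3)[OF L', of x j] x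
        by (simp add: Q_act smul_simps)
      have 4: "dl j (T' (Suc j) (\<gamma> (Suc (Suc j)) x)) = - T' j (\<gamma> (Suc j) (dl (Suc (l + j)) x))"
        using dl_T'[OF ga2(1)] A_liftD(3)[OF L, of x "Suc j"] x by (simp add: eq_neg_iff_add_eq_0)
      have Q4: "\<gamma> (Suc j) (T' (Suc (l + j)) x) \<in> Q (Suc j)" "d' (dl (Suc (l + j)) x) \<in> Q (Suc j)"
        "(- 1) ^ Suc (Suc (l + j)) \<odot> \<gamma>' (Suc j) x \<in> Q (Suc j)" "T' (Suc j) (\<gamma> (Suc (Suc j)) x) \<in> Q (Suc j)"
        using gaQ[of "T' (Suc (l + j)) x" "Suc j"] twistedD(2)[OF tw' y(1)] ga2 y by (auto intro: Q_simps(3) T'Q)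
      have "rhs (Suc j) d' x - T' (Suc j) (\<gamma> (Suc (Suc j)) x) = \<gamma> (Suc j) (T' (Suc (l + j)) x) + d' (dl (Suc (l + j)) x)
          + (- 1) ^ Suc (Suc (l + j)) \<odot> \<gamma>' (Suc j) x - T' (Suc j) (\<gamma> (Suc (Suc j)) x)"
        by (simp only: rhs_def add_Suc_right)
      then have "dl j (rhs (Suc j) d' x - T' (Suc j) (\<gamma> (Suc (Suc j)) x))
          = dl j (\<gamma> (Suc j) (T' (Suc (l + j)) x)) + dl j (d' (dl (Suc (l + j)) x))
          + dl j ((- 1) ^ Suc (Suc (l + j)) \<odot> \<gamma>' (Suc j) x) - dl j (T' (Suc j) (\<gamma> (Suc (Suc j)) x))"
        using Q4 by (simp only: QhomD(2)[OF dl_hom] QhomD(7)[OF dl_hom] Q_simps(2))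
      also have "\<dots> = 0" unfolding 1 2 3 4 by (simp only: algebra_simps) simp
      finally show ?thesis .
    qed
    then show "\<exists>d'. ?P (Suc j) d' \<and> ?R j d d'" using tw' R
      by (intro exI[of _ d']) (simp add: cycle_simps)
  qed
  then obtain d where "\<And>j. ?P j (d j)" "\<And>j. ?R j (d j) (d (Suc j))" by blast
  then show ?thesis by (intro exI[of _ d]) (auto simp: rhs_def add.commute add.left_commute)
qed

end

section \<open>The integer coefficients\<close>

text \<open>
  The coefficient \<open>\<kappa>\<^sub>l(a)\<close> with which the lifting of \<open>g T\<^bsub>s+1\<^esub> \<cdots> T\<^sub>l\<close> occurs, on \<open>x\<^sup>a\<close>, in the lifting of
  \<open>g x\<^bsup>p-s\<^esup>\<close>.  This summand sends \<open>x\<^sup>a\<close> to \<open>x\<^bsup>a+l-p\<^esup>\<close>, so \<open>\<kappa>\<^sub>l(a) = 0\<close> for \<open>a + l < p\<close>.  For \<open>a + l = p\<close>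
  it is visible after augmentation, which forces its value.  The last case is the recursion
  \<open>\<kappa>\<^sub>l(a) = (-1)\<^sup>l (\<kappa>\<^sub>l(a-1) - \<kappa>\<^bsub>l-1\<^esub>(a))\<close>, where \<open>\<kappa>\<close> is zero at negative arguments.
\<close>

fun lift_coeff :: "nat \<Rightarrow> nat \<Rightarrow> nat \<Rightarrow> nat \<Rightarrow> int" where
  "lift_coeff p s l a =
     (if l < s \<or> a + l < p then 0
      else if a + l = p then (if l = s then 1 else 0)
      else (- 1) ^ l * ((if a = 0 then 0 else lift_coeff p s l (a - 1)) - (if l = 0 then 0 else lift_coeff p s (l - 1) a)))"

declare lift_coeff.simps [simp del]

lemma lift_coeff_below: "l < s \<Longrightarrow> lift_coeff p s l a = 0"
  by (simp add: lift_coeff.simps)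

lemma lift_coeff_start: "a + l = p \<Longrightarrow> lift_coeff p s l a = (if l = s then 1 else 0)"
  by (auto simp: lift_coeff.simps)

lemma lift_coeff_rec:
  assumes "a + l > p"
  shows "lift_coeff p s l a = (- 1) ^ l * ((if a = 0 then 0 else lift_coeff p s l (a - 1)) - (if l = 0 then 0 else lift_coeff p s (l - 1) a))"
proof (cases "l < s")
  case True
  then show ?thesis by (simp add: lift_coeff_below)
next
  case False
  show ?thesis by (subst lift_coeff.simps) (use False assms in auto)
qed

lemma lift_coeff_diagonal: "s \<le> p \<Longrightarrow> lift_coeff p s s (p - s + b) = (- 1) ^ (s * b)"
proof (induction b)
  case 0
  then show ?case by (simp add: lift_coeff_start)
next
  case (Suc b)
  have "lift_coeff p s s (p - s + Suc b) = (- 1) ^ s * lift_coeff p s s (p - s + b)"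
    using Suc.prems by (subst lift_coeff_rec) (auto simp: lift_coeff_below)
  then show ?case using Suc by (simp add: power_add)
qed

context star_setting
begin

text \<open>
  The three sums are the contributions of division by \<open>x\<close> after the lifting, of the obstructions, and of
  division by \<open>x\<close> before the lifting.  After a shift of the index in the second one, comparing
  coefficients of \<open>z\<^sub>l\<close> gives the recursion of \<open>lift_coeff\<close>.
\<close>

lemma lift_coeff_cancel:
  fixes z :: "nat \<Rightarrow> nat \<Rightarrow> 'a"
  assumes N: "N \<ge> p"
  shows "(- 1) ^ i \<odot> (\<Sum>l\<le>Suc N. of_int (lift_coeff p s l (Suc N - l)) \<odot> z l)
      + (\<Sum>l\<le>N. of_int (lift_coeff p s l (N - l)) \<odot> (- 1) ^ Suc (l + i) \<odot> z (Suc l))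
    = (\<Sum>l\<le>N. of_int (lift_coeff p s l (N - l)) \<odot> (- 1) ^ (l + i) \<odot> z l)"
proof -
  define w where "w l = (if l = 0 then 0 else of_int (lift_coeff p s (l - 1) (Suc N - l)) \<odot> (- 1) ^ (l + i) \<odot> z l)" for l
  define v where "v l = (if l = Suc N then 0 else of_int (lift_coeff p s l (N - l)) \<odot> (- 1) ^ (l + i) \<odot> z l)" for l
  have "(\<Sum>l\<le>N. of_int (lift_coeff p s l (N - l)) \<odot> (- 1) ^ Suc (l + i) \<odot> z (Suc l)) = (\<Sum>l\<le>N. w (Suc l))"
    by (intro sum.cong) (auto simp: w_def)
  also have "\<dots> = (\<Sum>l\<le>Suc N. w l)" by (subst sum.atMost_Suc_shift) (simp add: w_def)
  finally have 1: "(\<Sum>l\<le>N. of_int (lift_coeff p s l (N - l)) \<odot> (- 1) ^ Suc (l + i) \<odot> z (Suc l)) = (\<Sum>l\<le>Suc N. w l)" .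
  have 2: "(\<Sum>l\<le>N. of_int (lift_coeff p s l (N - l)) \<odot> (- 1) ^ (l + i) \<odot> z l) = (\<Sum>l\<le>Suc N. v l)"
    by (simp add: v_def)
  have "(- 1) ^ i \<odot> of_int (lift_coeff p s l (Suc N - l)) \<odot> z l + w l = v l" if l: "l \<le> Suc N" for l
  proof -
    have k: "lift_coeff p s l (Suc N - l) = (- 1) ^ l * ((if l = Suc N then 0 else lift_coeff p s l (N - l)) - (if l = 0 then 0 else lift_coeff p s (l - 1) (Suc N - l)))"
    proof -
      have "Suc N - l + l > p" using l N by simp
      moreover have "Suc N - l - 1 = N - l" "Suc N - l = 0 \<longleftrightarrow> l = Suc N" using l by auto
      ultimately show ?thesis using lift_coeff_rec[of p "Suc N - l" l s] by simp
    qed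
    have m: "(- 1) ^ k * of_int b = of_int ((- 1) ^ k * b)" "of_int b * (- 1) ^ k = of_int (b * (- 1) ^ k)" for k b
      by simp_all
    have "(- 1) ^ i * of_int (lift_coeff p s l (Suc N - l)) + (if l = 0 then 0 else of_int (lift_coeff p s (l - 1) (Suc N - l)) * (- 1) ^ (l + i))
      = (if l = Suc N then 0 else of_int (lift_coeff p s l (N - l)) * (- 1) ^ (l + i) :: 'a)"
      unfolding k m by (cases "even i"; cases "even l") auto
    then have "((- 1) ^ i * of_int (lift_coeff p s l (Suc N - l)) + (if l = 0 then 0 else of_int (lift_coeff p s (l - 1) (Suc N - l)) * (- 1) ^ (l + i))) \<odot> z l
      = (if l = Suc N then 0 else of_int (lift_coeff p s l (N - l)) * (- 1) ^ (l + i)) \<odot> z l" by simp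
    then show ?thesis unfolding w_def v_def smul_simps(2) by (simp add: smul_simps(3,6,7,9) split: if_splits)
  qed
  then show ?thesis unfolding 1 2 smul_sum by (simp only: sum.distrib[symmetric]) simp
qed

section \<open>Liftings over the deformed algebra\<close>

abbreviation P :: "nat \<Rightarrow> (nat \<Rightarrow> nat \<Rightarrow> 'a) set" where "P m \<equiv> car (Psum e R m)"

lemma P_iff: "x \<in> P m \<longleftrightarrow> (\<forall>k\<le>m. x k \<in> Q k) \<and> (\<forall>k>m. x k = 0)"
  and P_act: "act (Psum e R m) a x = (\<lambda>k. a \<odot> x k)"
  by (simp_all add: Psum_simps Q_act)

lemma P_module: "left_module (Psum e R m)"
  by (auto simp: left_module_def P_iff P_act Q_simps smul_simps intro!: ext)

lemmas P_simps = left_moduleD[OF P_module, unfolded P_act]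
lemmas PhomD = homD[OF _ P_module, unfolded P_act]

lemma P_D: "x \<in> P m \<Longrightarrow> k \<le> m \<Longrightarrow> x k \<in> Q k" by (simp add: P_iff)

definition inc :: "nat \<Rightarrow> (nat \<Rightarrow> 'a) \<Rightarrow> nat \<Rightarrow> nat \<Rightarrow> 'a" where "inc k y = (\<lambda>j. if j = k then y else 0)"

lemma inc_in: "k \<le> m \<Longrightarrow> inc k y \<in> P m \<longleftrightarrow> y \<in> Q k"
  by (auto simp: inc_def P_iff Q_simps)

lemma inc_simps: "inc k (x + y) = inc k x + inc k y" "inc k (a \<odot> x) = (\<lambda>i. a \<odot> inc k x i)" "inc k 0 = 0"
  by (auto simp: inc_def fun_eq_iff smul_simps)

lemma P_expand: assumes "x \<in> P m" shows "x = (\<Sum>k\<le>m. inc k (x k))"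
proof
  fix i
  have "(\<Sum>k\<le>m. inc k (x k)) i = (\<Sum>k\<le>m. if k = i then x k else 0)"
    by (subst sum_apply, intro sum.cong) (auto simp: inc_def)
  then show "x i = (\<Sum>k\<le>m. inc k (x k)) i" using assms by (simp add: P_iff)
qed

definition fP :: "nat \<Rightarrow> 'a \<Rightarrow> (nat \<Rightarrow> nat \<Rightarrow> 'a) \<Rightarrow> nat \<Rightarrow> nat \<Rightarrow> 'a" where
  "fP m a x = (\<lambda>k. if k \<le> m then fQ k a (x k) else 0)"

lemma fP_in: "fP m a x \<in> P m"
  by (simp add: fP_def P_iff fQ_in)

text \<open>
  The analogue of \<open>twisted\<close> for direct sums of the modules \<open>Q\<^sub>k\<close>; by \<open>Af_hom_iff\<close> it describes all morphisms
  between the terms of the resolution over \<open>A\<^sub>f\<close>.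
\<close>

definition Af_pair :: "nat \<Rightarrow> nat \<Rightarrow> ((nat \<Rightarrow> nat \<Rightarrow> 'a) \<Rightarrow> nat \<Rightarrow> nat \<Rightarrow> 'a) \<Rightarrow>
    ((nat \<Rightarrow> nat \<Rightarrow> 'a) \<Rightarrow> nat \<Rightarrow> nat \<Rightarrow> 'a) \<Rightarrow> bool" where
  "Af_pair p m u d \<longleftrightarrow> u \<in> hom (Psum e R p) (Psum e R m) \<and>
     (\<forall>x\<in>P p. d x \<in> P m) \<and> (\<forall>x\<in>P p. \<forall>y\<in>P p. d (x + y) = d x + d y) \<and>
     (\<forall>a. \<forall>x\<in>P p. d (\<lambda>k. a \<odot> x k) = (\<lambda>k. a \<odot> d x k) - u (fP p a x) + fP m a (u x)) \<and>
     (\<forall>x. x \<notin> P p \<longrightarrow> d x = 0)"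

lemma Af_pairD:
  assumes "Af_pair p m u d"
  shows "u \<in> hom (Psum e R p) (Psum e R m)"
    "x \<in> P p \<Longrightarrow> d x \<in> P m" "x \<in> P p \<Longrightarrow> y \<in> P p \<Longrightarrow> d (x + y) = d x + d y"
    "x \<in> P p \<Longrightarrow> d (\<lambda>k. a \<odot> x k) = (\<lambda>k. a \<odot> d x k) - u (fP p a x) + fP m a (u x)" "x \<notin> P p \<Longrightarrow> d x = 0"
  using assms by (auto simp: Af_pair_def)

text \<open>
  Scalars commute with twisted maps because \<open>f\<^sub>Q\<close> acts on them through the element \<open>f(1, 1)\<close>, which makes
  the two correction terms cancel.
\<close>

lemma fQ_scalar: "y \<in> Q k \<Longrightarrow> fQ k (sc c 1) y = (sc c 1 * f 1 1) \<odot> y"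
proof
  fix r assume y: "y \<in> Q k"
  have "f (sc c 1) b = sc c (f 1 b)" for b
    using coc unfolding hochschild_2_cocycle_def Vector_Spaces.linear_def module_hom_def module_hom_axioms_def by blast
  moreover have "f 1 b = f 1 1 * b" for b using cocycle[of 1 1 b] by simp
  ultimately have "f (sc c 1) b = sc c 1 * f 1 1 * b" for b by (metis fd sc_alg(7) mult_1 mult.assoc)
  then show "fQ k (sc c 1) y r = ((sc c 1 * f 1 1) \<odot> y) r"
    using Q_D[OF y, of r] by (simp add: fQ_apply smul_apply mult.assoc)
qed

lemma fP_scalar: "x \<in> P m \<Longrightarrow> fP m (sc c 1) x = (\<lambda>k. (sc c 1 * f 1 1) \<odot> x k)"
  by (auto simp: fP_def fun_eq_iff P_iff fQ_scalar smul_simps smul_apply)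

text \<open>
  Since the map \<open>TM\<close> of \<open>Phat\<close> is the identity, the outer two components of a morphism coincide.
\<close>

lemma Af_hom_iff: "(u, d, u2) \<in> Af_hom sc (Phat e f R p) (Phat e f R m) \<longleftrightarrow> u2 = u \<and> Af_pair p m u d"
proof
  assume A: "(u, d, u2) \<in> Af_hom sc (Phat e f R p) (Phat e f R m)"
  then have u: "u \<in> hom (Psum e R p) (Psum e R m)" "u2 \<in> hom (Psum e R p) (Psum e R m)"
    and kl: "d \<in> klin sc (Psum e R p) (Psum e R m)"
    and T: "\<forall>x\<in>P p. restr0 (P m) (\<lambda>x. x) (u x) = u2 (restr0 (P p) (\<lambda>x. x) x)"
    and tw: "\<forall>a. \<forall>x\<in>P p. d (\<lambda>k. a \<odot> x k) = (\<lambda>k. a \<odot> d x k) - u2 (restr0 (P p) (fP p a) x) + restr0 (P m) (fP m a) (u x)"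
    by (simp_all add: Af_hom_def Phat_def P_act fP_def[abs_def])
  have "u2 x = u x" for x
  proof (cases "x \<in> P p")
    case True
    with T have "restr0 (P m) (\<lambda>x. x) (u x) = u2 (restr0 (P p) (\<lambda>x. x) x)" by blast
    then show ?thesis using True PhomD(1)[OF u(1) True] by (simp add: restr0_def)
  qed (simp add: PhomD(4)[OF u(1)] PhomD(4)[OF u(2)])
  then have "u2 = u" by blast
  moreover from this have "Af_pair p m u d"
    using u kl tw PhomD(1)[OF u(1)] by (simp add: Af_pair_def klin_def restr0_def)
  ultimately show "u2 = u \<and> Af_pair p m u d" by blast
next
  assume "u2 = u \<and> Af_pair p m u d"
  then have u2: "u2 = u" and A: "Af_pair p m u d" by auto
  note u = Af_pairD(1)[OF A]
  have "d (\<lambda>k. sc c 1 \<odot> x k) = (\<lambda>k. sc c 1 \<odot> d x k)" if x: "x \<in> P p" for c x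
    using Af_pairD(4)[OF A x, of "sc c 1"] fP_scalar[OF x] fP_scalar[OF PhomD(1)[OF u x]] PhomD(3)[OF u x]
    by (simp add: P_act)
  then show "(u, d, u2) \<in> Af_hom sc (Phat e f R p) (Phat e f R m)"
    using u Af_pairD(2-5)[OF A] PhomD(1)[OF u]
    by (simp add: u2 Af_hom_def Phat_def P_act fP_def klin_def restr0_def)
qed

text \<open>
  The differential over \<open>A\<^sub>f\<close> is the pair \<open>(U, W)\<close>.
\<close>

definition U :: "nat \<Rightarrow> (nat \<Rightarrow> nat \<Rightarrow> 'a) \<Rightarrow> nat \<Rightarrow> nat \<Rightarrow> 'a" where
  "U m x = (\<lambda>k. if k < m then dl k (x (Suc k)) else 0)"

definition W :: "nat \<Rightarrow> (nat \<Rightarrow> nat \<Rightarrow> 'a) \<Rightarrow> nat \<Rightarrow> nat \<Rightarrow> 'a" where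
  "W m x = (\<lambda>k. if k < m then (- 1) ^ k \<odot> x k + T' k (x (Suc k)) else 0)"

lemma hat_delta_UW: "hat_delta e f R C m = (restr0 (P m) (U m), restr0 (P m) (W m), restr0 (P m) (U m))"
  by (simp add: hat_delta_def Let_def U_def[abs_def] W_def[abs_def] Q_act T'_def smul_simps cong: if_cong)

lemma U_in: "x \<in> P (Suc m) \<Longrightarrow> U (Suc m) x \<in> P m"
  and W_in: "x \<in> P (Suc m) \<Longrightarrow> W (Suc m) x \<in> P m"
  by (auto simp: P_iff U_def W_def intro!: Q_simps QhomD(1)[OF dl_hom] twistedD(2)[OF T'_twisted])

text \<open>
  \<open>lifting_Af\<close> in terms of pairs and restricted to carriers; see \<open>lifting_Af_iff\<close>.
\<close>

definition Af_lift :: "nat \<Rightarrow> (nat \<Rightarrow> (nat \<Rightarrow> 'a) \<Rightarrow> 's) \<Rightarrow>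
    (nat \<Rightarrow> (nat \<Rightarrow> nat \<Rightarrow> 'a) \<Rightarrow> nat \<Rightarrow> nat \<Rightarrow> 'a) \<Rightarrow> (nat \<Rightarrow> (nat \<Rightarrow> nat \<Rightarrow> 'a) \<Rightarrow> nat \<Rightarrow> nat \<Rightarrow> 'a) \<Rightarrow> bool" where
  "Af_lift p g u d \<longleftrightarrow> (\<forall>j. Af_pair (p + j) j (u j) (d j)) \<and>
     (\<forall>x\<in>P p. aug R (u 0 x 0) = (\<Sum>k\<le>p. g k (x k))) \<and>
     (\<forall>j. \<forall>x\<in>P (Suc (p + j)). U (Suc j) (u (Suc j) x) = u j (U (Suc (p + j)) x) \<and>
        U (Suc j) (d (Suc j) x) + W (Suc j) (u (Suc j) x) = u j (W (Suc (p + j)) x) + d j (U (Suc (p + j)) x))"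

lemma Af_liftD:
  assumes "Af_lift p g u d"
  shows "Af_pair (p + j) j (u j) (d j)" "x \<in> P p \<Longrightarrow> aug R (u 0 x 0) = (\<Sum>k\<le>p. g k (x k))"
    "x \<in> P (Suc (p + j)) \<Longrightarrow> U (Suc j) (u (Suc j) x) = u j (U (Suc (p + j)) x)"
    "x \<in> P (Suc (p + j)) \<Longrightarrow>
        U (Suc j) (d (Suc j) x) + W (Suc j) (u (Suc j) x) = u j (W (Suc (p + j)) x) + d j (U (Suc (p + j)) x)"
  using assms by (auto simp: Af_lift_def)

lemma Af_pair_zero: assumes "Af_pair p m u d" shows "u 0 = 0" "d 0 = 0"
proof -
  show "u 0 = 0" by (rule PhomD(5)[OF Af_pairD(1)[OF assms]])
  have "d (0 + 0) = d 0 + d 0" by (rule Af_pairD(3)[OF assms P_simps(1) P_simps(1)])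
  then show "d 0 = 0" unfolding add_0_left by (simp only: add_cancel_right_right)
qed

lemma lifting_Af_iff:
  assumes g: "\<And>k. k \<le> p \<Longrightarrow> g k \<in> hom (Qres e R k) S"
  shows "lifting_Af sc e f R C p (hat_elem e R p g) \<gamma> \<longleftrightarrow> (\<exists>u d. \<gamma> = (\<lambda>j. (u j, d j, u j)) \<and> Af_lift p g u d)"
proof
  assume L: "lifting_Af sc e f R C p (hat_elem e R p g) \<gamma>"
  define u d where "u j = fst (\<gamma> j)" and "d j = fst (snd (\<gamma> j))" for j
  have h: "\<gamma> j \<in> Af_hom sc (Phat e f R (p + j)) (Phat e f R j)" for j
    using L by (simp add: lifting_Af_def)
  have "(u j, d j, snd (snd (\<gamma> j))) \<in> Af_hom sc (Phat e f R (p + j)) (Phat e f R j)" for j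
    using h[of j] by (simp add: u_def d_def)
  then have ga: "\<gamma> j = (u j, d j, u j)" and pr: "Af_pair (p + j) j (u j) (d j)" for j
    unfolding Af_hom_iff by (auto simp: u_def d_def prod_eq_iff)
  have uP: "u j x \<in> P j" "d j x \<in> P j" if "x \<in> P (p + j)" for j x
    using PhomD(1)[OF Af_pairD(1)[OF pr] that] Af_pairD(2)[OF pr that] by auto
  have "Af_comp (hat_elem e R 0 (\<lambda>_. aug R)) (\<gamma> 0) = hat_elem e R p g"
    using L by (simp add: lifting_Af_def)
  then have "(\<lambda>x. restr0 (P 0) (\<lambda>x. aug R (x 0)) (u 0 x)) = restr0 (P p) (\<lambda>x. \<Sum>k\<le>p. g k (x k))"
    by (simp add: ga Af_comp_def hat_elem_def)
  then have 1: "aug R (u 0 x 0) = (\<Sum>k\<le>p. g k (x k))" if "x \<in> P p" for x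
    using fun_cong[of _ _ x] uP[of x 0] that by (fastforce simp: restr0_def)
  have 2: "U (Suc j) (u (Suc j) x) = u j (U (Suc (p + j)) x) \<and>
        U (Suc j) (d (Suc j) x) + W (Suc j) (u (Suc j) x) = u j (W (Suc (p + j)) x) + d j (U (Suc (p + j)) x)"
    if x: "x \<in> P (Suc (p + j))" for j x
  proof -
    have "\<forall>j\<ge>1. Af_comp (hat_delta e f R C j) (\<gamma> j) = Af_comp (\<gamma> (j - 1)) (hat_delta e f R C (p + j))"
      using L by (simp add: lifting_Af_def)
    from this[rule_format, of "Suc j"]
    have "Af_comp (hat_delta e f R C (Suc j)) (\<gamma> (Suc j)) = Af_comp (\<gamma> j) (hat_delta e f R C (Suc (p + j)))" by simp
    then have e1: "(\<lambda>x. restr0 (P (Suc j)) (U (Suc j)) (u (Suc j) x)) = (\<lambda>x. u j (restr0 (P (Suc (p + j))) (U (Suc (p + j))) x))"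
      and e2: "(\<lambda>x. restr0 (P (Suc j)) (U (Suc j)) (d (Suc j) x) + restr0 (P (Suc j)) (W (Suc j)) (u (Suc j) x))
        = (\<lambda>x. u j (restr0 (P (Suc (p + j))) (W (Suc (p + j))) x) + d j (restr0 (P (Suc (p + j))) (U (Suc (p + j))) x))"
      by (simp_all add: ga Af_comp_def hat_delta_UW)
    show ?thesis using fun_cong[OF e1, of x] fun_cong[OF e2, of x] uP[of x "Suc j"] x by (simp add: restr0_def)
  qed
  have "Af_lift p g u d" using pr 1 2 by (simp add: Af_lift_def)
  then show "\<exists>u d. \<gamma> = (\<lambda>j. (u j, d j, u j)) \<and> Af_lift p g u d" using ga by blast
next
  assume "\<exists>u d. \<gamma> = (\<lambda>j. (u j, d j, u j)) \<and> Af_lift p g u d"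
  then obtain u d where ga: "\<gamma> = (\<lambda>j. (u j, d j, u j))" and L: "Af_lift p g u d" by blast
  note pr = Af_liftD(1)[OF L]
  have uP: "u j x \<in> P j" "d j x \<in> P j" if "x \<in> P (p + j)" for j x
    using PhomD(1)[OF Af_pairD(1)[OF pr] that] Af_pairD(2)[OF pr that] by auto
  have uz: "u j x = 0" "d j x = 0" if "x \<notin> P (p + j)" for j x
    using PhomD(4)[OF Af_pairD(1)[OF pr] that] Af_pairD(5)[OF pr that] by auto
  have "(\<lambda>x. restr0 (P 0) (\<lambda>x. aug R (x 0)) (u 0 x)) = restr0 (P p) (\<lambda>x. \<Sum>k\<le>p. g k (x k))"
  proof
    fix x
    show "restr0 (P 0) (\<lambda>x. aug R (x 0)) (u 0 x) = restr0 (P p) (\<lambda>x. \<Sum>k\<le>p. g k (x k)) x"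
      using uP[of x 0] uz[of x 0] Af_liftD(2)[OF L, of x] QhomD(5)[OF aug_hom]
      by (cases "x \<in> P p") (simp_all add: restr0_def)
  qed
  then have 1: "Af_comp (hat_elem e R 0 (\<lambda>_. aug R)) (\<gamma> 0) = hat_elem e R p g"
    by (simp add: ga Af_comp_def hat_elem_def fun_eq_iff)
  have UW0: "U k 0 = 0" "W k 0 = 0" for k
    using QhomD(5)[OF dl_hom] twisted_zero[OF T'_twisted] by (auto simp: U_def W_def fun_eq_iff smul_simps)
  have 2: "Af_comp (hat_delta e f R C (Suc j)) (\<gamma> (Suc j)) = Af_comp (\<gamma> j) (hat_delta e f R C (Suc (p + j)))" for j
  proof -
    have "restr0 (P (Suc j)) (U (Suc j)) (u (Suc j) x) = u j (restr0 (P (Suc (p + j))) (U (Suc (p + j))) x)"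
      and "restr0 (P (Suc j)) (U (Suc j)) (d (Suc j) x) + restr0 (P (Suc j)) (W (Suc j)) (u (Suc j) x)
        = u j (restr0 (P (Suc (p + j))) (W (Suc (p + j))) x) + d j (restr0 (P (Suc (p + j))) (U (Suc (p + j))) x)" for x
      using uP[of x "Suc j"] uz[of x "Suc j"] Af_liftD(3,4)[OF L, of x j] Af_pair_zero[OF pr, of j]
      by (cases "x \<in> P (Suc (p + j))"; simp add: restr0_def UW0)+
    then show ?thesis by (simp add: ga Af_comp_def hat_delta_UW)
  qed
  have 3: "Af_comp (hat_delta e f R C j) (\<gamma> j) = Af_comp (\<gamma> (j - 1)) (hat_delta e f R C (p + j))" if "j \<ge> 1" for j
    using 2[of "j - 1"] that by simp
  have "\<gamma> j \<in> Af_hom sc (Phat e f R (p + j)) (Phat e f R j)" for j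
    unfolding ga Af_hom_iff using pr by simp
  then show "lifting_Af sc e f R C p (hat_elem e R p g) \<gamma>"
    using 1 3 by (simp add: lifting_Af_def)
qed


section \<open>Liftings of zero\<close>

lemma fP_inc: "k \<le> m \<Longrightarrow> fP m a (inc k y) = inc k (fQ k a y)"
  by (auto simp: fP_def inc_def fQ_simps)

text \<open>
  This reduces statements about pairs to twisted maps between single modules \<open>Q\<^sub>k\<close>.
\<close>

lemma Af_pair_coordinate:
  assumes A: "Af_pair p m u d" and k: "k \<le> p" and i: "i \<le> m"
  shows "twisted k i (\<lambda>y. u (inc k y) i) (\<lambda>y. d (inc k y) i)"
proof -
  note u = Af_pairD(1)[OF A]
  have I: "inc k y \<in> P p \<longleftrightarrow> y \<in> Q k" for y by (rule inc_in[OF k])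
  have up: "u (inc k y) \<in> P m" "d (inc k y) \<in> P m" if "y \<in> Q k" for y
    using PhomD(1)[OF u] Af_pairD(2)[OF A] that I by blast+
  have "(\<lambda>y. u (inc k y) i) \<in> hom (Qres e R k) (Qres e R i)"
    using P_D[OF up(1) i]
    by (auto simp: hom_def I inc_simps Q_act PhomD(2,4)[OF u] PhomD(3)[OF u, unfolded P_act])
  then show ?thesis
    using P_D[OF up(2) i] i
    by (auto simp: twisted_def I inc_simps Af_pairD(3-5)[OF A] fP_inc[OF k] fP_def[of m])
qed

lemma Af_pair_rad:
  assumes A: "Af_pair p m u d" and x: "x \<in> P p" "\<And>k. k \<le> p \<Longrightarrow> x k \<in> rad k" and i: "i \<le> m"
  shows "u x i \<in> rad i" "d x i \<in> rad i"
proof -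
  have I: "inc k (x k) \<in> P p" if "k \<in> {..p}" for k using inc_in[of k p] P_D[OF x(1)] that by simp
  have "u x = (\<Sum>k\<le>p. u (inc k (x k)))"
    using PhomD(8)[OF Af_pairD(1)[OF A], of "{..p}" "\<lambda>k. inc k (x k)"] I P_expand[OF x(1)] by simp
  then have "u x i = (\<Sum>k\<le>p. u (inc k (x k)) i)" by (simp add: sum_apply)
  then show "u x i \<in> rad i"
    using hom_rad[OF twistedD(1)[OF Af_pair_coordinate[OF A _ i]] x(2)] by (auto intro: rad_closed(7))
  have "d x = (\<Sum>k\<le>p. d (inc k (x k)))"
    using additive_sum[OF P_module, of p d "{..p}" "\<lambda>k. inc k (x k)"] Af_pairD(3)[OF A] I P_expand[OF x(1)] by simp
  then have "d x i = (\<Sum>k\<le>p. d (inc k (x k)) i)" by (simp add: sum_apply)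
  then show "d x i \<in> rad i"
    using twisted_rad[OF Af_pair_coordinate[OF A _ i] x(2)] by (auto intro: rad_closed(7))
qed

lemma U_inc: "Suc k \<le> m \<Longrightarrow> U m (inc (Suc k) y) = inc k (dl k y)" "U m (inc 0 y) = 0"
  using QhomD(5)[OF dl_hom] by (auto simp: U_def inc_def fun_eq_iff)

text \<open>
  Consider first the top component, the one in \<open>Q\<^sub>j\<close> of a value in \<open>Q\<^sub>0 \<oplus> \<cdots> \<oplus> Q\<^sub>j\<close>.  Restricted to the summands
  with a fixed power of \<open>x\<close>, these components form a chain map over \<open>A\<close>, to which \<open>chain_map_in_rad\<close>
  applies.  The other components follow by induction on \<open>j\<close> and descent from the top: in
  \<open>U d + W u = u W + d U\<close> all terms but \<open>W u\<close> are known to lie in the radical, and the \<open>i\<close>-th component of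
  \<open>W u\<close> is, up to sign, the \<open>i\<close>-th component of \<open>u\<close> plus \<open>T'\<close> of the next one.
\<close>

lemma null_lift_in_rad:
  assumes L: "Af_lift p (\<lambda>k y. 0) u d" and x: "x \<in> P (p + j)" and i: "i \<le> j"
  shows "u j x i \<in> rad i"
proof -
  note A = Af_liftD(1)[OF L]
  have uP: "u j x \<in> P j" "d j x \<in> P j" if "x \<in> P (p + j)" for j x
    using PhomD(1)[OF Af_pairD(1)[OF A] that] Af_pairD(2)[OF A that] by auto
  have diag: "u (b + i) (inc (c + i) y) (b + i) \<in> rad (b + i)"
    if c: "c \<le> p + b" "b = 0 \<or> c = 0" and y: "y \<in> Q (c + i)" for b c i y
  proof (rule chain_map_in_rad[where \<beta> = "\<lambda>i y. u (b + i) (inc (c + i) y) (b + i)"])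
    show "(\<lambda>y. u (b + i) (inc (c + i) y) (b + i)) \<in> hom (Qres e R (c + i)) (Qres e R (b + i))" for i
      by (rule twistedD(1)[OF Af_pair_coordinate[OF A]]) (use c in auto)
    show "y \<in> Q (c + i)" by (rule y)
    show "cycle b (u (b + 0) (inc (c + 0) y) (b + 0))" if "y \<in> Q c" for y
    proof (cases b)
      case 0
      then show ?thesis using c inc_in[of c p y] that Af_liftD(2)[OF L, of "inc c y"] by (simp add: cycle_simps)
    next
      case (Suc b')
      then have c0: "c = 0" using c by simp
      have "inc 0 y \<in> P (Suc (p + b'))" using that c0 inc_in[of 0] by simp
      from Af_liftD(3)[OF L this] have "U (Suc b') (u (Suc b') (inc 0 y)) b' = u b' 0 b'" by (simp add: U_inc)
      then show ?thesis using Af_pair_zero(1)[OF A, of b'] by (simp add: Suc c0 cycle_simps U_def)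
    qed
    show "dl (b + i) (u (b + Suc i) (inc (c + Suc i) y) (b + Suc i)) = u (b + i) (inc (c + i) (dl (c + i) y)) (b + i)"
      if "y \<in> Q (Suc (c + i))" for i y
    proof -
      have "inc (Suc (c + i)) y \<in> P (Suc (p + (b + i)))" using that c inc_in[of "Suc (c + i)"] by simp
      from Af_liftD(3)[OF L this]
      have "U (Suc (b + i)) (u (Suc (b + i)) (inc (Suc (c + i)) y)) (b + i) = u (b + i) (inc (c + i) (dl (c + i) y)) (b + i)"
        using c by (simp add: U_inc)
      then show ?thesis by (simp add: U_def)
    qed
  qed
  have top: "u j x j \<in> rad j" if x: "x \<in> P (p + j)" for j x
  proof -
    have I: "inc k (x k) \<in> P (p + j)" if "k \<in> {..p + j}" for k using inc_in[of k "p + j"] P_D[OF x] that by simp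
    have "u j x = (\<Sum>k\<le>p + j. u j (inc k (x k)))"
      using PhomD(8)[OF Af_pairD(1)[OF A], of "{..p + j}" "\<lambda>k. inc k (x k)" j] I P_expand[OF x] by simp
    then have "u j x j = (\<Sum>k\<le>p + j. u j (inc k (x k)) j)" by (simp add: sum_apply)
    moreover have "u j (inc k (x k)) j \<in> rad j" if "k \<le> p + j" for k
    \<comment> \<open>The summand \<open>Q\<^sub>k\<close> carries \<open>x\<^bsup>p+j-k\<^esup>\<close>; its chain starts in degree 0 of the target if \<open>k \<ge> j\<close>, and in \<open>Q\<^sub>0\<close> otherwise.\<close>
    proof (cases "k \<ge> j")
      case True
      then show ?thesis using diag[of "k - j" 0 "x k" j] that P_D[OF x that] by simp
    next
      case False
      then show ?thesis using diag[of 0 "j - k" "x k" k] P_D[OF x that] by simp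
    qed
    ultimately show ?thesis by (auto intro: rad_closed(7))
  qed
  show ?thesis using x i
  proof (induction j arbitrary: x i)
    case 0
    then show ?case using top[of x 0] by simp
  next
    case (Suc j)
    have x: "x \<in> P (Suc (p + j))" using Suc.prems by simp
    have xS: "x \<in> P (p + Suc j)" using x by simp
    have Wx: "W (Suc (p + j)) x \<in> P (p + j)" and Ux: "U (Suc (p + j)) x \<in> P (p + j)"
      using x W_in U_in by auto
    have Urad: "U (Suc (p + j)) x k \<in> rad k" if "k \<le> p + j" for k
      using P_D[OF x, of "Suc k"] that by (simp add: U_def dl_rad)
    have descend: "u (Suc j) x i \<in> rad i" if i: "i \<le> j" and up: "u (Suc j) x (Suc i) \<in> rad (Suc i)" for i
    proof -
      have eq: "U (Suc j) (d (Suc j) x) + W (Suc j) (u (Suc j) x)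
          = u j (W (Suc (p + j)) x) + d j (U (Suc (p + j)) x)" by (rule Af_liftD(4)[OF L x])
      have "dl i (d (Suc j) x (Suc i)) + ((- 1) ^ i \<odot> u (Suc j) x i + T' i (u (Suc j) x (Suc i)))
          = u j (W (Suc (p + j)) x) i + d j (U (Suc (p + j)) x) i"
        using fun_cong[OF eq, of i] i by (simp add: U_def W_def)
      then have 1: "(- 1) ^ i \<odot> u (Suc j) x i = u j (W (Suc (p + j)) x) i + d j (U (Suc (p + j)) x) i
          - dl i (d (Suc j) x (Suc i)) - T' i (u (Suc j) x (Suc i))" by (simp add: algebra_simps)
      have "(- 1) ^ i \<odot> u (Suc j) x i \<in> rad i"
        unfolding 1
      proof (intro rad_closed(3,4))
        show "u j (W (Suc (p + j)) x) i \<in> rad i" by (rule Suc.IH[OF Wx i])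
        show "d j (U (Suc (p + j)) x) i \<in> rad i" by (rule Af_pair_rad(2)[OF A Ux Urad i])
        show "dl i (d (Suc j) x (Suc i)) \<in> rad i" by (rule dl_rad, rule P_D[OF uP(2)[OF xS]]) (use i in simp)
        show "T' i (u (Suc j) x (Suc i)) \<in> rad i" by (rule twisted_rad[OF T'_twisted up])
      qed
      then have "(- 1) ^ i \<odot> (- 1) ^ i \<odot> u (Suc j) x i \<in> rad i" by (rule rad_closed(5))
      moreover have "(- 1) ^ i * (- 1) ^ i = (1 :: 'a)" by (cases "even i") simp_all
      ultimately show ?thesis by (simp add: smul_simps(8) flip: smul_simps(3))
    qed
    from Suc.prems(2) show ?case
    proof (induction i rule: inc_induct)
      case base
      show ?case by (rule top[OF xS])
    next
      case (step k)
      show ?case by (rule descend[OF _ step.IH]) (use step.hyps in simp)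
    qed
  qed
qed

section \<open>Sums of liftings and the Yoneda product\<close>

lemma UW_add:
  assumes "x \<in> P m" "y \<in> P m"
  shows "U m (x + y) = U m x + U m y" "W m (x + y) = W m x + W m y"
  using assms
  by (auto simp: U_def W_def fun_eq_iff[of _ "_ + _"] smul_simps QhomD(2)[OF dl_hom] twistedD(3)[OF T'_twisted] P_D)

lemma UW_neg:
  assumes "x \<in> P m"
  shows "U m (- x) = - U m x" "W m (- x) = - W m x"
proof -
  have t: "T' k (- z) = - T' k z" if "z \<in> Q (Suc k)" for k z
    using twisted_neg_one[OF T'_twisted that, of 1] by (simp add: smul_simps)
  show "U m (- x) = - U m x" "W m (- x) = - W m x"
    using assms
    by (auto simp: U_def W_def fun_eq_iff[of _ "- _"] smul_simps QhomD(6)[OF dl_hom] t P_D)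
qed

lemma fP_simps: "fP m a (x + y) = fP m a x + fP m a y" "fP m a (- x) = - fP m a x" "fP m a 0 = 0"
  by (auto simp: fP_def fun_eq_iff[of _ "_ + _"] fun_eq_iff[of _ "- _"] fun_eq_iff[of _ 0] fQ_simps)

lemma Af_lift_add:
  assumes L: "Af_lift p g u d" and L': "Af_lift p g' u' d'"
  shows "Af_lift p (\<lambda>k y. g k y + g' k y) (\<lambda>j x. u j x + u' j x) (\<lambda>j x. d j x + d' j x)"
  unfolding Af_lift_def
proof (intro conjI allI ballI)
  note A = Af_liftD(1)[OF L] and A' = Af_liftD(1)[OF L']
  note uP = PhomD(1)[OF Af_pairD(1)[OF A]] Af_pairD(2)[OF A] PhomD(1)[OF Af_pairD(1)[OF A']] Af_pairD(2)[OF A']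
  show "Af_pair (p + j) j (\<lambda>x. u j x + u' j x) (\<lambda>x. d j x + d' j x)" for j
    unfolding Af_pair_def
  proof (intro conjI allI ballI impI)
    show "(\<lambda>x. u j x + u' j x) \<in> hom (Psum e R (p + j)) (Psum e R j)"
      by (rule hom_add[OF Af_pairD(1)[OF A] Af_pairD(1)[OF A'] P_module P_module])
    show "d j (\<lambda>k. a \<odot> x k) + d' j (\<lambda>k. a \<odot> x k) = (\<lambda>k. a \<odot> (d j x + d' j x) k)
        - (u j (fP (p + j) a x) + u' j (fP (p + j) a x)) + fP j a (u j x + u' j x)" if x: "x \<in> P (p + j)" for a x
      unfolding Af_pairD(4)[OF A x] Af_pairD(4)[OF A' x]
      by (auto simp: fP_simps smul_simps fun_eq_iff[of _ "_ + _"])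
  qed (use uP Af_pairD(3,5)[OF A] Af_pairD(3,5)[OF A'] in \<open>auto simp: P_simps\<close>)
  show "aug R ((u 0 x + u' 0 x) 0) = (\<Sum>k\<le>p. g k (x k) + g' k (x k))" if "x \<in> P p" for x
    using Af_liftD(2)[OF L that] Af_liftD(2)[OF L' that] P_D[OF uP(1), of x 0 0] P_D[OF uP(3), of x 0 0] that
    by (simp add: sum.distrib QhomD(2)[OF aug_hom])
  fix j x assume x: "x \<in> P (Suc (p + j))"
  have xS: "x \<in> P (p + Suc j)" using x by simp
  note e = Af_liftD(3,4)[OF L x] Af_liftD(3,4)[OF L' x]
  show "U (Suc j) (u (Suc j) x + u' (Suc j) x) = u j (U (Suc (p + j)) x) + u' j (U (Suc (p + j)) x)"
    unfolding UW_add(1)[OF uP(1)[OF xS] uP(3)[OF xS]] e ..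
  have "U (Suc j) (d (Suc j) x + d' (Suc j) x) + W (Suc j) (u (Suc j) x + u' (Suc j) x)
      = (U (Suc j) (d (Suc j) x) + W (Suc j) (u (Suc j) x)) + (U (Suc j) (d' (Suc j) x) + W (Suc j) (u' (Suc j) x))"
    unfolding UW_add(2)[OF uP(1)[OF xS] uP(3)[OF xS]] UW_add(1)[OF uP(2)[OF xS] uP(4)[OF xS]] by (simp only: ac_simps)
  then show "U (Suc j) (d (Suc j) x + d' (Suc j) x) + W (Suc j) (u (Suc j) x + u' (Suc j) x)
      = u j (W (Suc (p + j)) x) + u' j (W (Suc (p + j)) x) + (d j (U (Suc (p + j)) x) + d' j (U (Suc (p + j)) x))"
    unfolding e by (simp only: ac_simps)
qed

lemma Af_lift_neg:
  assumes L: "Af_lift p g u d"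
  shows "Af_lift p (\<lambda>k y. - g k y) (\<lambda>j x. - u j x) (\<lambda>j x. - d j x)"
  unfolding Af_lift_def
proof (intro conjI allI ballI)
  note A = Af_liftD(1)[OF L]
  note uP = PhomD(1)[OF Af_pairD(1)[OF A]] Af_pairD(2)[OF A]
  show "Af_pair (p + j) j (\<lambda>x. - u j x) (\<lambda>x. - d j x)" for j
    unfolding Af_pair_def
  proof (intro conjI allI ballI impI)
    show "(\<lambda>x. - u j x) \<in> hom (Psum e R (p + j)) (Psum e R j)"
      using hom_diff[OF zero_hom Af_pairD(1)[OF A] P_module P_module] P_module by simp
    show "- d j (\<lambda>k. a \<odot> x k) = (\<lambda>k. a \<odot> (- d j x) k)
        - (- u j (fP (p + j) a x)) + fP j a (- u j x)" if x: "x \<in> P (p + j)" for a x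
      unfolding Af_pairD(4)[OF A x]
      by (auto simp: fP_simps smul_simps fun_eq_iff[of _ "_ + _"] fun_eq_iff[of "_ - _"] fun_eq_iff[of "- _"])
  qed (use uP Af_pairD(3,5)[OF A] in \<open>auto simp: P_simps\<close>)
  show "aug R ((- u 0 x) 0) = (\<Sum>k\<le>p. - g k (x k))" if "x \<in> P p" for x
    using Af_liftD(2)[OF L that] P_D[OF uP(1), of x 0 0] that
    by (simp add: sum_negf QhomD(6)[OF aug_hom])
  fix j x assume x: "x \<in> P (Suc (p + j))"
  have xS: "x \<in> P (p + Suc j)" using x by simp
  note e = Af_liftD(3,4)[OF L x]
  show "U (Suc j) (- u (Suc j) x) = - u j (U (Suc (p + j)) x)"
    unfolding UW_neg(1)[OF uP(1)[OF xS]] e ..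
  have "U (Suc j) (- d (Suc j) x) + W (Suc j) (- u (Suc j) x)
      = - (U (Suc j) (d (Suc j) x) + W (Suc j) (u (Suc j) x))"
    unfolding UW_neg(2)[OF uP(1)[OF xS]] UW_neg(1)[OF uP(2)[OF xS]] by (simp only: minus_add_distrib)
  then show "U (Suc j) (- d (Suc j) x) + W (Suc j) (- u (Suc j) x)
      = - u j (W (Suc (p + j)) x) + - d j (U (Suc (p + j)) x)"
    unfolding e by (simp only: minus_add_distrib)
qed

lemma Af_lift_zero: "Af_lift p (\<lambda>k y. 0) (\<lambda>j x. 0) (\<lambda>j x. 0)"
proof -
  have z: "U m 0 = 0" "W m 0 = 0" for m
    using UW_add[OF P_simps(1) P_simps(1), of m] by (simp_all only: add_0_left add_cancel_right_right)
  have "(\<lambda>k. a \<odot> (0 :: nat \<Rightarrow> nat \<Rightarrow> 'a) k) = 0" for a by (auto simp: smul_simps fun_eq_iff[of _ 0])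
  then have "Af_pair p m (\<lambda>x. 0) (\<lambda>x. 0)" for p m
    unfolding Af_pair_def by (intro conjI) (simp_all only: zero_hom P_module P_simps(1) fP_simps diff_0_right add_0_left simp_thms, auto)
  then show ?thesis
    unfolding Af_lift_def by (simp only: z add_0_left zero_fun_apply QhomD(5)[OF aug_hom] sum.neutral_const) simp
qed

lemma Af_lift_sum:
  assumes "finite K" "\<And>s. s \<in> K \<Longrightarrow> Af_lift p (g s) (u s) (d s)"
  shows "Af_lift p (\<lambda>k y. \<Sum>s\<in>K. g s k y) (\<lambda>j x. \<Sum>s\<in>K. u s j x) (\<lambda>j x. \<Sum>s\<in>K. d s j x)"
  using assms
proof (induction K)
  case empty
  then show ?case using Af_lift_zero by (simp only: sum.empty)
next
  case (insert s K)
  have "Af_lift p (\<lambda>k y. g s k y + (\<Sum>s\<in>K. g s k y)) (\<lambda>j x. u s j x + (\<Sum>s\<in>K. u s j x)) (\<lambda>j x. d s j x + (\<Sum>s\<in>K. d s j x))"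
    by (rule Af_lift_add) (use insert in auto)
  then show ?case using insert(1,2) by (simp only: sum.insert not_False_eq_True)
qed

text \<open>
  The difference of two liftings of \<open>g\<close> lifts zero, so it has values in the radical and disappears under
  the homomorphisms \<open>h\<^sub>i\<close>.
\<close>

lemma yoneda_Af_eq:
  assumes g: "\<And>k. k \<le> p \<Longrightarrow> g k \<in> hom (Qres e R k) S" and h: "\<And>i. i \<le> m \<Longrightarrow> h i \<in> hom (Qres e R i) S"
    and L: "Af_lift p g u d"
  shows "yoneda_Af sc e f R C m (hat_elem e R m h) p (hat_elem e R p g)
    = (0, restr0 (P (p + m)) (\<lambda>x. \<Sum>i\<le>m. h i (u m x i)), 0)"
proof -
  have comp: "Af_comp (hat_elem e R m h) (u m, d m, u m) = (0, restr0 (P (p + m)) (\<lambda>x. \<Sum>i\<le>m. h i (u m x i)), 0)"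
    if "Af_lift p g u d" for u d
  proof -
    note u = Af_pairD(1)[OF Af_liftD(1)[OF that, of m]]
    have h0: "(\<Sum>i\<le>m. h i 0) = 0" using QhomD(5)[OF h] by (intro sum.neutral) auto
    have "restr0 (P m) (\<lambda>x. \<Sum>i\<le>m. h i (x i)) (u m x) = restr0 (P (p + m)) (\<lambda>x. \<Sum>i\<le>m. h i (u m x i)) x" for x
      using PhomD(1,4)[OF u, of x] by (cases "x \<in> P (p + m)") (simp_all add: restr0_def h0)
    then show ?thesis by (simp add: Af_comp_def hat_elem_def fun_eq_iff)
  qed
  note iff = lifting_Af_iff[of p g, OF g]
  show ?thesis
    unfolding yoneda_Af_def
  proof (rule the_equality)
    have "lifting_Af sc e f R C p (hat_elem e R p g) (\<lambda>j. (u j, d j, u j))"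
      using iff L by blast
    then show "\<exists>\<gamma>. lifting_Af sc e f R C p (hat_elem e R p g) \<gamma> \<and>
        (0, restr0 (P (p + m)) (\<lambda>x. \<Sum>i\<le>m. h i (u m x i)), 0) = Af_comp (hat_elem e R m h) (\<gamma> m)"
      using comp[OF L] by (intro exI[of _ "\<lambda>j. (u j, d j, u j)"]) auto
  next
    fix w assume "\<exists>\<gamma>. lifting_Af sc e f R C p (hat_elem e R p g) \<gamma> \<and> w = Af_comp (hat_elem e R m h) (\<gamma> m)"
    then obtain u' d' where L': "Af_lift p g u' d'" and w: "w = Af_comp (hat_elem e R m h) (u' m, d' m, u' m)"
      using iff by auto
    have N: "Af_lift p (\<lambda>k y. 0) (\<lambda>j x. u j x + - u' j x) (\<lambda>j x. d j x + - d' j x)"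
      using Af_lift_add[OF L Af_lift_neg[OF L']] by simp
    have "h i (u' m x i) = h i (u m x i)" if x: "x \<in> P (p + m)" and i: "i \<le> m" for x i
    proof -
      have "(u m x + - u' m x) i \<in> rad i" by (rule null_lift_in_rad[OF N x i])
      then have "u m x i - u' m x i \<in> rad i" by simp
      then have "h i (u m x i - u' m x i) = 0" using hom_S_rad[OF h[OF i]] by blast
      moreover have "u m x i \<in> Q i" "u' m x i \<in> Q i"
        using P_D[OF PhomD(1)[OF Af_pairD(1)[OF Af_liftD(1)[OF L]] x] i] P_D[OF PhomD(1)[OF Af_pairD(1)[OF Af_liftD(1)[OF L']] x] i] by auto
      ultimately show ?thesis using QhomD(7)[OF h[OF i]] by simp
    qed
    then have "(\<Sum>i\<le>m. h i (u' m x i)) = (\<Sum>i\<le>m. h i (u m x i))" if "x \<in> P (p + m)" for x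
      using that by (intro sum.cong) auto
    then have "restr0 (P (p + m)) (\<lambda>x. \<Sum>i\<le>m. h i (u' m x i)) = restr0 (P (p + m)) (\<lambda>x. \<Sum>i\<le>m. h i (u m x i))"
      by (auto simp: restr0_def fun_eq_iff)
    then show "w = (0, restr0 (P (p + m)) (\<lambda>x. \<Sum>i\<le>m. h i (u m x i)), 0)"
      unfolding w comp[OF L'] by simp
  qed
qed

end

section \<open>The lifting of a monomial\<close>

lemma additive_of_int_mult:
  assumes A: "\<And>x y. x \<in> A \<Longrightarrow> y \<in> A \<Longrightarrow> \<phi> (x + y) = \<phi> x + (\<phi> y :: nat \<Rightarrow> 'a::ring_1)"
    and x: "\<And>c. of_int c \<odot> (x :: nat \<Rightarrow> 'a) \<in> A"
  shows "\<phi> (of_int c \<odot> x) = of_int c \<odot> \<phi> x"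
proof -
  have x1: "x \<in> A" using x[of 1] by (simp add: smul_simps)
  have z: "0 \<in> A" using x[of 0] by (simp only: of_int_0 smul_simps)
  have "\<phi> (0 + 0) = \<phi> 0 + \<phi> 0" by (rule A[OF z z])
  then have z0: "\<phi> 0 = 0" by (simp only: add_0_left add_cancel_right_right)
  have st: "\<phi> (of_int (c + 1) \<odot> x) = \<phi> (of_int c \<odot> x) + \<phi> x" for c
    using A[OF x[of c] x1] by (simp only: of_int_add of_int_1 smul_simps)
  show ?thesis
  proof (induction c rule: int_induct[where k = 0])
    case base
    then show ?case by (simp only: of_int_0 smul_simps z0)
  next
    case (step1 i)
    then show ?case unfolding st by (simp only: of_int_add of_int_1 smul_simps)
  next
    case (step2 i)
    have "\<phi> (of_int (i - 1) \<odot> x) = \<phi> (of_int i \<odot> x) - \<phi> x"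
      using st[of "i - 1"] by (simp only: diff_add_cancel add_diff_cancel)
    then show ?case using step2 by (simp only: of_int_diff of_int_1 smul_simps)
  qed
qed

lemma smul_of_int_commute: "a \<odot> of_int c \<odot> x = of_int c \<odot> a \<odot> x"
  by (simp only: mult_of_int_commute flip: smul_simps(3))

context star_setting
begin

lemma fQ_of_int: "x \<in> Q k \<Longrightarrow> fQ k a (of_int c \<odot> x) = of_int c \<odot> fQ k a x"
  by (rule additive_of_int_mult[where A = "Q k"]) (simp_all only: fQ_simps Q_simps(3))

lemma T'_of_int: "x \<in> Q (Suc k) \<Longrightarrow> T' k (of_int c \<odot> x) = of_int c \<odot> T' k x"
  by (rule additive_of_int_mult[where A = "Q (Suc k)"]) (simp_all only: twistedD(3)[OF T'_twisted] Q_simps(3))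

text \<open>
  The explicit lifting of \<open>g x\<^bsup>p-s\<^esup>\<close>.  It combines the liftings \<open>\<gamma>\<^sub>l\<close> of \<open>g T\<^bsub>s+1\<^esub> \<cdots> T\<^sub>l\<close> and the twisted maps
  \<open>\<theta>\<^sub>l\<close> over them from \<open>deformed_lift\<close>.  Component \<open>i\<close> of the value in degree \<open>j\<close> collects the summands \<open>Q\<^bsub>l+i\<^esub> x\<^sup>a\<close>
  of degree \<open>p + j\<close>, so \<open>a = p + j - i - l\<close>.  For \<open>l < s\<close> the coefficients vanish and \<open>\<gamma>\<^sub>l\<close>, \<open>\<theta>\<^sub>l\<close> are fillers
  that allow all sums to start at 0.
\<close>

lemma monomial_lift:
  assumes s: "s \<le> p" and g: "g \<in> hom (Qres e R s) S"
  obtains \<gamma> u d where "\<And>l. s \<le> l \<Longrightarrow> A_lift l (T_comp e f R C g s (l - s)) (\<gamma> l)"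
    "Af_lift p (\<lambda>k. if k = s then g else (\<lambda>y. 0)) u d"
    "\<And>j x i. x \<in> P (p + j) \<Longrightarrow> i \<le> j \<Longrightarrow>
       u j x i = (\<Sum>l\<le>p + j - i. of_int (lift_coeff p s l (p + j - i - l)) \<odot> \<gamma> l i (x (l + i)))"
proof -
  define G where "G l = (if l < s then (\<lambda>y. 0) else T_comp e f R C g s (l - s))" for l
  have G: "G l \<in> hom (Qres e R l) S" for l
    using T_comp_Ext[of g s "l - s"] g zero_hom[OF S_module] by (auto simp: G_def Ext_A_def)
  have GT: "G (Suc l) = G l \<circ> T l" if "s \<le> l" for l
    using that by (simp add: G_def Suc_diff_le)
  have "\<forall>l. \<exists>\<gamma>. A_lift l (G l) \<gamma>" using A_lift_exists[OF G] by blast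
  then obtain \<gamma> where L: "\<And>l. A_lift l (G l) (\<gamma> l)" by metis
  note ga = A_liftD(1)[OF L]
  have "\<exists>d. (\<forall>j. twisted (l + j) j (\<gamma> l j) (d j)) \<and>
    (s \<le> l \<longrightarrow> (\<forall>j. \<forall>x\<in>Q (Suc (l + j)). dl j (d (Suc j) x) + T' j (\<gamma> l (Suc j) x)
       = d j (dl (l + j) x) + \<gamma> l j (T' (l + j) x) + (- 1) ^ Suc (l + j) \<odot> \<gamma> (Suc l) j x))" for l
  proof (cases "s \<le> l")
    case True
    have "A_lift (Suc l) (G l \<circ> T l) (\<gamma> (Suc l))" using L[of "Suc l"] GT[OF True] by simp
    from deformed_lift[OF G L this] show ?thesis by blast
  next
    case False
    then show ?thesis using twist_twisted[OF ga[of l]] by (intro exI[of _ "\<lambda>j. twist (l + j) j (\<gamma> l j)"]) simp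
  qed
  then obtain \<theta> where th: "\<And>l j. twisted (l + j) j (\<gamma> l j) (\<theta> l j)"
    and rel: "\<And>l j x. s \<le> l \<Longrightarrow> x \<in> Q (Suc (l + j)) \<Longrightarrow> dl j (\<theta> l (Suc j) x) + T' j (\<gamma> l (Suc j) x)
       = \<theta> l j (dl (l + j) x) + \<gamma> l j (T' (l + j) x) + (- 1) ^ Suc (l + j) \<odot> \<gamma> (Suc l) j x"
    by metis
  define K where "K N l = (of_int (lift_coeff p s l (N - l)) :: 'a)" for N l
  have Kc: "a \<odot> K N l \<odot> x = K N l \<odot> a \<odot> x" for a N l x
    by (simp only: K_def smul_of_int_commute)
  define u where "u j = restr0 (P (p + j)) (\<lambda>x i. if i \<le> j then (\<Sum>l\<le>p + j - i. K (p + j - i) l \<odot> \<gamma> l i (x (l + i))) else 0)" for j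
  define d where "d j = restr0 (P (p + j)) (\<lambda>x i. if i \<le> j then (\<Sum>l\<le>p + j - i. K (p + j - i) l \<odot> \<theta> l i (x (l + i))) else 0)" for j
  have u: "u j x i = (\<Sum>l\<le>p + j - i. K (p + j - i) l \<odot> \<gamma> l i (x (l + i)))"
    and d: "d j x i = (\<Sum>l\<le>p + j - i. K (p + j - i) l \<odot> \<theta> l i (x (l + i)))"
    if "x \<in> P (p + j)" "i \<le> j" for j x i
    using that by (simp_all add: u_def d_def restr0_def)
  have ud0: "u j x i = 0" "d j x i = 0" if "\<not> i \<le> j \<or> x \<notin> P (p + j)" for j x i
    using that by (auto simp: u_def d_def restr0_def)
  have xQ: "x (l + i) \<in> Q (l + i)" if "x \<in> P (p + j)" "i \<le> j" "l \<le> p + j - i" for x l i j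
    using P_D[OF that(1), of "l + i"] that by simp
  have gQ: "\<gamma> l i (x (l + i)) \<in> Q i" "\<theta> l i (x (l + i)) \<in> Q i" if "x \<in> P (p + j)" "i \<le> j" "l \<le> p + j - i" for x l i j
    using QhomD(1)[OF ga xQ[OF that]] twistedD(2)[OF th xQ[OF that]] by auto
  have uP: "u j x \<in> P j" "d j x \<in> P j" if "x \<in> P (p + j)" for j x
    unfolding P_iff[of "u j x"] P_iff[of "d j x"]
    using gQ[OF that] by (auto simp: u[OF that] d[OF that] ud0 intro!: Q_sum Q_simps(3))
  have pair: "Af_pair (p + j) j (u j) (d j)" for j
  proof -
    have hom: "u j \<in> hom (Psum e R (p + j)) (Psum e R j)"
      unfolding hom_def P_act
    proof (intro CollectI conjI ballI allI impI)
      show "u j x \<in> P j" if "x \<in> P (p + j)" for x by (rule uP(1)[OF that])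
      show "u j x = 0" if "x \<notin> P (p + j)" for x using that by (simp add: u_def restr0_def)
      show "u j (x + y) = u j x + u j y" if x: "x \<in> P (p + j)" and y: "y \<in> P (p + j)" for x y
      proof
        fix i show "u j (x + y) i = (u j x + u j y) i"
        proof (cases "i \<le> j")
          case True
          have "u j (x + y) i = (\<Sum>l\<le>p + j - i. K (p + j - i) l \<odot> \<gamma> l i (x (l + i)) + K (p + j - i) l \<odot> \<gamma> l i (y (l + i)))"
            unfolding u[OF P_simps(2)[OF x y] True]
            by (intro sum.cong) (simp_all add: QhomD(2)[OF ga xQ[OF x True] xQ[OF y True]] smul_simps)
          then show ?thesis by (simp add: u x y True sum.distrib)
        qed (simp add: ud0)
      qed
      show "u j (\<lambda>k. a \<odot> x k) = (\<lambda>k. a \<odot> u j x k)" if x: "x \<in> P (p + j)" for a x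
      proof
        fix i show "u j (\<lambda>k. a \<odot> x k) i = a \<odot> u j x i"
        proof (cases "i \<le> j")
          case True
          have "u j (\<lambda>k. a \<odot> x k) i = (\<Sum>l\<le>p + j - i. a \<odot> K (p + j - i) l \<odot> \<gamma> l i (x (l + i)))"
            unfolding u[OF P_simps(3)[OF x] True]
            by (intro sum.cong) (simp_all add: QhomD(3)[OF ga xQ[OF x True]] Q_act Kc)
          then show ?thesis by (simp add: u x True smul_sum)
        qed (simp add: ud0 smul_simps)
      qed
    qed
    moreover have "d j (x + y) = d j x + d j y" if x: "x \<in> P (p + j)" and y: "y \<in> P (p + j)" for x y
    proof
      fix i show "d j (x + y) i = (d j x + d j y) i"
      proof (cases "i \<le> j")
        case True
        have "d j (x + y) i = (\<Sum>l\<le>p + j - i. K (p + j - i) l \<odot> \<theta> l i (x (l + i)) + K (p + j - i) l \<odot> \<theta> l i (y (l + i)))"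
          unfolding d[OF P_simps(2)[OF x y] True]
          by (intro sum.cong) (simp_all add: twistedD(3)[OF th xQ[OF x True] xQ[OF y True]] smul_simps)
        then show ?thesis by (simp add: d x y True sum.distrib)
      qed (simp add: ud0)
    qed
    moreover have "d j (\<lambda>k. a \<odot> x k) = (\<lambda>k. a \<odot> d j x k) - u j (fP (p + j) a x) + fP j a (u j x)"
      if x: "x \<in> P (p + j)" for a x
    proof
      fix i show "d j (\<lambda>k. a \<odot> x k) i = ((\<lambda>k. a \<odot> d j x k) - u j (fP (p + j) a x) + fP j a (u j x)) i"
      proof (cases "i \<le> j")
        case True
        let ?N = "p + j - i"
        have "d j (\<lambda>k. a \<odot> x k) i = (\<Sum>l\<le>?N. a \<odot> K ?N l \<odot> \<theta> l i (x (l + i)) - K ?N l \<odot> \<gamma> l i (fQ (l + i) a (x (l + i)))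
            + fQ i a (K ?N l \<odot> \<gamma> l i (x (l + i))))"
          unfolding d[OF P_simps(3)[OF x] True]
        proof (intro sum.cong refl)
          fix l assume "l \<in> {..?N}"
          then have l: "l \<le> ?N" by simp
          have "fQ i a (K ?N l \<odot> \<gamma> l i (x (l + i))) = K ?N l \<odot> fQ i a (\<gamma> l i (x (l + i)))"
            unfolding K_def by (rule fQ_of_int[OF gQ(1)[OF x True l]])
          then show "K ?N l \<odot> \<theta> l i (a \<odot> x (l + i)) = a \<odot> K ?N l \<odot> \<theta> l i (x (l + i))
              - K ?N l \<odot> \<gamma> l i (fQ (l + i) a (x (l + i))) + fQ i a (K ?N l \<odot> \<gamma> l i (x (l + i)))"
            by (simp add: twistedD(4)[OF th xQ[OF x True l]] smul_simps Kc)
        qed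
        also have "\<dots> = a \<odot> d j x i - (\<Sum>l\<le>?N. K ?N l \<odot> \<gamma> l i (fQ (l + i) a (x (l + i)))) + fQ i a (u j x i)"
          by (simp only: d[OF x True] u[OF x True] sum.distrib sum_subtractf smul_sum fQ_sum)
        also have "(\<Sum>l\<le>?N. K ?N l \<odot> \<gamma> l i (fQ (l + i) a (x (l + i)))) = u j (fP (p + j) a x) i"
          unfolding u[OF fP_in True] by (intro sum.cong) (use True in \<open>auto simp: fP_def\<close>)
        finally have "d j (\<lambda>k. a \<odot> x k) i = a \<odot> d j x i - u j (fP (p + j) a x) i + fQ i a (u j x i)" .
        moreover have "fP j a (u j x) i = fQ i a (u j x i)" using True by (simp add: fP_def)
        ultimately show ?thesis by (simp only: plus_fun_apply minus_apply)
      qed (simp add: ud0 smul_simps fP_def)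
    qed
    moreover have "d j x = 0" if "x \<notin> P (p + j)" for x using that by (simp add: d_def restr0_def)
    ultimately show ?thesis using uP by (simp only: Af_pair_def simp_thms) blast
  qed
  have aug: "aug R (u 0 x 0) = (\<Sum>k\<le>p. (if k = s then g else (\<lambda>y. 0)) (x k))" if x: "x \<in> P p" for x
  proof -
    have "u 0 x 0 = (\<Sum>l\<le>p. K p l \<odot> \<gamma> l 0 (x l))" using u[of x 0 0] x by simp
    also have "\<dots> = (\<Sum>l\<le>p. if l = s then \<gamma> s 0 (x s) else 0)"
      by (intro sum.cong) (auto simp: K_def lift_coeff_start smul_simps)
    finally have "u 0 x 0 = \<gamma> s 0 (x s)" using s by simp
    moreover have "aug R (\<gamma> s 0 (x s)) = g (x s)" using A_liftD(2)[OF L P_D[OF x s]] by (simp add: G_def)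
    moreover have "(\<Sum>k\<le>p. (if k = s then g else (\<lambda>y. 0)) (x k)) = (\<Sum>k\<le>p. if k = s then g (x s) else 0)"
      by (intro sum.cong) auto
    ultimately show ?thesis using s by simp
  qed
  have chain: "U (Suc j) (u (Suc j) x) = u j (U (Suc (p + j)) x) \<and>
        U (Suc j) (d (Suc j) x) + W (Suc j) (u (Suc j) x) = u j (W (Suc (p + j)) x) + d j (U (Suc (p + j)) x)"
    if x: "x \<in> P (Suc (p + j))" for j x
  proof -
    have xS: "x \<in> P (p + Suc j)" using x by simp
    note Ux = U_in[OF x] and Wx = W_in[OF x]
    define y where "y i l = x (Suc (l + i))" for i l
    have comp: "U (Suc j) (u (Suc j) x) i = u j (U (Suc (p + j)) x) i"
      "(U (Suc j) (d (Suc j) x) + W (Suc j) (u (Suc j) x)) i = (u j (W (Suc (p + j)) x) + d j (U (Suc (p + j)) x)) i"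
      if i: "i \<le> j" for i
    proof -
      \<comment> \<open>The largest \<open>l\<close> that occurs in component \<open>i\<close> of a value in degree \<open>j\<close>, and in component \<open>i + 1\<close> in degree \<open>j + 1\<close>.\<close>
      define N where "N = p + j - i"
      have N: "p \<le> N" "p + Suc j - Suc i = N" "p + Suc j - i = Suc N" "p + j - i = N"
        using i by (simp_all add: N_def)
      have iS: "Suc i \<le> Suc j" "i \<le> Suc j" using i by simp_all
      have yQ: "y i l \<in> Q (Suc (l + i))" if "l \<le> N" for l
        using xQ[OF xS iS(1), of l] that by (simp add: y_def N)
      have uS: "u (Suc j) x (Suc i) = (\<Sum>l\<le>N. K N l \<odot> \<gamma> l (Suc i) (y i l))"
        and dS: "d (Suc j) x (Suc i) = (\<Sum>l\<le>N. K N l \<odot> \<theta> l (Suc i) (y i l))"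
        using u[OF xS iS(1)] d[OF xS iS(1)] by (simp_all add: y_def N)
      have gS: "\<gamma> l (Suc i) (y i l) \<in> Q (Suc i)" "\<theta> l (Suc i) (y i l) \<in> Q (Suc i)" if "l \<le> N" for l
        using gQ[OF xS iS(1), of l] that by (simp_all add: y_def N)
      have Uxl: "U (Suc (p + j)) x (l + i) = dl (l + i) (y i l)" if "l \<le> N" for l
      proof -
        have "l + i < Suc (p + j)" using that i unfolding N_def by linarith
        then show ?thesis by (simp add: U_def y_def)
      qed
      have Wxl: "W (Suc (p + j)) x (l + i) = (- 1) ^ (l + i) \<odot> x (l + i) + T' (l + i) (y i l)" if "l \<le> N" for l
      proof -
        have "l + i < Suc (p + j)" using that i unfolding N_def by linarith
        then show ?thesis by (simp add: W_def y_def)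
      qed
      have dlsum: "dl i (\<Sum>l\<le>N. K N l \<odot> z l) = (\<Sum>l\<le>N. K N l \<odot> dl i (z l))" if "\<And>l. l \<le> N \<Longrightarrow> z l \<in> Q (Suc i)" for z
      proof -
        have "dl i (\<Sum>l\<le>N. K N l \<odot> z l) = (\<Sum>l\<le>N. dl i (K N l \<odot> z l))"
          by (rule QhomD(8)[OF dl_hom]) (simp add: Q_simps(3) that)
        then show ?thesis using that by (simp add: QhomD(3)[OF dl_hom] Q_act)
      qed
      have Tsum: "T' i (\<Sum>l\<le>N. K N l \<odot> z l) = (\<Sum>l\<le>N. K N l \<odot> T' i (z l))" if "\<And>l. l \<le> N \<Longrightarrow> z l \<in> Q (Suc i)" for z
      proof -
        have "T' i (\<Sum>l\<le>N. K N l \<odot> z l) = (\<Sum>l\<le>N. T' i (K N l \<odot> z l))"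
          by (rule twisted_sum[OF T'_twisted]) (simp add: Q_simps(3) that)
        then show ?thesis using that by (simp add: K_def T'_of_int)
      qed
      have "U (Suc j) (u (Suc j) x) i = dl i (\<Sum>l\<le>N. K N l \<odot> \<gamma> l (Suc i) (y i l))"
        using i by (simp add: U_def uS)
      also have "\<dots> = (\<Sum>l\<le>N. K N l \<odot> \<gamma> l i (dl (l + i) (y i l)))"
        by (subst dlsum) (auto intro!: gS(1) sum.cong simp: A_liftD(3)[OF L yQ])
      also have "\<dots> = u j (U (Suc (p + j)) x) i"
        unfolding u[OF Ux i] N by (simp add: Uxl)
      finally show "U (Suc j) (u (Suc j) x) i = u j (U (Suc (p + j)) x) i" .
      define z where "z l = \<gamma> l i (x (l + i))" for l
      have kc: "(- 1) ^ i \<odot> (\<Sum>l\<le>Suc N. K (Suc N) l \<odot> z l)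
            + (\<Sum>l\<le>N. K N l \<odot> (- 1) ^ Suc (l + i) \<odot> z (Suc l)) = (\<Sum>l\<le>N. K N l \<odot> (- 1) ^ (l + i) \<odot> z l)"
        unfolding K_def by (rule lift_coeff_cancel[OF N(1)])
      have rel': "K N l \<odot> dl i (\<theta> l (Suc i) (y i l)) + K N l \<odot> T' i (\<gamma> l (Suc i) (y i l))
          = K N l \<odot> \<theta> l i (dl (l + i) (y i l)) + K N l \<odot> \<gamma> l i (T' (l + i) (y i l)) + K N l \<odot> (- 1) ^ Suc (l + i) \<odot> z (Suc l)"
        if l: "l \<le> N" for l
      proof (cases "s \<le> l")
        case True
        have "\<gamma> (Suc l) i (y i l) = z (Suc l)" by (simp add: z_def y_def)
        then show ?thesis using rel[OF True yQ[OF l]] by (simp only: flip: smul_simps(1))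
      next
        case False
        then have "K N l = 0" by (simp add: K_def lift_coeff_below)
        then show ?thesis by (simp only: smul_simps add_0_left)
      qed
      have dl\<theta>: "dl i (\<Sum>l\<le>N. K N l \<odot> \<theta> l (Suc i) (y i l)) = (\<Sum>l\<le>N. K N l \<odot> dl i (\<theta> l (Suc i) (y i l)))"
        by (rule dlsum) (rule gS(2))
      have T\<gamma>: "T' i (\<Sum>l\<le>N. K N l \<odot> \<gamma> l (Suc i) (y i l)) = (\<Sum>l\<le>N. K N l \<odot> T' i (\<gamma> l (Suc i) (y i l)))"
        by (rule Tsum) (rule gS(1))
      have "(U (Suc j) (d (Suc j) x) + W (Suc j) (u (Suc j) x)) i
          = dl i (d (Suc j) x (Suc i)) + ((- 1) ^ i \<odot> u (Suc j) x i + T' i (u (Suc j) x (Suc i)))"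
        using i by (simp add: U_def W_def)
      also have "\<dots> = (- 1) ^ i \<odot> (\<Sum>l\<le>Suc N. K (Suc N) l \<odot> z l)
          + (\<Sum>l\<le>N. K N l \<odot> dl i (\<theta> l (Suc i) (y i l)) + K N l \<odot> T' i (\<gamma> l (Suc i) (y i l)))"
        unfolding uS dS dl\<theta> T\<gamma> u[OF xS iS(2)] N z_def sum.distrib by (simp only: ac_simps)
      also have "(\<Sum>l\<le>N. K N l \<odot> dl i (\<theta> l (Suc i) (y i l)) + K N l \<odot> T' i (\<gamma> l (Suc i) (y i l)))
          = (\<Sum>l\<le>N. K N l \<odot> \<theta> l i (dl (l + i) (y i l)) + K N l \<odot> \<gamma> l i (T' (l + i) (y i l)) + K N l \<odot> (- 1) ^ Suc (l + i) \<odot> z (Suc l))"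
        by (intro sum.cong refl rel') simp
      also have "(- 1) ^ i \<odot> (\<Sum>l\<le>Suc N. K (Suc N) l \<odot> z l) + \<dots>
          = (\<Sum>l\<le>N. K N l \<odot> (- 1) ^ (l + i) \<odot> z l) + (\<Sum>l\<le>N. K N l \<odot> \<gamma> l i (T' (l + i) (y i l)))
            + (\<Sum>l\<le>N. K N l \<odot> \<theta> l i (dl (l + i) (y i l)))"
        unfolding sum.distrib kc[symmetric] by (simp only: ac_simps)
      also have "(\<Sum>l\<le>N. K N l \<odot> \<theta> l i (dl (l + i) (y i l))) = d j (U (Suc (p + j)) x) i"
        unfolding d[OF Ux i] N by (simp add: Uxl)
      also have "(\<Sum>l\<le>N. K N l \<odot> (- 1) ^ (l + i) \<odot> z l) + (\<Sum>l\<le>N. K N l \<odot> \<gamma> l i (T' (l + i) (y i l)))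
          = u j (W (Suc (p + j)) x) i"
      proof -
        have "\<gamma> l i (W (Suc (p + j)) x (l + i)) = (- 1) ^ (l + i) \<odot> z l + \<gamma> l i (T' (l + i) (y i l))" if l: "l \<le> N" for l
        proof -
          have "l \<le> p + Suc j - i" using l N(3) by linarith
          then have q: "x (l + i) \<in> Q (l + i)" "T' (l + i) (y i l) \<in> Q (l + i)"
            using xQ[OF xS iS(2)] twistedD(2)[OF T'_twisted yQ[OF l]] by blast+
          then show ?thesis
            unfolding Wxl[OF l] z_def
            by (simp only: QhomD(2)[OF ga Q_simps(3)[OF q(1)] q(2)] QhomD(3)[OF ga q(1)] Q_act)
        qed
        then show ?thesis unfolding u[OF Wx i] N sum.distrib[symmetric] by (simp add: smul_simps(1))
      qed
      finally show "(U (Suc j) (d (Suc j) x) + W (Suc j) (u (Suc j) x)) i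
          = (u j (W (Suc (p + j)) x) + d j (U (Suc (p + j)) x)) i"
        by (rule trans) (rule plus_fun_apply[symmetric])
    qed
    have out: "U (Suc j) (u (Suc j) x) i = u j (U (Suc (p + j)) x) i"
      "(U (Suc j) (d (Suc j) x) + W (Suc j) (u (Suc j) x)) i = (u j (W (Suc (p + j)) x) + d j (U (Suc (p + j)) x)) i"
      if i: "\<not> i \<le> j" for i
      using i by (simp_all add: ud0 U_def W_def)
    show ?thesis using comp out by (meson ext)
  qed
  show thesis
  proof
    show "A_lift l (T_comp e f R C g s (l - s)) (\<gamma> l)" if "s \<le> l" for l
      using L[of l] that by (simp add: G_def)
    show "Af_lift p (\<lambda>k. if k = s then g else (\<lambda>y. 0)) u d"
      unfolding Af_lift_def by (intro conjI allI ballI pair aug) (use chain in blast)+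
    show "u j x i = (\<Sum>l\<le>p + j - i. of_int (lift_coeff p s l (p + j - i - l)) \<odot> \<gamma> l i (x (l + i)))"
      if "x \<in> P (p + j)" "i \<le> j" for j x i
      using u[OF that] by (simp add: K_def)
  qed
qed

end

section \<open>The product formula\<close>

lemma triple_sum: "(\<Sum>k\<in>K. (0, F k, 0)) = (0, \<Sum>k\<in>K. F k, 0)"
  by (induction K rule: infinite_finite_induct) (simp_all add: zero_prod_def)

lemma restr0_sum: "(\<Sum>k\<in>K. restr0 X (\<phi> k)) = restr0 X (\<lambda>x. \<Sum>k\<in>K. \<phi> k x)"
  by (rule ext, subst sum_apply) (simp add: restr0_def)

context star_setting
begin

lemma hat_monom_eq: "hat_monom e R k \<phi> j = (0, restr0 (P (k + j)) (\<lambda>x. \<phi> (x k)), 0)"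
proof -
  have "(\<Sum>i\<le>k + j. (if i = k then \<phi> else 0) (x i)) = \<phi> (x k)" for x
  proof -
    have "(\<Sum>i\<le>k + j. (if i = k then \<phi> else 0) (x i)) = (\<Sum>i\<le>k + j. if i = k then \<phi> (x k) else 0)"
      by (intro sum.cong) auto
    then show ?thesis by simp
  qed
  then show ?thesis by (simp add: hat_monom_def hat_elem_def)
qed

lemma yoneda_monom:
  assumes i: "i \<le> m" and s: "s \<le> p" and h: "h \<in> hom (Qres e R i) S" and g: "g \<in> hom (Qres e R s) S"
    and L: "Af_lift p (\<lambda>k. if k = s then g else (\<lambda>y. 0)) u d"
  shows "yoneda_Af sc e f R C m (hat_monom e R i h (m - i)) p (hat_monom e R s g (p - s))
    = (0, restr0 (P (p + m)) (\<lambda>x. h (u m x i)), 0)"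
proof -
  have z: "(0 :: (nat \<Rightarrow> 'a) \<Rightarrow> 's) = (\<lambda>y. 0)" by (simp add: fun_eq_iff)
  have "yoneda_Af sc e f R C m (hat_elem e R m (\<lambda>k. if k = i then h else 0)) p (hat_elem e R p (\<lambda>k. if k = s then g else 0))
      = (0, restr0 (P (p + m)) (\<lambda>x. \<Sum>k\<le>m. (if k = i then h else 0) (u m x k)), 0)"
  proof (rule yoneda_Af_eq)
    show "Af_lift p (\<lambda>k. if k = s then g else 0) u d" unfolding z by (rule L)
  qed (use h g zero_hom[OF S_module] in \<open>auto simp: z\<close>)
  moreover have "(\<Sum>k\<le>m. (if k = i then h else 0) (v k)) = h (v i)" for v :: "nat \<Rightarrow> nat \<Rightarrow> 'a"
  proof -
    have "(\<Sum>k\<le>m. (if k = i then h else 0) (v k)) = (\<Sum>k\<le>m. if k = i then h (v i) else 0)"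
      by (intro sum.cong) auto
    then show ?thesis using i by simp
  qed
  ultimately show ?thesis using i s by (simp add: hat_monom_def)
qed

text \<open>
  Liftings may be added, and by \<open>yoneda_Af_eq\<close> any lifting computes the product.
\<close>

lemma yoneda_bilinear:
  assumes g: "\<And>s. s \<le> p \<Longrightarrow> g s \<in> hom (Qres e R s) S" and h: "\<And>i. i \<le> m \<Longrightarrow> h i \<in> hom (Qres e R i) S"
  shows "yoneda_Af sc e f R C m (hat_elem e R m h) p (hat_elem e R p g) =
    (\<Sum>i\<le>m. \<Sum>s\<le>p. yoneda_Af sc e f R C m (hat_monom e R i (h i) (m - i)) p (hat_monom e R s (g s) (p - s)))"
proof -
  have "\<exists>u d. s \<le> p \<longrightarrow> Af_lift p (\<lambda>k. if k = s then g s else (\<lambda>y. 0)) u d" for s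
    using monomial_lift[OF _ g] by (metis (no_types))
  then obtain u d where L: "\<And>s. s \<le> p \<Longrightarrow> Af_lift p (\<lambda>k. if k = s then g s else (\<lambda>y. 0)) (u s) (d s)" by metis
  have "Af_lift p (\<lambda>k y. \<Sum>s\<le>p. (if k = s then g s else (\<lambda>y. 0)) y) (\<lambda>j x. \<Sum>s\<le>p. u s j x) (\<lambda>j x. \<Sum>s\<le>p. d s j x)"
    by (rule Af_lift_sum) (use L in auto)
  moreover have "(\<Sum>k\<le>p. \<Sum>s\<le>p. (if k = s then g s else (\<lambda>y. 0)) (x k)) = (\<Sum>k\<le>p. g k (x k))" for x
  proof (intro sum.cong refl)
    fix k assume "k \<in> {..p}"
    moreover have "(\<Sum>s\<le>p. (if k = s then g s else (\<lambda>y. 0)) (x k)) = (\<Sum>s\<le>p. if k = s then g k (x k) else 0)"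
      by (intro sum.cong) auto
    ultimately show "(\<Sum>s\<le>p. (if k = s then g s else (\<lambda>y. 0)) (x k)) = g k (x k)" by simp
  qed
  ultimately have LL: "Af_lift p g (\<lambda>j x. \<Sum>s\<le>p. u s j x) (\<lambda>j x. \<Sum>s\<le>p. d s j x)"
    by (simp only: Af_lift_def) blast
  have uQ: "u s m x i \<in> Q i" if "x \<in> P (p + m)" "s \<le> p" "i \<le> m" for s x i
    using P_D[OF PhomD(1)[OF Af_pairD(1)[OF Af_liftD(1)[OF L[OF that(2)]]] that(1)] that(3)] .
  have "(\<Sum>i\<le>m. h i ((\<Sum>s\<le>p. u s m x) i)) = (\<Sum>i\<le>m. \<Sum>s\<le>p. h i (u s m x i))" if x: "x \<in> P (p + m)" for x
  proof (intro sum.cong refl)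
    fix i assume "i \<in> {..m}"
    then show "h i ((\<Sum>s\<le>p. u s m x) i) = (\<Sum>s\<le>p. h i (u s m x i))"
      unfolding sum_apply[of "\<lambda>s. u s m x"] using uQ[OF x] by (intro QhomD(8)[OF h]) auto
  qed
  then have "restr0 (P (p + m)) (\<lambda>x. \<Sum>i\<le>m. h i ((\<Sum>s\<le>p. u s m x) i)) = restr0 (P (p + m)) (\<lambda>x. \<Sum>i\<le>m. \<Sum>s\<le>p. h i (u s m x i))"
    by (auto simp: restr0_def fun_eq_iff)
  then have "yoneda_Af sc e f R C m (hat_elem e R m h) p (hat_elem e R p g)
      = (0, restr0 (P (p + m)) (\<lambda>x. \<Sum>i\<le>m. \<Sum>s\<le>p. h i (u s m x i)), 0)"
    using yoneda_Af_eq[OF g h LL] by simp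
  also have "\<dots> = (\<Sum>i\<le>m. \<Sum>s\<le>p. (0, restr0 (P (p + m)) (\<lambda>x. h i (u s m x i)), 0))"
    by (simp only: triple_sum restr0_sum)
  also have "\<dots> = (\<Sum>i\<le>m. \<Sum>s\<le>p. yoneda_Af sc e f R C m (hat_monom e R i (h i) (m - i)) p (hat_monom e R s (g s) (p - s)))"
    by (intro sum.cong refl yoneda_monom[OF _ _ h g L, symmetric]) auto
  finally show ?thesis .
qed

text \<open>
  The homomorphism \<open>h x\<^bsup>m-i\<^esup>\<close> sees only the component in \<open>Q\<^sub>i\<close> of the lifting in degree \<open>m\<close>, and the \<open>l\<close>-th summand
  of this component is a multiple of \<open>\<gamma>\<^sub>l\<close>, which computes the product over \<open>A\<close> with \<open>g T\<^bsub>s+1\<^esub> \<cdots> T\<^sub>l\<close>.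
\<close>

lemma yoneda_formula:
  assumes i: "i \<le> m" and s: "s \<le> p" and h: "h \<in> hom (Qres e R i) S" and g: "g \<in> hom (Qres e R s) S"
  shows "yoneda_Af sc e f R C m (hat_monom e R i h (m - i)) p (hat_monom e R s g (p - s)) =
     hat_monom e R (i + s) (int_mult S ((-1) ^ (s * (m - i))) (yoneda_A e R i h s g)) (m + p - i - s)
     + (\<Sum>l = s + 1..m + p - i. hat_monom e R (i + l)
          (int_mult S (lift_coeff p s l (m + p - i - l)) (yoneda_A e R i h l (T_comp e f R C g s (l - s)))) (m + p - i - l))"
proof -
  obtain \<gamma> u d where L: "\<And>l. s \<le> l \<Longrightarrow> A_lift l (T_comp e f R C g s (l - s)) (\<gamma> l)"
    and A: "Af_lift p (\<lambda>k. if k = s then g else (\<lambda>y. 0)) u d"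
    and u: "\<And>j x i. x \<in> P (p + j) \<Longrightarrow> i \<le> j \<Longrightarrow>
       u j x i = (\<Sum>l\<le>p + j - i. of_int (lift_coeff p s l (p + j - i - l)) \<odot> \<gamma> l i (x (l + i)))"
    using monomial_lift[OF s g] by blast
  define N where "N = m + p - i"
  have N: "p + m - i = N" "s \<le> N" using i s by (simp_all add: N_def)
  let ?F = "\<lambda>l x. act S (of_int (lift_coeff p s l (N - l))) (h (\<gamma> l i (x (i + l))))"
  have yA: "yoneda_A e R i h l (T_comp e f R C g s (l - s)) = h \<circ> \<gamma> l i" if "s \<le> l" for l
    using yoneda_A_eq[OF _ h L[OF that]] T_comp_Ext[of g s "l - s"] g that by (simp add: Ext_A_def)
  have mon: "hat_monom e R (i + l) (int_mult S c (h \<circ> \<gamma> l i)) (N - l) = (0, restr0 (P (p + m)) (\<lambda>x. act S (of_int c) (h (\<gamma> l i (x (i + l))))), 0)"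
    if "l \<le> N" for l c
  proof -
    have "i + l + (N - l) = p + m" using that i by (simp add: N_def)
    then show ?thesis by (simp add: hat_monom_eq int_mult_def)
  qed
  have k1: "lift_coeff p s s (N - s) = (- 1) ^ (s * (m - i))"
  proof -
    have "N - s = p - s + (m - i)" using i s by (simp add: N_def)
    then show ?thesis using lift_coeff_diagonal[OF s] by simp
  qed
  have sp: "h (u m x i) = ?F s x + (\<Sum>l = s + 1..N. ?F l x)" if x: "x \<in> P (p + m)" for x
  proof -
    have ux: "u m x i = (\<Sum>l\<in>{s..N}. of_int (lift_coeff p s l (N - l)) \<odot> \<gamma> l i (x (i + l)))"
      unfolding u[OF x i] N
      by (rule sum.mono_neutral_cong_right) (auto simp: lift_coeff_below smul_simps add.commute)
    have q: "\<gamma> l i (x (i + l)) \<in> Q i" if l: "l \<in> {s..N}" for l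
    proof -
      have "l + i \<le> p + m" using l i by (auto simp: N_def)
      then have "x (l + i) \<in> Q (l + i)" by (rule P_D[OF x])
      then show ?thesis using QhomD(1)[OF A_liftD(1)[OF L]] l by (simp add: add.commute)
    qed
    have "h (u m x i) = (\<Sum>l\<in>{s..N}. h (of_int (lift_coeff p s l (N - l)) \<odot> \<gamma> l i (x (i + l))))"
      unfolding ux by (rule QhomD(8)[OF h]) (simp add: Q_simps(3) q)
    also have "\<dots> = (\<Sum>l\<in>{s..N}. ?F l x)"
      by (intro sum.cong refl QhomD(3)[OF h] q)
    also have "\<dots> = ?F s x + (\<Sum>l = s + 1..N. ?F l x)" using N(2) by (simp add: sum.atLeast_Suc_atMost)
    finally show ?thesis .
  qed
  have "yoneda_Af sc e f R C m (hat_monom e R i h (m - i)) p (hat_monom e R s g (p - s))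
      = (0, restr0 (P (p + m)) (\<lambda>x. h (u m x i)), 0)" by (rule yoneda_monom[OF i s h g A])
  also have "restr0 (P (p + m)) (\<lambda>x. h (u m x i)) = restr0 (P (p + m)) (?F s) + restr0 (P (p + m)) (\<lambda>x. \<Sum>l = s + 1..N. ?F l x)"
    using sp by (auto simp: restr0_def fun_eq_iff)
  also have "(0, \<dots>, 0) = (0, restr0 (P (p + m)) (?F s), 0) + (\<Sum>l = s + 1..N. (0, restr0 (P (p + m)) (?F l), 0))"
    unfolding triple_sum restr0_sum by simp
  also have "(0, restr0 (P (p + m)) (?F s), 0) = hat_monom e R (i + s) (int_mult S ((-1) ^ (s * (m - i))) (yoneda_A e R i h s g)) (N - s)"
    using yA[of s] mon[OF N(2)] k1 by simp
  also have "(\<Sum>l = s + 1..N. (0, restr0 (P (p + m)) (?F l), 0)) = (\<Sum>l = s + 1..N. hat_monom e R (i + l)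
          (int_mult S (lift_coeff p s l (N - l)) (yoneda_A e R i h l (T_comp e f R C g s (l - s)))) (N - l))"
    by (intro sum.cong refl) (simp add: yA mon)
  finally show ?thesis unfolding N_def .
qed

end

theorem theorem5p2:
  fixes sc :: "'k::alg_closed_field \<Rightarrow> 'a::ring_1 \<Rightarrow> 'a"
    and f :: "'a \<Rightarrow> 'a \<Rightarrow> 'a"
    and n :: nat and e :: "nat \<Rightarrow> 'a"
    and S :: "('a, 's::ab_group_add) lmod"
    and R :: "('a, 's) resolution"
    and C :: "nat \<Rightarrow> nat \<Rightarrow> nat \<Rightarrow> 'a"
  assumes "fd_algebra sc"
    and "hochschild_2_cocycle sc f"
    and "idempotent_decomposition n e"
    and "sum_of_simples n e S"
    and "star_resolution n e f S R"
    and "admissible_C e f R C"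
  shows
    "(\<forall>s l. \<forall>g \<in> Ext_A e S R s. s \<le> l \<longrightarrow> T_comp e f R C g s (l - s) \<in> Ext_A e S R l) \<and>
     (\<forall>p m. \<exists>c :: nat \<Rightarrow> nat \<Rightarrow> nat \<Rightarrow> int.
        (\<forall>g h. (\<forall>s\<le>p. g s \<in> Ext_A e S R s) \<and> (\<forall>i\<le>m. h i \<in> Ext_A e S R i) \<longrightarrow>
           yoneda_Af sc e f R C m (hat_elem e R m h) p (hat_elem e R p g) =
             (\<Sum>i\<le>m. \<Sum>s\<le>p.
                yoneda_Af sc e f R C m (hat_monom e R i (h i) (m - i))
                                     p (hat_monom e R s (g s) (p - s)))) \<and>
        (\<forall>i\<le>m. \<forall>s\<le>p. \<forall>h \<in> Ext_A e S R i. \<forall>g \<in> Ext_A e S R s.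
           yoneda_Af sc e f R C m (hat_monom e R i h (m - i)) p (hat_monom e R s g (p - s)) =
             hat_monom e R (i + s)
               (int_mult S ((-1) ^ (s * (m - i))) (yoneda_A e R i h s g)) (m + p - i - s)
             + (\<Sum>l = s + 1..m + p - i.
                 hat_monom e R (i + l)
                   (int_mult S (c i s l)
                      (yoneda_A e R i h l (T_comp e f R C g s (l - s)))) (m + p - i - l))))"
proof -
  interpret star_setting sc f n e S R C by unfold_locales (fact assms)+
  show ?thesis
  proof (intro conjI allI ballI impI)
    show "T_comp e f R C g s (l - s) \<in> Ext_A e S R l" if "g \<in> Ext_A e S R s" "s \<le> l" for s l g
      using T_comp_Ext[OF that(1), of "l - s"] that(2) by simp
  next
    fix p m
    show "\<exists>c :: nat \<Rightarrow> nat \<Rightarrow> nat \<Rightarrow> int.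
        (\<forall>g h. (\<forall>s\<le>p. g s \<in> Ext_A e S R s) \<and> (\<forall>i\<le>m. h i \<in> Ext_A e S R i) \<longrightarrow>
           yoneda_Af sc e f R C m (hat_elem e R m h) p (hat_elem e R p g) =
             (\<Sum>i\<le>m. \<Sum>s\<le>p.
                yoneda_Af sc e f R C m (hat_monom e R i (h i) (m - i))
                                     p (hat_monom e R s (g s) (p - s)))) \<and>
        (\<forall>i\<le>m. \<forall>s\<le>p. \<forall>h \<in> Ext_A e S R i. \<forall>g \<in> Ext_A e S R s.
           yoneda_Af sc e f R C m (hat_monom e R i h (m - i)) p (hat_monom e R s g (p - s)) =
             hat_monom e R (i + s)
               (int_mult S ((-1) ^ (s * (m - i))) (yoneda_A e R i h s g)) (m + p - i - s)
             + (\<Sum>l = s + 1..m + p - i.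
                 hat_monom e R (i + l)
                   (int_mult S (c i s l)
                      (yoneda_A e R i h l (T_comp e f R C g s (l - s)))) (m + p - i - l)))"
      using yoneda_bilinear[of p _ m] yoneda_formula[of _ m _ p]
      \<comment> \<open>The factor \<open>x\<^sup>a\<close> on which the \<open>l\<close>-th summand is evaluated has \<open>a = m + p - i - l\<close>.\<close>
      by (intro exI[of _ "\<lambda>i s l. lift_coeff p s l (m + p - i - l)"] conjI allI impI ballI)
        (simp_all add: Ext_A_def)
  qed
qed

end
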